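(* Let $k\ge 2$ be an integer, $\alpha\in(0,1)$, $L>0$, $\nu>0$, and let $u_0\in C^{k,\alpha}$ be a divergence free, spatially periodic, $\mathbb{R}^3$-valued vector field. Then there exist $T = T(k,\alpha,L,\nu,\|u_0\|_{k,\alpha})>0$ and a spatially periodic $u\in C^{k,\alpha}(\mathcal{I}\times[0,T])$ which is a solution of the Navier-Stokes equations $$\partial_t u + (u\cdot\nabla)u - \nu\Delta u + \nabla p = 0,\qquad \nabla\cdot u = 0$$ on $[0,T]$ with periodic boundary conditions and initial data $u_0$.
   Context: Let $\mathcal{I}=[0,L]^3$. For spatially periodic functions (period $L$ in each coordinate) define $|u|_\alpha = \sup_{x,y\in\mathcal I} L^\alpha \frac{|u(x)-u(y)|}{|x-y|^\alpha}$, $\|u\|_{C^k} = \sum_{|m|\le k} L^{|m|}\sup_{\mathcal I}|D^m u|$, and $\|u\|_{k,\alpha} = \|u\|_{C^k} + \sum_{|m|=k} L^k |D^m u|_\alpha$, where $m$ ranges over multi-indices. $C^{k,\alpha}$ is the space of spatially periodic functions with finite norm $\|\cdot\|_{k,\alpha}$. The notation $u\in C^{k,\alpha}(\mathcal I\times[0,T])$ imposes only a spatial regularity requirement ($u(\cdot,t)\in C^{k,\alpha}$ for $t\in[0,T]$); it asserts nothing about regularity in time. *)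

theory Defs
  imports "HOL-Analysis.Analysis"
begin

definition partial_deriv :: "3 \<Rightarrow> (real^3 \<Rightarrow> 'b::real_normed_vector) \<Rightarrow> real^3 \<Rightarrow> 'b" where
  "partial_deriv i f x = vector_derivative (\<lambda>h. f (x + h *\<^sub>R axis i 1)) (at 0)"

(* Total differentiability at each level makes the (total) operator partial_deriv meaningful;
   since the derivatives of top order are continuous this is the classical class C^k(R^3). *)
primrec C_class :: "nat \<Rightarrow> (real^3 \<Rightarrow> 'b::real_normed_vector) \<Rightarrow> bool" where
  "C_class 0 f \<longleftrightarrow> continuous_on UNIV f"
| "C_class (Suc k) f \<longleftrightarrow> (\<forall>x. f differentiable (at x)) \<and> (\<forall>i. C_class k (partial_deriv i f))"

definition mi_order :: "nat^3 \<Rightarrow> nat" where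
  "mi_order m = (\<Sum>i\<in>UNIV. m $ i)"

definition multi_deriv :: "nat^3 \<Rightarrow> (real^3 \<Rightarrow> 'b::real_normed_vector) \<Rightarrow> real^3 \<Rightarrow> 'b" where
  "multi_deriv m f =
     (partial_deriv 1 ^^ (m $ 1)) ((partial_deriv 2 ^^ (m $ 2)) ((partial_deriv 3 ^^ (m $ 3)) f))"

(* The sums below range over genuinely finite sets (an infinite sum would be 0 by convention). *)
lemma finite_mi_order_le: "finite {m. mi_order m \<le> k}"
proof (rule finite_subset)
  show "{m. mi_order m \<le> k} \<subseteq> vec_lambda ` (UNIV \<rightarrow>\<^sub>E {..k})"
  proof
    fix m :: "nat^3" assume m: "m \<in> {m. mi_order m \<le> k}"
    have "m $ i \<le> k" for i
      using m member_le_sum[of i UNIV "\<lambda>i. m $ i"] by (simp add: mi_order_def)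
    then have "vec_nth m \<in> UNIV \<rightarrow>\<^sub>E {..k}" by auto
    then show "m \<in> vec_lambda ` (UNIV \<rightarrow>\<^sub>E {..k})"
      by (metis image_eqI vec_nth_inverse)
  qed
  show "finite (vec_lambda ` ((UNIV :: 3 set) \<rightarrow>\<^sub>E {..k}))"
    by (intro finite_imageI finite_PiE) auto
qed

lemma finite_mi_order_eq: "finite {m. mi_order m = k}"
  by (rule finite_subset[OF _ finite_mi_order_le[of k]]) auto

definition period_cube :: "real \<Rightarrow> (real^3) set" where
  "period_cube L = cbox 0 (\<chi> i. L)"

definition spatially_periodic :: "real \<Rightarrow> (real^3 \<Rightarrow> 'b) \<Rightarrow> bool" where
  "spatially_periodic L f \<longleftrightarrow> (\<forall>x i. f (x + L *\<^sub>R axis i 1) = f x)"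

(* Norms take values in ennreal, so that "finite norm" is a genuine condition. *)

(* For x = y the quotient is 0 / 0 = 0, so the diagonal does not contribute. *)
definition holder_seminorm :: "real \<Rightarrow> real \<Rightarrow> (real^3 \<Rightarrow> 'b::real_normed_vector) \<Rightarrow> ennreal" where
  "holder_seminorm L \<alpha> f =
     (SUP x\<in>period_cube L. SUP y\<in>period_cube L.
        ennreal (L powr \<alpha> * (norm (f x - f y) / norm (x - y) powr \<alpha>)))"

definition Ck_norm :: "real \<Rightarrow> nat \<Rightarrow> (real^3 \<Rightarrow> 'b::real_normed_vector) \<Rightarrow> ennreal" where
  "Ck_norm L k f =
     (\<Sum>m | mi_order m \<le> k.
        ennreal (L ^ mi_order m) * (SUP x\<in>period_cube L. ennreal (norm (multi_deriv m f x))))"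

definition holder_norm :: "real \<Rightarrow> nat \<Rightarrow> real \<Rightarrow> (real^3 \<Rightarrow> 'b::real_normed_vector) \<Rightarrow> ennreal" where
  "holder_norm L k \<alpha> f =
     Ck_norm L k f + (\<Sum>m | mi_order m = k. ennreal (L ^ k) * holder_seminorm L \<alpha> (multi_deriv m f))"

definition holder_space :: "real \<Rightarrow> nat \<Rightarrow> real \<Rightarrow> (real^3 \<Rightarrow> 'b::real_normed_vector) set" where
  "holder_space L k \<alpha> = {f. spatially_periodic L f \<and> C_class k f \<and> holder_norm L k \<alpha> f < top}"

definition divergence :: "(real^3 \<Rightarrow> real^3) \<Rightarrow> real^3 \<Rightarrow> real" where
  "divergence v x = (\<Sum>i\<in>UNIV. partial_deriv i v x $ i)"

definition grad :: "(real^3 \<Rightarrow> real) \<Rightarrow> real^3 \<Rightarrow> real^3" where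
  "grad q x = (\<chi> i. partial_deriv i q x)"

definition laplacian :: "(real^3 \<Rightarrow> real^3) \<Rightarrow> real^3 \<Rightarrow> real^3" where
  "laplacian v x = (\<Sum>i\<in>UNIV. partial_deriv i (partial_deriv i v) x)"

definition convection :: "(real^3 \<Rightarrow> real^3) \<Rightarrow> (real^3 \<Rightarrow> real^3) \<Rightarrow> real^3 \<Rightarrow> real^3" where
  "convection v w x = (\<Sum>i\<in>UNIV. (v x $ i) *\<^sub>R partial_deriv i w x)"

(* Pointwise (classical) solutions on the closed interval [0,T]: the equation prescribes the
   time derivative, which is one-sided at t = 0 and t = T.  Velocity and pressure are both
   periodic in space; the first argument of u and p is time. *)
definition navier_stokes_solution ::
  "real \<Rightarrow> real \<Rightarrow> real \<Rightarrow> (real^3 \<Rightarrow> real^3) \<Rightarrow>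
   (real \<Rightarrow> real^3 \<Rightarrow> real^3) \<Rightarrow> (real \<Rightarrow> real^3 \<Rightarrow> real) \<Rightarrow> bool" where
  "navier_stokes_solution L \<nu> T u0 u p \<longleftrightarrow>
     u 0 = u0 \<and>
     (\<forall>t\<in>{0..T}.
        spatially_periodic L (u t) \<and> C_class 2 (u t) \<and>
        spatially_periodic L (p t) \<and> C_class 1 (p t) \<and>
        (\<forall>x. divergence (u t) x = 0 \<and>
             (\<exists>u'. ((\<lambda>s. u s x) has_vector_derivative u') (at t within {0..T}) \<and>
                   u' + convection (u t) (u t) x - \<nu> *\<^sub>R laplacian (u t) x + grad (p t) x = 0)))"

end

theory Submission
  imports Defs "HOL-Real_Asymp.Real_Asymp"
begin

text \<open>
  On the Fourier side the projected equation is a quadratic convolution system. Its Picard iterates are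
  dominated by \<open>exp (- t \<bar>\<xi>\<bar>) b\<^sub>j(\<xi>)\<close>, where the majorants \<open>b\<^sub>j\<close> increase to an \<open>l\<^sup>1\<close> sequence on a time
  interval that depends only on the \<open>l\<^sup>1\<close> norm of the initial coefficients, which Bessel's inequality
  bounds by the \<open>C\<^sup>2\<close> norm of \<open>u\<^sub>0\<close>. The weight makes the solution analytic in space for positive times,
  so the equation and the Hoelder regularity for \<open>t > 0\<close> are obtained term by term.

  The delicate point is the time derivative at \<open>t = 0\<close>, where the Fourier series of the second
  derivatives of \<open>u\<^sub>0\<close> need not converge absolutely. The heat semigroup is a contraction for the
  supremum norm, because \<open>exp (- \<tau> \<xi>\<^sup>2)\<close> is the limit of the multipliers \<open>cos\<^sup>N(\<xi> \<surd>(2 \<tau> / N))\<close>, which are iterated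
  averages of translations. Together with the density of trigonometric polynomials it converges uniformly
  to the identity on continuous periodic functions, and this gives uniform convergence of the velocity
  gradient as \<open>t\<close> tends to \<open>0\<close>. The pressure gradient converges uniformly because its source
  \<open>\<partial>\<^sub>i u\<^sub>l \<partial>\<^sub>l u\<^sub>i\<close> stays bounded in \<open>H\<^sup>1\<close>. The mean value theorem along \<open>s \<mapsto> exp (\<nu> (t - s) \<Delta>) u(s)\<close> then
  identifies the derivative.
\<close>

section \<open>Infinite sums and convolutions\<close>

no_notation Infinite_Set_Sum.abs_summable_on (infix \<open>abs'_summable'_on\<close> 50)

text \<open>The weight \<open>exp (- (t * \<bar>\<xi>\<bar>))\<close> is submultiplicative by the
  triangle inequality for frequencies, so a convolution of weighted sequences is again weighted. It
  is cheap: by completing a square, half of the heat decay over a time \<open>r\<close> pays for it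
  up to a factor \<open>exp (r / (2 * \<nu>))\<close>, at most \<open>exp 1\<close> when
  \<open>T \<le> 2 * \<nu>\<close>, and the other half absorbs the derivative in the nonlinearity
  with a gain of order \<open>sqrt (T / \<nu>)\<close>. The constant 72 is what closes the quadratic
  inequality for the total mass of the majorants. Differences of iterates are dominated by
  differences of majorants, so monotone convergence of real sequences replaces a contraction
  estimate.

  Dimension three enters through the summability of \<open>1 / \<bar>\<xi>\<bar> ^ 4\<close> over
  nonzero frequencies. Paired with two square summable derivatives of the datum it gives absolutely
  summable coefficients; paired with one derivative of the pressure source it gives a continuously
  differentiable pressure. The source is a product of velocity gradients, so controlling the
  pressure down to time 0 requires an H^2 bound on the solution that is uniform in time.\<close>

lemma has_sum_diff:
  fixes f g :: "'i \<Rightarrow> 'b::real_normed_vector"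
  assumes "(f has_sum a) A" "(g has_sum b) A"
  shows "((\<lambda>n. f n - g n) has_sum (a - b)) A"
  using has_sum_add[OF assms(1), of "\<lambda>n. - g n" "- b"] assms(2) by (simp add: has_sum_uminus)

lemma summable_on_diff:
  fixes f g :: "'i \<Rightarrow> 'b::real_normed_vector"
  assumes "f summable_on A" "g summable_on A"
  shows "(\<lambda>n. f n - g n) summable_on A"
  using assms has_sum_diff unfolding summable_on_def by blast

lemma infsum_diff:
  fixes f g :: "'i \<Rightarrow> 'b::real_normed_vector"
  assumes "f summable_on A" "g summable_on A"
  shows "(\<Sum>\<^sub>\<infinity>n\<in>A. f n - g n) = infsum f A - infsum g A"
  using assms by (intro infsumI has_sum_diff has_sum_infsum)

lemma has_sum_sum:
  fixes f :: "'j \<Rightarrow> 'i \<Rightarrow> 'b::real_normed_vector"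
  assumes "\<And>j. j \<in> J \<Longrightarrow> (f j has_sum s j) A"
  shows "((\<lambda>n. \<Sum>j\<in>J. f j n) has_sum (\<Sum>j\<in>J. s j)) A"
  using assms
proof (induction J rule: infinite_finite_induct)
  case (insert j J)
  then show ?case by (simp add: has_sum_add)
qed simp_all

lemma summable_on_sum:
  fixes f :: "'j \<Rightarrow> 'i \<Rightarrow> 'b::real_normed_vector"
  assumes "\<And>j. j \<in> J \<Longrightarrow> f j summable_on A"
  shows "(\<lambda>n. \<Sum>j\<in>J. f j n) summable_on A"
proof -
  have "((\<lambda>n. \<Sum>j\<in>J. f j n) has_sum (\<Sum>j\<in>J. infsum (f j) A)) A"
    by (intro has_sum_sum has_sum_infsum assms)
  then show ?thesis by (auto simp: summable_on_def)
qed

lemma infsum_sum: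
  fixes f :: "'j \<Rightarrow> 'i \<Rightarrow> 'b::real_normed_vector"
  assumes "\<And>j. j \<in> J \<Longrightarrow> f j summable_on A"
  shows "(\<Sum>\<^sub>\<infinity>n\<in>A. \<Sum>j\<in>J. f j n) = (\<Sum>j\<in>J. \<Sum>\<^sub>\<infinity>n\<in>A. f j n)"
  by (rule infsumI[OF has_sum_sum[OF has_sum_infsum[OF assms]]])

lemma infsum_bounded_linear:
  assumes "bounded_linear h" "f summable_on A"
  shows "h (infsum f A) = (\<Sum>\<^sub>\<infinity>n\<in>A. h (f n))"
  using has_sum_bounded_linear[OF assms(1) has_sum_infsum[OF assms(2)]] by (simp add: infsumI)

lemma norm_infsum_le_infsum:
  fixes f :: "'i \<Rightarrow> 'b::banach" and M :: "'i \<Rightarrow> real"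
  assumes "M summable_on A" and "\<And>n. n \<in> A \<Longrightarrow> norm (f n) \<le> M n"
  shows "norm (infsum f A) \<le> infsum M A"
proof -
  have "f abs_summable_on A"
    using Infinite_Sum.abs_summable_on_comparison_test'[OF assms] .
  then show ?thesis
    by (rule norm_infsum_le[OF has_sum_infsum[OF abs_summable_summable] has_sum_infsum[OF assms(1)] assms(2)])
qed

lemma abs_summable_on_le:
  fixes f :: "'i \<Rightarrow> 'b::real_normed_vector" and M :: "'i \<Rightarrow> real"
  assumes "M summable_on A" and "\<And>n. n \<in> A \<Longrightarrow> norm (f n) \<le> M n"
  shows "f abs_summable_on A"
  using Infinite_Sum.abs_summable_on_comparison_test'[OF assms] .

text \<open>Dominated convergence for unordered sums along an arbitrary filter. The Weierstrass
  M-test makes the finite partial sums converge uniformly on the set of all \<open>y\<close> that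
  satisfy the bound, and \<open>F\<close> eventually lies in that set, so the two limits may be
  swapped.\<close>

lemma tendsto_infsum_dominated:
  fixes f :: "'i \<Rightarrow> 'y \<Rightarrow> 'b::banach" and M :: "'i \<Rightarrow> real"
  assumes lim: "\<And>n. (f n \<longlongrightarrow> l n) F"
    and bound: "eventually (\<lambda>y. \<forall>n. norm (f n y) \<le> M n) F"
    and M: "M summable_on UNIV"
  shows "((\<lambda>y. \<Sum>\<^sub>\<infinity>n. f n y) \<longlongrightarrow> (\<Sum>\<^sub>\<infinity>n. l n)) F"
proof (cases "F = bot")
  case False
  have l: "norm (l n) \<le> M n" for n
  proof (rule tendsto_upperbound[OF tendsto_norm[OF lim[of n]] _ False])
    show "eventually (\<lambda>y. norm (f n y) \<le> M n) F"
      using bound by eventually_elim auto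
  qed
  then have "l abs_summable_on UNIV" by (intro abs_summable_on_le[OF M])
  then have ls: "(sum l \<longlongrightarrow> (\<Sum>\<^sub>\<infinity>n. l n)) (finite_subsets_at_top UNIV)"
    by (rule infsum_tendsto[OF abs_summable_summable])
  have u: "uniform_limit {y. \<forall>n. norm (f n y) \<le> M n} (\<lambda>X y. \<Sum>n\<in>X. f n y) (\<lambda>y. \<Sum>\<^sub>\<infinity>n. f n y)
      (finite_subsets_at_top UNIV)"
    by (rule Weierstrass_m_test_general[OF _ M]) auto
  have "eventually (\<lambda>X. ((\<lambda>y. \<Sum>n\<in>X. f n y) \<longlongrightarrow> sum l X) F) (finite_subsets_at_top UNIV)"
    by (intro always_eventually allI tendsto_sum lim)
  then show ?thesis
    by (rule swap_uniform_limit'[OF _ ls u]) (use bound in auto)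
qed simp

lemma continuous_on_infsum:
  fixes f :: "'i \<Rightarrow> 'y::topological_space \<Rightarrow> 'b::banach" and M :: "'i \<Rightarrow> real"
  assumes "\<And>n. continuous_on S (f n)" and "\<And>n y. y \<in> S \<Longrightarrow> norm (f n y) \<le> M n"
    and "M summable_on UNIV"
  shows "continuous_on S (\<lambda>y. \<Sum>\<^sub>\<infinity>n. f n y)"
  unfolding continuous_on
proof
  fix y assume "y \<in> S"
  show "((\<lambda>y. \<Sum>\<^sub>\<infinity>n. f n y) \<longlongrightarrow> (\<Sum>\<^sub>\<infinity>n. f n y)) (at y within S)"
  proof (rule tendsto_infsum_dominated[OF _ _ assms(3)])
    show "(f n \<longlongrightarrow> f n y) (at y within S)" for n
      using assms(1) \<open>y \<in> S\<close> by (simp add: continuous_on)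
    show "eventually (\<lambda>y. \<forall>n. norm (f n y) \<le> M n) (at y within S)"
      using assms(2) by (auto simp: eventually_at_filter)
  qed
qed

text \<open>Termwise differentiation: the mean value inequality on the convex set \<open>X\<close>
  bounds the normalised remainder \<open>q n y\<close> of each term by \<open>2 * M n\<close>,
  uniformly in \<open>y\<close>, and dominated convergence sends the sum of the remainders to
  0.\<close>

lemma has_derivative_infsum:
  fixes f :: "'i \<Rightarrow> 'y::real_normed_vector \<Rightarrow> 'b::banach" and M :: "'i \<Rightarrow> real"
  assumes X: "convex X" "x \<in> X"
    and d: "\<And>n y. y \<in> X \<Longrightarrow> (f n has_derivative f' n y) (at y within X)"
    and b: "\<And>n y h. y \<in> X \<Longrightarrow> norm (f' n y h) \<le> M n * norm h"
    and M: "M summable_on UNIV" and M0: "\<And>n. 0 \<le> M n"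
    and s: "\<And>y. y \<in> X \<Longrightarrow> (\<lambda>n. f n y) summable_on UNIV"
  shows "((\<lambda>y. \<Sum>\<^sub>\<infinity>n. f n y) has_derivative (\<lambda>h. \<Sum>\<^sub>\<infinity>n. f' n x h)) (at x within X)"
proof -
  have lin: "bounded_linear (f' n x)" for n
    using d[OF X(2)] has_derivative_bounded_linear by blast
  have Mh: "(\<lambda>n. M n * norm h) summable_on UNIV" for h :: 'y
    using M by (rule summable_on_cmult_left)
  have sh: "(\<lambda>n. f' n x h) summable_on UNIV" for h
    by (rule abs_summable_summable, rule abs_summable_on_le[OF Mh]) (use b X in auto)
  have bl: "bounded_linear (\<lambda>h. \<Sum>\<^sub>\<infinity>n. f' n x h)"
  proof (rule bounded_linear_intro[where K="\<Sum>\<^sub>\<infinity>n. M n"])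
    show "(\<Sum>\<^sub>\<infinity>n. f' n x (h + k)) = (\<Sum>\<^sub>\<infinity>n. f' n x h) + (\<Sum>\<^sub>\<infinity>n. f' n x k)" for h k
      using sh by (simp add: infsum_add[symmetric] linear_add[OF bounded_linear.linear[OF lin]])
    show "(\<Sum>\<^sub>\<infinity>n. f' n x (r *\<^sub>R h)) = r *\<^sub>R (\<Sum>\<^sub>\<infinity>n. f' n x h)" for r h
      by (simp add: linear_scale[OF bounded_linear.linear[OF lin]] infsum_scaleR_right)
    show "norm (\<Sum>\<^sub>\<infinity>n. f' n x h) \<le> norm h * (\<Sum>\<^sub>\<infinity>n. M n)" for h
    proof -
      have "norm (\<Sum>\<^sub>\<infinity>n. f' n x h) \<le> (\<Sum>\<^sub>\<infinity>n. M n * norm h)"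
        by (rule norm_infsum_le_infsum[OF Mh]) (use b X in auto)
      then show ?thesis by (simp add: infsum_cmult_left' mult.commute)
    qed
  qed
  define q where "q n y = (1 / norm (y - x)) *\<^sub>R (f n y - (f n x + f' n x (y - x)))" for n y
  have q0: "(q n \<longlongrightarrow> 0) (at x within X)" for n
    using d[OF X(2), of n] unfolding has_derivative_within q_def by blast
  have qb: "norm (q n y) \<le> 2 * M n" if "y \<in> X" for n y
  proof (cases "y = x")
    case True
    then show ?thesis using M0[of n] by (simp add: q_def)
  next
    case False
    have "norm (f n y - f n x) \<le> M n * norm (y - x)"
    proof (rule differentiable_bound[OF X(1) d, of n])
      show "onorm (f' n z) \<le> M n" if "z \<in> X" for z
        by (rule onorm_bound[OF M0]) (rule b[OF that])
    qed (use X that in auto)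
    then have "norm (f n y - (f n x + f' n x (y - x))) \<le> M n * norm (y - x) + M n * norm (y - x)"
      using b[OF X(2), of n "y - x"] norm_triangle_ineq4[of "f n y - f n x" "f' n x (y-x)"]
      by (simp add: algebra_simps)
    then show ?thesis using False by (simp add: q_def divide_simps mult_ac)
  qed
  have M2: "(\<lambda>n. 2 * M n) summable_on UNIV" using M by (rule summable_on_cmult_right)
  have "((\<lambda>y. \<Sum>\<^sub>\<infinity>n. q n y) \<longlongrightarrow> (\<Sum>\<^sub>\<infinity>n::'i. 0)) (at x within X)"
    by (rule tendsto_infsum_dominated[OF q0 _ M2]) (use qb in \<open>auto simp: eventually_at_filter\<close>)
  moreover have "eventually (\<lambda>y. (\<Sum>\<^sub>\<infinity>n. q n y) = (1 / norm (y - x)) *\<^sub>R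
      ((\<Sum>\<^sub>\<infinity>n. f n y) - ((\<Sum>\<^sub>\<infinity>n. f n x) + (\<Sum>\<^sub>\<infinity>n. f' n x (y - x))))) (at x within X)"
  proof -
    have "(\<Sum>\<^sub>\<infinity>n. q n y) = (1 / norm (y - x)) *\<^sub>R
      ((\<Sum>\<^sub>\<infinity>n. f n y) - ((\<Sum>\<^sub>\<infinity>n. f n x) + (\<Sum>\<^sub>\<infinity>n. f' n x (y - x))))" if "y \<in> X" for y
    proof -
      have 1: "(\<lambda>n. f n x + f' n x (y - x)) summable_on UNIV"
        by (intro summable_on_add s sh X)
      have "(\<lambda>n. f n y - (f n x + f' n x (y - x))) summable_on UNIV"
        by (intro summable_on_diff s that 1)
      then have "(\<Sum>\<^sub>\<infinity>n. q n y) = (1 / norm (y - x)) *\<^sub>R (\<Sum>\<^sub>\<infinity>n. f n y - (f n x + f' n x (y - x)))"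
        unfolding q_def by (simp add: infsum_scaleR_right)
      also have "(\<Sum>\<^sub>\<infinity>n. f n y - (f n x + f' n x (y - x))) = (\<Sum>\<^sub>\<infinity>n. f n y) - (\<Sum>\<^sub>\<infinity>n. f n x + f' n x (y - x))"
        by (intro infsum_diff s that 1)
      also have "(\<Sum>\<^sub>\<infinity>n. f n x + f' n x (y - x)) = (\<Sum>\<^sub>\<infinity>n. f n x) + (\<Sum>\<^sub>\<infinity>n. f' n x (y - x))"
        by (intro infsum_add s sh X)
      finally show ?thesis .
    qed
    then show ?thesis by (auto simp: eventually_at_filter)
  qed
  ultimately have "((\<lambda>y. (1 / norm (y - x)) *\<^sub>R
      ((\<Sum>\<^sub>\<infinity>n. f n y) - ((\<Sum>\<^sub>\<infinity>n. f n x) + (\<Sum>\<^sub>\<infinity>n. f' n x (y - x))))) \<longlongrightarrow> 0) (at x within X)"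
    unfolding infsum_0_simp by (rule Lim_transform_eventually)
  then show ?thesis
    using bl unfolding has_derivative_within by blast
qed

section \<open>Convolution on an abelian group\<close>

definition conv :: "('i::ab_group_add \<Rightarrow> 'b::real_normed_algebra) \<Rightarrow> ('i \<Rightarrow> 'b) \<Rightarrow> 'i \<Rightarrow> 'b" where
  "conv c d n = (\<Sum>\<^sub>\<infinity>m. c (n - m) * d m)"

text \<open>The shear turns the double family of a convolution into a product family, whose
  summability is immediate; all Fubini arguments for \<open>conv\<close> go through it.\<close>

lemma bij_shear: "bij_betw (\<lambda>(n, m). (n - m, m)) UNIV (UNIV :: ('i::ab_group_add \<times> 'i) set)"
  by (rule bij_betwI[where g="\<lambda>(n, m). (n + m, m)"]) auto

lemma abs_summable_shear:
  fixes c d :: "'i::ab_group_add \<Rightarrow> 'b::{real_normed_algebra,banach}"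
  assumes "c abs_summable_on UNIV" "d abs_summable_on UNIV"
  shows "(\<lambda>(n, m). c (n - m) * d m) abs_summable_on UNIV \<times> UNIV"
proof -
  have "(\<lambda>p. c (fst p) * d (snd p)) abs_summable_on (UNIV \<times> UNIV)"
  proof -
    have "(\<lambda>p. norm (c (fst p)) * norm (d (snd p))) abs_summable_on (UNIV \<times> UNIV)"
      unfolding Infinite_Sum.abs_summable_on_Sigma_iff using assms
      by (auto simp: infsum_cmult_right abs_mult infsum_nonneg intro!: summable_on_cmult_left summable_on_cmult_right)
    then have "(\<lambda>p. norm (c (fst p)) * norm (d (snd p))) summable_on (UNIV \<times> UNIV)"
      by (rule abs_summable_summable)
    then show ?thesis
      by (rule abs_summable_on_le) (auto simp: norm_mult_ineq)
  qed
  from summable_on_reindex_bij_betw[OF bij_shear, THEN iffD2, of "\<lambda>p. norm (c (fst p) * d (snd p))"] this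
  show ?thesis by (simp add: case_prod_unfold)
qed

lemma conv_summand_abs_summable:
  fixes c d :: "'i::ab_group_add \<Rightarrow> 'b::{real_normed_algebra,banach}"
  assumes "c abs_summable_on UNIV" "d abs_summable_on UNIV"
  shows "(\<lambda>m. c (n - m) * d m) abs_summable_on UNIV"
  using abs_summable_shear[OF assms] unfolding Infinite_Sum.abs_summable_on_Sigma_iff
  by (simp del: UNIV_Times_UNIV)

lemma conv_abs_summable:
  fixes c d :: "'i::ab_group_add \<Rightarrow> 'b::{real_normed_algebra,banach}"
  assumes "c abs_summable_on UNIV" "d abs_summable_on UNIV"
  shows "conv c d abs_summable_on UNIV"
proof -
  have "(\<lambda>n. \<Sum>\<^sub>\<infinity>m. norm (c (n - m) * d m)) abs_summable_on UNIV"
    using abs_summable_shear[OF assms] unfolding Infinite_Sum.abs_summable_on_Sigma_iff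
  by (simp del: UNIV_Times_UNIV)
  then have "(\<lambda>n. \<Sum>\<^sub>\<infinity>m. norm (c (n - m) * d m)) summable_on UNIV"
    by (rule abs_summable_summable)
  then show ?thesis
    by (rule abs_summable_on_le)
      (auto simp: conv_def intro!: norm_infsum_bound conv_summand_abs_summable assms)
qed

text \<open>Swapping the two sums leaves a translated sum of \<open>c\<close>, which is independent
  of the translation. Applied to the terms of two Fourier series at a fixed point, this becomes the
  product formula \<open>series_mult\<close>.\<close>

lemma infsum_conv:
  fixes c d :: "'i::ab_group_add \<Rightarrow> 'b::{real_normed_algebra,banach}"
  assumes "c abs_summable_on UNIV" "d abs_summable_on UNIV"
  shows "(\<Sum>\<^sub>\<infinity>n. conv c d n) = (\<Sum>\<^sub>\<infinity>n. c n) * (\<Sum>\<^sub>\<infinity>n. d n)"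
proof -
  have 1: "(\<lambda>(n, m). c (n - m) * d m) summable_on UNIV \<times> UNIV"
    using abs_summable_shear[OF assms] by (rule abs_summable_summable)
  have "(\<Sum>\<^sub>\<infinity>n. conv c d n) = (\<Sum>\<^sub>\<infinity>m. \<Sum>\<^sub>\<infinity>n. c (n - m) * d m)"
    unfolding conv_def by (rule infsum_swap_banach) (use 1 in simp)
  also have "\<dots> = (\<Sum>\<^sub>\<infinity>m. (\<Sum>\<^sub>\<infinity>n. c (n - m)) * d m)"
  proof (rule infsum_cong)
    fix m
    have "(\<lambda>n. c (n - m)) summable_on UNIV"
      using abs_summable_summable[OF assms(1)] summable_on_reindex_bij_betw[of "\<lambda>n. n - m" UNIV UNIV c]
        bij_betwI[of "\<lambda>n. n - m" UNIV UNIV "\<lambda>n. n + m"] by auto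
    then show "(\<Sum>\<^sub>\<infinity>n. c (n - m) * d m) = (\<Sum>\<^sub>\<infinity>n. c (n - m)) * d m"
      by (rule infsum_cmult_left)
  qed
  also have "\<dots> = (\<Sum>\<^sub>\<infinity>m. (\<Sum>\<^sub>\<infinity>n. c n) * d m)"
  proof (rule infsum_cong)
    fix m
    show "(\<Sum>\<^sub>\<infinity>n. c (n - m)) * d m = (\<Sum>\<^sub>\<infinity>n. c n) * d m"
      using infsum_reindex_bij_betw[of "\<lambda>n. n - m" UNIV UNIV c]
        bij_betwI[of "\<lambda>n. n - m" UNIV UNIV "\<lambda>n. n + m"] by auto
  qed
  also have "\<dots> = (\<Sum>\<^sub>\<infinity>n. c n) * (\<Sum>\<^sub>\<infinity>n. d n)"
    using abs_summable_summable[OF assms(2)] by (rule infsum_cmult_right)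
  finally show ?thesis .
qed

lemma conv_mono:
  fixes b d b' d' :: "'i::ab_group_add \<Rightarrow> real"
  assumes "b' summable_on UNIV" "d' summable_on UNIV"
    "\<And>n. 0 \<le> b n" "\<And>n. b n \<le> b' n" "\<And>n. 0 \<le> d n" "\<And>n. d n \<le> d' n"
  shows "conv b d n \<le> conv b' d' n"
  unfolding conv_def
proof (rule infsum_mono)
  have b': "b' abs_summable_on UNIV" and d': "d' abs_summable_on UNIV"
    using assms(1,2) summable_on_iff_abs_summable_on_real by blast+
  have b: "b abs_summable_on UNIV" and d: "d abs_summable_on UNIV"
    by (rule abs_summable_on_le[OF assms(1)] abs_summable_on_le[OF assms(2)], use assms in simp)+
  show "(\<lambda>m. b (n - m) * d m) summable_on UNIV"
    "(\<lambda>m. b' (n - m) * d' m) summable_on UNIV"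
    using abs_summable_summable[OF conv_summand_abs_summable] b d b' d' by blast+
  show "b (n - m) * d m \<le> b' (n - m) * d' m" for m
    using assms by (meson mult_mono order_trans)
qed

lemma conv_nonneg:
  fixes b d :: "'i::ab_group_add \<Rightarrow> real"
  assumes "\<And>n. 0 \<le> b n" "\<And>n. 0 \<le> d n"
  shows "0 \<le> conv b d n"
  unfolding conv_def using assms by (intro infsum_nonneg) auto

lemma uniform_limit_bound:
  fixes f :: "'t \<Rightarrow> 'x \<Rightarrow> 'b::real_normed_vector"
  assumes "eventually (\<lambda>t. \<forall>x\<in>S. norm (f t x - g x) \<le> h t) F" "(h \<longlongrightarrow> 0) F"
  shows "uniform_limit S f g F"
proof (rule uniform_limitI)
  fix e :: real assume "e > 0"
  then have "eventually (\<lambda>t. dist (h t) 0 < e) F" using assms(2) by (rule tendstoD[rotated])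
  with assms(1) show "eventually (\<lambda>t. \<forall>x\<in>S. dist (f t x) (g x) < e) F"
    by eventually_elim (force simp: dist_norm)
qed

lemma conv_commute:
  fixes f g :: "'i::ab_group_add \<Rightarrow> real"
  shows "conv f g n = conv g f n"
proof -
  have "bij_betw (\<lambda>m. n - m) UNIV UNIV" by (rule bij_betwI[where g="\<lambda>m. n - m"]) auto
  from infsum_reindex_bij_betw[OF this, of "\<lambda>m. f m * g (n - m)"]
  show ?thesis by (simp add: conv_def mult.commute)
qed

text \<open>Young's inequality for a square summable and a summable sequence. Cauchy-Schwarz for the
  measure with weights \<open>g\<close> is obtained by expanding a nonnegative sum of
  \<open>(f (n - m) - c)\<^sup>2 * g m\<close>; the resulting pointwise bound by
  \<open>conv (\<lambda>n. (f n)\<^sup>2) g\<close> is summable.\<close>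

lemma young_l2_l1:
  fixes f g :: "'i::ab_group_add \<Rightarrow> real"
  assumes f: "\<And>n. 0 \<le> f n" "(\<lambda>n. (f n)\<^sup>2) summable_on UNIV"
    and g: "\<And>n. 0 \<le> g n" "g summable_on UNIV"
  shows "(\<lambda>m. f (n - m) * g m) summable_on UNIV" and "(\<lambda>n. (conv f g n)\<^sup>2) summable_on UNIV"
proof -
  have abs: "(\<lambda>n. (f n)\<^sup>2) abs_summable_on UNIV" "g abs_summable_on UNIV"
    using f(2) g by simp_all
  have s2: "(\<lambda>m. (f (n - m))\<^sup>2 * g m) summable_on UNIV" for n
    using abs_summable_summable[OF conv_summand_abs_summable[OF abs, of n]] by simp
  have s1: "(\<lambda>m. f (n - m) * g m) summable_on UNIV" for n
  proof (rule summable_on_comparison_test[OF summable_on_add[OF s2[of n] g(2)]])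
    fix m
    have "f (n - m) \<le> (f (n - m))\<^sup>2 + 1"
      using sum_squares_bound[of "f (n - m)" 1] f(1)[of "n - m"] by simp
    from mult_right_mono[OF this g(1)[of m]]
    show "f (n - m) * g m \<le> (f (n - m))\<^sup>2 * g m + g m" by (simp add: distrib_right)
  qed (use f g in auto)
  show "(\<lambda>m. f (n - m) * g m) summable_on UNIV" by (rule s1)
  define G where "G = (\<Sum>\<^sub>\<infinity>m. g m)"
  have G: "G \<ge> 0" unfolding G_def by (intro infsum_nonneg) (simp add: g)
  have le: "(conv f g n)\<^sup>2 \<le> (G + 1) * conv (\<lambda>n. (f n)\<^sup>2) g n" for n
  proof -
    define x where "x = conv f g n"
    \<comment> \<open>The optimal choice would be \<open>x / G\<close>. Using \<open>G + 1\<close>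
      keeps the denominator positive and costs only a constant.\<close>
    define c where "c = x / (G + 1)"
    have "0 \<le> (\<Sum>\<^sub>\<infinity>m. (f (n - m) - c)\<^sup>2 * g m)" by (intro infsum_nonneg) (simp add: g)
    also have "\<dots> = (\<Sum>\<^sub>\<infinity>m. ((f (n - m))\<^sup>2 * g m - 2 * c * (f (n - m) * g m)) + c\<^sup>2 * g m)"
      by (intro infsum_cong) (simp add: power2_eq_square algebra_simps)
    also have "\<dots> = (conv (\<lambda>n. (f n)\<^sup>2) g n - 2 * c * x) + c\<^sup>2 * G"
      unfolding conv_def x_def G_def
      by (simp add: infsum_add infsum_diff infsum_cmult_right' summable_on_diff summable_on_cmult_right s1 s2 g(2))
    finally have "2 * c * x - c\<^sup>2 * G \<le> conv (\<lambda>n. (f n)\<^sup>2) g n" by simp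
    moreover have "x\<^sup>2 / (G + 1) \<le> 2 * c * x - c\<^sup>2 * G"
    proof -
      have xc: "x = c * (G + 1)" using G by (simp add: c_def)
      have "x\<^sup>2 / (G + 1) = c\<^sup>2 * (G + 1)" using G by (simp add: xc power2_eq_square)
      moreover have "2 * c * x - c\<^sup>2 * G = c\<^sup>2 * (G + 2)" by (simp add: xc power2_eq_square algebra_simps)
      ultimately show ?thesis by (simp add: mult_left_mono)
    qed
    ultimately have "x\<^sup>2 / (G + 1) \<le> conv (\<lambda>n. (f n)\<^sup>2) g n" by simp
    then show ?thesis using G by (simp add: x_def divide_le_eq mult.commute)
  qed
  have sm: "(\<lambda>n. (G + 1) * conv (\<lambda>n. (f n)\<^sup>2) g n) summable_on UNIV"
    using abs_summable_summable[OF conv_abs_summable[OF abs]] by (rule summable_on_cmult_right)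
  show "(\<lambda>n. (conv f g n)\<^sup>2) summable_on UNIV"
    by (rule summable_on_comparison_test[OF sm le]) simp
qed

lemma power2_sum_le: "(x + y)\<^sup>2 \<le> 2 * x\<^sup>2 + 2 * y\<^sup>2" for x y :: real
  using sum_squares_bound[of x y] by (simp add: power2_sum)

lemma summable_square:
  fixes f :: "'i \<Rightarrow> real"
  assumes "\<And>n. 0 \<le> f n" "f summable_on UNIV" shows "(\<lambda>n. (f n)\<^sup>2) summable_on UNIV"
proof (rule summable_on_comparison_test[OF summable_on_cmult_right[OF assms(2)]])
  fix n
  have "f n \<le> (\<Sum>\<^sub>\<infinity>n. f n)"
    using finite_sum_le_infsum[OF assms(2), of "{n}"] assms(1) by simp
  then show "(f n)\<^sup>2 \<le> (\<Sum>\<^sub>\<infinity>n. f n) * f n" using assms(1) by (simp add: power2_eq_square mult_right_mono)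
qed simp

lemma uniform_limit_sum:
  fixes f :: "'j \<Rightarrow> 't \<Rightarrow> 'x \<Rightarrow> 'b::real_normed_vector"
  assumes "\<And>j. j \<in> J \<Longrightarrow> uniform_limit S (f j) (g j) F"
  shows "uniform_limit S (\<lambda>t x. \<Sum>j\<in>J. f j t x) (\<lambda>x. \<Sum>j\<in>J. g j x) F"
  using assms
proof (induction J rule: infinite_finite_induct)
  case (insert j J)
  then show ?case by (simp add: uniform_limit_add)
qed (auto intro!: uniform_limit_const)

section \<open>A quadratic convolution system by the majorant method\<close>

text \<open>With \<open>y = \<nu> * t * k\<^sup>2 / 2\<close> the integral equals
  \<open>2 / (\<nu> * k\<^sup>2) * (1 - exp (- y))\<close>, and \<open>1 - exp (- y)\<close> is at
  most both 1 and \<open>y\<close>, hence at most \<open>sqrt y\<close>. The powers of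
  \<open>k\<close> then cancel: the heat factor absorbs one derivative uniformly in the
  frequency.\<close>

lemma integral_exp_le_sqrt:
  fixes c k t \<nu> :: real
  assumes "0 < \<nu>" "0 \<le> k" "0 \<le> t"
  shows "k * integral {0..t} (\<lambda>s. exp (- (\<nu> * (t - s) * k\<^sup>2 / 2))) \<le> sqrt (2 * t / \<nu>)"
proof (cases "k = 0")
  case False
  then have k: "k > 0" using assms by simp
  define y where "y = \<nu> * t * k\<^sup>2 / 2"
  have y: "y \<ge> 0" using assms by (simp add: y_def)
  have "((\<lambda>s. exp (- (\<nu> * (t - s) * k\<^sup>2 / 2))) has_integral
      (2 / (\<nu> * k\<^sup>2)) * exp (- (\<nu> * (t - t) * k\<^sup>2 / 2)) - (2 / (\<nu> * k\<^sup>2)) * exp (- (\<nu> * (t - 0) * k\<^sup>2 / 2))) {0..t}"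
    by (rule fundamental_theorem_of_calculus)
      (use assms k in \<open>auto intro!: derivative_eq_intros simp flip: has_real_derivative_iff_has_vector_derivative\<close>)
  then have eq: "integral {0..t} (\<lambda>s. exp (- (\<nu> * (t - s) * k\<^sup>2 / 2))) = (2 / (\<nu> * k\<^sup>2)) * (1 - exp (- y))"
    by (simp add: integral_unique y_def algebra_simps)
  have "1 - exp (- y) \<le> sqrt y"
  proof (cases "y \<le> 1")
    case True
    have "1 - exp (- y) \<le> y" using exp_ge_add_one_self[of "- y"] by simp
    also have "y \<le> sqrt y" using True y by (intro real_le_rsqrt) (simp add: power2_eq_square mult_left_le)
    finally show ?thesis .
  next
    case False
    then have "1 \<le> sqrt y" by simp
    then show ?thesis by (smt (verit) exp_gt_zero)
  qed
  then have "(2 / (\<nu> * k)) * (1 - exp (- y)) \<le> (2 / (\<nu> * k)) * sqrt y"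
    using assms k by (intro mult_left_mono) auto
  moreover have "k * ((2 / (\<nu> * k\<^sup>2)) * (1 - exp (- y))) = (2 / (\<nu> * k)) * (1 - exp (- y))"
    using assms k by (simp add: power2_eq_square)
  ultimately have "k * ((2 / (\<nu> * k\<^sup>2)) * (1 - exp (- y))) \<le> (2 / (\<nu> * k)) * sqrt y" by simp
  also have "\<dots> = sqrt ((2 / (\<nu> * k))\<^sup>2 * y)" using assms k by (simp add: real_sqrt_mult)
  also have "(2 / (\<nu> * k))\<^sup>2 * y = 2 * t / \<nu>"
    using assms k by (simp add: y_def power2_eq_square field_simps)
  finally show ?thesis by (simp add: eq)
qed (use assms in simp)

text \<open>Here \<open>k\<close> stands for the modulus of the frequency and \<open>N\<close> for
  the bilinear symbol, which costs one derivative. \<open>k_triangle\<close> lets the exponential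
  weight pass through a convolution; \<open>T_le\<close> limits the cost of the weight to a factor
  \<open>exp 1\<close>; \<open>T_small\<close> closes the quadratic inequality for the
  majorants.\<close>

locale quadratic_convolution_system =
  fixes k :: "'i::ab_group_add \<Rightarrow> real"
    and N :: "'i \<Rightarrow> 'b::banach \<Rightarrow> 'b \<Rightarrow> 'b"
    and a :: "'i \<Rightarrow> 'b" and \<nu> T :: real
  assumes \<nu>_pos: "0 < \<nu>" and T_pos: "0 < T"
    and k_nonneg: "\<And>n. 0 \<le> k n" and k_triangle: "\<And>n m. k n \<le> k (n - m) + k m"
    and N_bilinear: "\<And>n. bounded_bilinear (N n)"
    and N_bound: "\<And>n v w. norm (N n v w) \<le> 2 * k n * norm v * norm w"
    and a_summable: "a abs_summable_on UNIV"
    and T_le: "T \<le> 2 * \<nu>"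
    and T_small: "72 * sqrt (2 * T / \<nu>) * (\<Sum>\<^sub>\<infinity>n. norm (a n)) \<le> 1"
begin

definition heat :: "real \<Rightarrow> 'i \<Rightarrow> real" where
  "heat t n = exp (- (\<nu> * t * (k n)\<^sup>2))"

definition quad :: "('i \<Rightarrow> 'b) \<Rightarrow> 'i \<Rightarrow> 'b" where
  "quad v n = (\<Sum>\<^sub>\<infinity>m. N n (v (n - m)) (v m))"

definition duhamel :: "(real \<Rightarrow> 'i \<Rightarrow> 'b) \<Rightarrow> real \<Rightarrow> 'i \<Rightarrow> 'b" where
  "duhamel v t n = heat t n *\<^sub>R a n - integral {0..t} (\<lambda>s. heat (t - s) n *\<^sub>R quad (v s) n)"

text \<open>The 6 is the 2 of \<open>N_bound\<close> times the 3 that bounds \<open>exp 1\<close>;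
  the root is the gain of \<open>integral_exp_le_sqrt\<close>.\<close>

definition \<gamma> :: real where "\<gamma> = 6 * sqrt (2 * T / \<nu>)"

primrec picard :: "nat \<Rightarrow> real \<Rightarrow> 'i \<Rightarrow> 'b" where
  "picard 0 = (\<lambda>t n. 0)"
| "picard (Suc j) = duhamel (picard j)"

text \<open>Picard iteration of the scalar convolution equation
  \<open>b = 3 * norm a + \<gamma> * conv b b\<close>. The 3 is the cost of replacing the heat
  factor of the linear part by the weight, see \<open>norm_heat_le\<close>.\<close>

primrec majorant :: "nat \<Rightarrow> 'i \<Rightarrow> real" where
  "majorant 0 = (\<lambda>n. 0)"
| "majorant (Suc j) = (\<lambda>n. 3 * norm (a n) + \<gamma> * conv (majorant j) (majorant j) n)"

text \<open>The weights of the two factors multiply to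
  \<open>exp (- (s * (k (n - m) + k m)))\<close>, and \<open>k_triangle\<close> bounds this by the
  weight at \<open>n\<close>.\<close>

lemma quad_summand_bound:
  assumes "\<And>n. norm (v n) \<le> exp (- (s * k n)) * b n" "s \<ge> 0" "\<And>n. 0 \<le> b n"
  shows "norm (N n (v (n - m)) (v m)) \<le> 2 * k n * exp (- (s * k n)) * (b (n - m) * b m)"
proof -
  have "norm (v (n - m)) * norm (v m) \<le> (exp (- (s * k (n - m))) * b (n - m)) * (exp (- (s * k m)) * b m)"
    using assms by (intro mult_mono) auto
  also have "\<dots> = exp (- (s * (k (n - m) + k m))) * (b (n - m) * b m)"
    by (simp add: exp_add[symmetric] algebra_simps)
  also have "\<dots> \<le> exp (- (s * k n)) * (b (n - m) * b m)"
    using assms k_triangle by (intro mult_right_mono) (auto intro!: mult_left_mono)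
  finally have "2 * k n * (norm (v (n - m)) * norm (v m)) \<le> 2 * k n * (exp (- (s * k n)) * (b (n - m) * b m))"
    using k_nonneg[of n] by (intro mult_left_mono) auto
  then show ?thesis using N_bound[of n "v (n - m)" "v m"] by (simp add: mult.assoc)
qed

lemma conv_self_summable:
  fixes b :: "'i \<Rightarrow> real"
  assumes "b summable_on UNIV"
  shows "(\<lambda>m. b (n - m) * b m) summable_on UNIV"
  using abs_summable_summable[OF conv_summand_abs_summable] assms
  by (metis summable_on_iff_abs_summable_on_real)

lemma quad_abs_summable:
  assumes "\<And>n. norm (v n) \<le> exp (- (s * k n)) * b n" "s \<ge> 0" "\<And>n. 0 \<le> b n" "b summable_on UNIV"
  shows "(\<lambda>m. N n (v (n - m)) (v m)) abs_summable_on UNIV"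
  by (rule abs_summable_on_le[OF summable_on_cmult_right[OF conv_self_summable[OF assms(4)]]])
    (use quad_summand_bound[OF assms(1-3)] in blast)

lemma norm_quad_le:
  assumes "\<And>n. norm (v n) \<le> exp (- (s * k n)) * b n" "s \<ge> 0" "\<And>n. 0 \<le> b n" "b summable_on UNIV"
  shows "norm (quad v n) \<le> 2 * k n * exp (- (s * k n)) * conv b b n"
proof -
  have "norm (quad v n) \<le> (\<Sum>\<^sub>\<infinity>m. 2 * k n * exp (- (s * k n)) * (b (n - m) * b m))"
    unfolding quad_def using quad_summand_bound[OF assms(1-3)]
    by (intro norm_infsum_le_infsum summable_on_cmult_right conv_self_summable assms(4)) auto
  also have "\<dots> = 2 * k n * exp (- (s * k n)) * conv b b n"
    unfolding conv_def by (intro infsum_cmult_right conv_self_summable assms(4))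
  finally show ?thesis .
qed

text \<open>The bilinear splitting of the difference mirrors the splitting of
  \<open>b (n - m) * b m - b' (n - m) * b' m\<close>. Measuring \<open>v - v'\<close> by the
  difference of the majorants, rather than by an independent norm, is what lets the scalar iteration
  control the convergence of the vector one.\<close>

lemma norm_quad_diff_le:
  assumes v: "\<And>n. norm (v n) \<le> exp (- (s * k n)) * b n" "s \<ge> 0" "\<And>n. 0 \<le> b n" "b summable_on UNIV"
    and v': "\<And>n. norm (v' n) \<le> exp (- (s * k n)) * b' n" "\<And>n. 0 \<le> b' n" "b' summable_on UNIV"
    and le: "\<And>n. norm (v n - v' n) \<le> exp (- (s * k n)) * (b n - b' n)"
  shows "norm (quad v n - quad v' n) \<le> 2 * k n * exp (- (s * k n)) * (conv b b n - conv b' b' n)"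
proof -
  have bb: "b' n \<le> b n" for n
    using order_trans[OF norm_ge_zero le[of n]] by (simp add: zero_le_mult_iff)
  have bnd: "norm (N n (v (n - m)) (v m) - N n (v' (n - m)) (v' m))
      \<le> 2 * k n * exp (- (s * k n)) * (b (n - m) * b m - b' (n - m) * b' m)" for m
  proof -
    interpret bounded_bilinear "N n" by (rule N_bilinear)
    have "N n (v (n - m)) (v m) - N n (v' (n - m)) (v' m)
        = N n (v (n - m) - v' (n - m)) (v m) + N n (v' (n - m)) (v m - v' m)"
      by (simp add: diff_left diff_right)
    also have "norm \<dots> \<le> 2 * k n * norm (v (n - m) - v' (n - m)) * norm (v m)
        + 2 * k n * norm (v' (n - m)) * norm (v m - v' m)"
      by (intro order_trans[OF norm_triangle_ineq] add_mono N_bound)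
    also have "\<dots> = 2 * k n * (norm (v (n - m) - v' (n - m)) * norm (v m)
        + norm (v' (n - m)) * norm (v m - v' m))" by (simp add: algebra_simps)
    also have "\<dots> \<le> 2 * k n * ((exp (- (s * k (n - m))) * (b (n - m) - b' (n - m))) * (exp (- (s * k m)) * b m)
       + (exp (- (s * k (n - m))) * b' (n - m)) * (exp (- (s * k m)) * (b m - b' m)))"
      using v v' le k_nonneg[of n] bb by (intro mult_left_mono add_mono mult_mono) auto
    also have "\<dots> = 2 * k n * (exp (- (s * (k (n - m) + k m))) * (b (n - m) * b m - b' (n - m) * b' m))"
    proof -
      have "exp (- (s * (k (n - m) + k m))) = exp (- (s * k (n - m))) * exp (- (s * k m))"
        by (simp add: exp_add[symmetric] algebra_simps)
      then show ?thesis by (simp only:) (simp add: algebra_simps)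
    qed
    also have "\<dots> \<le> 2 * k n * (exp (- (s * k n)) * (b (n - m) * b m - b' (n - m) * b' m))"
    proof (intro mult_left_mono mult_right_mono)
      show "0 \<le> b (n - m) * b m - b' (n - m) * b' m"
        using bb v v' mult_mono[OF bb[of "n - m"] bb[of m]] by simp
    qed (use k_nonneg k_triangle \<open>s \<ge> 0\<close> in \<open>auto intro!: mult_left_mono\<close>)
    finally show ?thesis by (simp add: mult.assoc)
  qed
  have sv: "(\<lambda>m. N n (v (n - m)) (v m)) summable_on UNIV"
    by (rule abs_summable_summable[OF quad_abs_summable]) (use v in auto)
  have sv': "(\<lambda>m. N n (v' (n - m)) (v' m)) summable_on UNIV"
    by (rule abs_summable_summable[OF quad_abs_summable]) (use v(2) v' in auto)
  have sb: "(\<lambda>m. b (n - m) * b m - b' (n - m) * b' m) summable_on UNIV"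
    by (intro summable_on_diff conv_self_summable v v')
  have "quad v n - quad v' n = (\<Sum>\<^sub>\<infinity>m. N n (v (n - m)) (v m) - N n (v' (n - m)) (v' m))"
    unfolding quad_def by (rule infsum_diff[OF sv sv', symmetric])
  also have "norm \<dots> \<le> (\<Sum>\<^sub>\<infinity>m. 2 * k n * exp (- (s * k n)) * (b (n - m) * b m - b' (n - m) * b' m))"
    using bnd by (intro norm_infsum_le_infsum summable_on_cmult_right sb) auto
  also have "\<dots> = 2 * k n * exp (- (s * k n)) * (\<Sum>\<^sub>\<infinity>m. b (n - m) * b m - b' (n - m) * b' m)"
    by (intro infsum_cmult_right sb)
  also have "(\<Sum>\<^sub>\<infinity>m. b (n - m) * b m - b' (n - m) * b' m) = conv b b n - conv b' b' n"
    unfolding conv_def by (intro infsum_diff conv_self_summable v v')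
  finally show ?thesis .
qed

lemma continuous_quad:
  assumes "\<And>n. continuous_on {0..T} (\<lambda>s. v s n)"
    and "\<And>s n. s \<in> {0..T} \<Longrightarrow> norm (v s n) \<le> exp (- (s * k n)) * b n" "\<And>n. 0 \<le> b n" "b summable_on UNIV"
  shows "continuous_on {0..T} (\<lambda>s. quad (v s) n)"
  unfolding quad_def
proof (rule continuous_on_infsum)
  show "continuous_on {0..T} (\<lambda>s. N n (v s (n - m)) (v s m))" for m
    by (intro bounded_bilinear.continuous_on[OF N_bilinear] assms(1))
  show "(\<lambda>m. 2 * k n * (b (n - m) * b m)) summable_on UNIV"
    by (intro summable_on_cmult_right conv_self_summable assms)
  fix m s assume s: "s \<in> {0..T}"
  have "norm (N n (v s (n - m)) (v s m)) \<le> exp (- (s * k n)) * (2 * k n * (b (n - m) * b m))"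
    using quad_summand_bound[OF assms(2)[OF s] _ assms(3), of n m] s by (simp add: ac_simps)
  also have "\<dots> \<le> 1 * (2 * k n * (b (n - m) * b m))"
    using s k_nonneg assms(3) by (intro mult_right_mono) auto
  finally show "norm (N n (v s (n - m)) (v s m)) \<le> 2 * k n * (b (n - m) * b m)" by simp
qed

section \<open>Estimates for the Duhamel integral\<close>

lemma heat_continuous: "continuous_on S (\<lambda>s. heat (t - s) n)"
  unfolding heat_def by (intro continuous_intros)

lemma heat_integrable:
  fixes f :: "real \<Rightarrow> 'b"
  assumes "continuous_on {0..T} f" "t \<in> {0..T}"
  shows "(\<lambda>s. heat (t - s) n *\<^sub>R f s) integrable_on {0..t}"
proof -
  have "continuous_on {0..t} f" using assms by (auto elim: continuous_on_subset)
  then show ?thesis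
    by (intro integrable_continuous_interval continuous_intros heat_continuous)
qed

text \<open>The weight at time \<open>s\<close> has to become the weight at time \<open>t\<close>,
  which costs \<open>exp ((t - s) * k n)\<close>. Half of the heat exponent pays for it, and the
  remaining half absorbs the factor \<open>k n\<close> through
  \<open>integral_exp_le_sqrt\<close>.\<close>

lemma norm_heat_integral_le:
  fixes f :: "real \<Rightarrow> 'b"
  assumes t: "t \<in> {0..T}" and f: "continuous_on {0..T} f"
    and b: "\<And>s. s \<in> {0..t} \<Longrightarrow> norm (f s) \<le> 2 * k n * exp (- (s * k n)) * q" and q: "q \<ge> 0"
  shows "norm (integral {0..t} (\<lambda>s. heat (t - s) n *\<^sub>R f s)) \<le> exp (- (t * k n)) * (\<gamma> * q)"
proof -
  have "norm (integral {0..t} (\<lambda>s. heat (t - s) n *\<^sub>R f s))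
      \<le> integral {0..t} (\<lambda>s. (6 * q * exp (- (t * k n)) * k n) * exp (- (\<nu> * (t - s) * (k n)\<^sup>2 / 2)))"
  proof (rule Henstock_Kurzweil_Integration.integral_norm_bound_integral)
    show "(\<lambda>s. heat (t - s) n *\<^sub>R f s) integrable_on {0..t}"
      by (rule heat_integrable[OF f t])
    show "(\<lambda>s. 6 * q * exp (- (t * k n)) * k n * exp (- (\<nu> * (t - s) * (k n)\<^sup>2 / 2))) integrable_on {0..t}"
      by (intro integrable_continuous_interval continuous_intros) simp
    fix s assume s: "s \<in> {0..t}"
    define r where "r = t - s"
    have r: "0 \<le> r" "r \<le> T" using s t by (auto simp: r_def)
    \<comment> \<open>The square is chosen to give
      \<open>k \<le> \<nu> * k\<^sup>2 / 2 + 1 / (2 * \<nu>)\<close>, so exactly half of the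
      quadratic exponent survives. The constant term contributes \<open>r / (2 * \<nu>)\<close>, at
      most 1 because \<open>T \<le> 2 * \<nu>\<close>.\<close>
    have "0 \<le> r * (sqrt (\<nu> / 2) * k n - 1 / sqrt (2 * \<nu>))\<^sup>2" using r by simp
    also have "\<dots> = r * (\<nu> * (k n)\<^sup>2 / 2 - k n + 1 / (2 * \<nu>))"
    proof -
      have "sqrt (\<nu> / 2) * (1 / sqrt (2 * \<nu>)) = 1 / 2"
        using \<nu>_pos by (simp add: real_sqrt_divide real_sqrt_mult field_simps)
      then have "2 * (sqrt (\<nu> / 2) * k n) * (1 / sqrt (2 * \<nu>)) = k n"
        by (metis (no_types, opaque_lifting) mult.assoc mult.commute mult_1 nonzero_mult_div_cancel_left one_neq_zero times_divide_eq_right zero_neq_numeral)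
      then show ?thesis
        using \<nu>_pos unfolding power2_diff by (simp add: power_mult_distrib power_divide)
    qed
    finally have "r * k n - \<nu> * r * (k n)\<^sup>2 \<le> r / (2 * \<nu>) - \<nu> * r * (k n)\<^sup>2 / 2"
      by (simp add: algebra_simps)
    moreover have "r / (2 * \<nu>) \<le> 1" using r T_le \<nu>_pos by (simp add: divide_simps)
    ultimately have "exp (r * k n - \<nu> * r * (k n)\<^sup>2) \<le> exp (1 - \<nu> * r * (k n)\<^sup>2 / 2)" by simp
    also have "\<dots> = exp 1 * exp (- (\<nu> * r * (k n)\<^sup>2 / 2))" by (simp add: exp_add[symmetric])
    also have "\<dots> \<le> 3 * exp (- (\<nu> * r * (k n)\<^sup>2 / 2))"
      using exp_le by (intro mult_right_mono) auto
    finally have "exp (r * k n - \<nu> * r * (k n)\<^sup>2) \<le> 3 * exp (- (\<nu> * r * (k n)\<^sup>2 / 2))" .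
    then have 1: "(2 * k n * exp (- (t * k n)) * q) * exp (r * k n - \<nu> * r * (k n)\<^sup>2)
        \<le> (2 * k n * exp (- (t * k n)) * q) * (3 * exp (- (\<nu> * r * (k n)\<^sup>2 / 2)))"
      using k_nonneg[of n] q by (intro mult_left_mono) auto
    have "norm (heat (t - s) n *\<^sub>R f s) \<le> heat (t - s) n * (2 * k n * exp (- (s * k n)) * q)"
      using b[OF s] by (simp add: heat_def)
    also have "\<dots> = (2 * k n * exp (- (t * k n)) * q) * exp (r * k n - \<nu> * r * (k n)\<^sup>2)"
    proof -
      have "heat (t - s) n * exp (- (s * k n)) = exp (- (t * k n)) * exp (r * k n - \<nu> * r * (k n)\<^sup>2)"
        unfolding heat_def exp_add[symmetric] r_def by (simp add: algebra_simps)
      then show ?thesis by (simp add: ac_simps)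
    qed
    also note 1
    finally show "norm (heat (t - s) n *\<^sub>R f s)
        \<le> 6 * q * exp (- (t * k n)) * k n * exp (- (\<nu> * (t - s) * (k n)\<^sup>2 / 2))"
      by (simp add: r_def ac_simps)
  qed
  also have "\<dots> = 6 * q * exp (- (t * k n)) * (k n * integral {0..t} (\<lambda>s. exp (- (\<nu> * (t - s) * (k n)\<^sup>2 / 2))))"
    by simp
  also have "\<dots> \<le> 6 * q * exp (- (t * k n)) * sqrt (2 * T / \<nu>)"
  proof (intro mult_left_mono)
    have "k n * integral {0..t} (\<lambda>s. exp (- (\<nu> * (t - s) * (k n)\<^sup>2 / 2))) \<le> sqrt (2 * t / \<nu>)"
      using integral_exp_le_sqrt[OF \<nu>_pos k_nonneg] t by simp
    also have "\<dots> \<le> sqrt (2 * T / \<nu>)" using t \<nu>_pos by (simp add: divide_right_mono)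
    finally show "k n * integral {0..t} (\<lambda>s. exp (- (\<nu> * (t - s) * (k n)\<^sup>2 / 2))) \<le> sqrt (2 * T / \<nu>)" .
  qed (use q in auto)
  finally show ?thesis by (simp add: \<gamma>_def ac_simps)
qed

text \<open>No derivative has to be absorbed in the linear part, so the whole heat exponent is spent
  on the weight, at the cost of \<open>exp (t / (4 * \<nu>))\<close>, which is below
  \<open>exp 1\<close> and hence below 3.\<close>

lemma norm_heat_le: assumes "t \<in> {0..T}" shows "heat t n \<le> 3 * exp (- (t * k n))"
proof -
  have "0 \<le> t * \<nu> * (k n - 1 / (2 * \<nu>))\<^sup>2" using assms \<nu>_pos by simp
  also have "\<dots> = \<nu> * t * (k n)\<^sup>2 - t * k n + t / (4 * \<nu>)"
    using \<nu>_pos by (simp add: power2_eq_square field_simps)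
  finally have "- (\<nu> * t * (k n)\<^sup>2) \<le> 1 - t * k n"
    using assms T_le \<nu>_pos by (smt (verit, best) atLeastAtMost_iff divide_le_eq_1)
  then have "heat t n \<le> exp (1 - t * k n)" by (simp add: heat_def)
  also have "\<dots> \<le> 3 * exp (- (t * k n))"
    using exp_le by (simp add: exp_diff exp_minus divide_right_mono field_simps)
  finally show ?thesis .
qed

lemma \<gamma>_nonneg: "0 \<le> \<gamma>" using T_pos \<nu>_pos by (simp add: \<gamma>_def)

definition mass :: real where "mass = (\<Sum>\<^sub>\<infinity>n. norm (a n))"

lemma mass_nonneg: "0 \<le> mass" by (simp add: mass_def infsum_nonneg)

text \<open>The bound \<open>6 * mass\<close> is invariant: with \<open>m = mass\<close> the next
  sum is at most \<open>3 * m + 36 * \<gamma> * m\<^sup>2\<close>, that is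
  \<open>3 * m + (12 * \<gamma> * m) * (3 * m)\<close>, and \<open>T_small\<close> says exactly that
  \<open>12 * \<gamma> * m\<close> is at most 1.\<close>

lemma majorant_props:
  shows majorant_nonneg: "0 \<le> majorant j n"
    and majorant_summable: "majorant j summable_on UNIV"
    and majorant_sum_le: "(\<Sum>\<^sub>\<infinity>n. majorant j n) \<le> 6 * mass"
proof (induction j arbitrary: n)
  case 0
  case 1 show ?case by simp
  case 2 show ?case by simp
  case 3 show ?case using mass_nonneg by simp
next
  case (Suc j)
  have abs: "majorant j abs_summable_on UNIV"
    using Suc(2) summable_on_iff_abs_summable_on_real by blast
  have c: "conv (majorant j) (majorant j) summable_on UNIV"
    by (rule abs_summable_summable[OF conv_abs_summable[OF abs abs]])
  case 1 show ?case using \<gamma>_nonneg Suc(1) by (simp add: conv_nonneg)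
  case 2 show ?case using c a_summable by (auto intro!: summable_on_add summable_on_cmult_right)
  case 3
  have "(\<Sum>\<^sub>\<infinity>n. majorant (Suc j) n) = 3 * mass + \<gamma> * ((\<Sum>\<^sub>\<infinity>n. majorant j n) * (\<Sum>\<^sub>\<infinity>n. majorant j n))"
    using c a_summable abs
    by (simp add: infsum_add infsum_cmult_right summable_on_cmult_right infsum_conv mass_def)
  also have "\<dots> \<le> 3 * mass + \<gamma> * ((6 * mass) * (6 * mass))"
    using Suc(3) \<gamma>_nonneg mass_nonneg Suc(1)
    by (intro add_left_mono mult_left_mono mult_mono) (auto simp: infsum_nonneg)
  also have "\<dots> = 3 * mass + (12 * \<gamma> * mass) * (3 * mass)" by (simp add: algebra_simps)
  also have "\<dots> \<le> 3 * mass + 1 * (3 * mass)"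
    using T_small mass_nonneg by (intro add_left_mono mult_right_mono) (auto simp: \<gamma>_def mass_def)
  finally show ?case by simp
qed

lemma majorant_Suc_le: "majorant j n \<le> majorant (Suc j) n"
proof (induction j arbitrary: n)
  case 0 show ?case using \<gamma>_nonneg conv_nonneg[of "\<lambda>n. 0" "\<lambda>n. 0" n] by (simp add: conv_def)
next
  case (Suc j)
  have "conv (majorant j) (majorant j) n \<le> conv (majorant (Suc j)) (majorant (Suc j)) n"
    by (rule conv_mono[OF majorant_summable majorant_summable]) (rule majorant_nonneg Suc.IH)+
  then show ?case using \<gamma>_nonneg by (simp add: mult_left_mono)
qed

lemma majorant_mono: "i \<le> j \<Longrightarrow> majorant i n \<le> majorant j n"
  using lift_Suc_mono_le[of "\<lambda>j. majorant j n"] majorant_Suc_le by blast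

text \<open>Once \<open>heat t n\<close> is taken out, \<open>t\<close> occurs in the integral only
  as its upper end, so continuity and differentiability in time follow from the theory of indefinite
  integrals. The factor \<open>heat (- s) n\<close> grows with \<open>n\<close>, but only a fixed
  \<open>n\<close> is considered.\<close>

lemma heat_integral_eq:
  fixes f :: "real \<Rightarrow> 'b"
  shows "integral {0..t} (\<lambda>s. heat (t - s) n *\<^sub>R f s) = heat t n *\<^sub>R integral {0..t} (\<lambda>s. heat (- s) n *\<^sub>R f s)"
proof -
  have "heat (t - s) n *\<^sub>R f s = heat t n *\<^sub>R heat (- s) n *\<^sub>R f s" for s
    by (simp add: heat_def exp_add[symmetric] algebra_simps)
  then have "(\<lambda>s. heat (t - s) n *\<^sub>R f s) = (\<lambda>s. heat t n *\<^sub>R heat (- s) n *\<^sub>R f s)" by blast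
  then show ?thesis by (simp only: integral_cmul)
qed

lemma duhamel_continuous:
  assumes "continuous_on {0..T} (\<lambda>s. quad (v s) n)"
  shows "continuous_on {0..T} (\<lambda>t. duhamel v t n)"
proof -
  have "(\<lambda>s. heat (- s) n *\<^sub>R quad (v s) n) integrable_on {0..T}"
    using heat_continuous[of "{0..T}" 0 n]
    by (intro integrable_continuous_interval continuous_intros assms) simp
  then have "continuous_on {0..T} (\<lambda>t. integral {0..t} (\<lambda>s. heat (- s) n *\<^sub>R quad (v s) n))"
    by (rule indefinite_integral_continuous_1)
  then show ?thesis
    unfolding duhamel_def heat_integral_eq
    by (intro continuous_intros) (auto simp: heat_def intro!: continuous_intros)
qed

lemma norm_duhamel_diff_le:
  assumes v: "\<And>s n. s \<in> {0..T} \<Longrightarrow> norm (v s n) \<le> exp (- (s * k n)) * b n" "\<And>n. 0 \<le> b n" "b summable_on UNIV"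
    "\<And>n. continuous_on {0..T} (\<lambda>s. v s n)"
    and v': "\<And>s n. s \<in> {0..T} \<Longrightarrow> norm (v' s n) \<le> exp (- (s * k n)) * b' n" "\<And>n. 0 \<le> b' n" "b' summable_on UNIV"
    "\<And>n. continuous_on {0..T} (\<lambda>s. v' s n)"
    and le: "\<And>s n. s \<in> {0..T} \<Longrightarrow> norm (v s n - v' s n) \<le> exp (- (s * k n)) * (b n - b' n)"
    and t: "t \<in> {0..T}"
  shows "norm (duhamel v t n - duhamel v' t n) \<le> exp (- (t * k n)) * (\<gamma> * (conv b b n - conv b' b' n))"
proof -
  have c: "continuous_on {0..T} (\<lambda>s. quad (v s) n)" "continuous_on {0..T} (\<lambda>s. quad (v' s) n)"
    by (rule continuous_quad[OF v(4) v(1-3)] continuous_quad[OF v'(4) v'(1-3)]; assumption)+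
  have i: "(\<lambda>s. heat (t - s) n *\<^sub>R quad (v s) n) integrable_on {0..t}"
    "(\<lambda>s. heat (t - s) n *\<^sub>R quad (v' s) n) integrable_on {0..t}"
    by (rule heat_integrable[OF c(1) t] heat_integrable[OF c(2) t])+
  have b0: "b' n \<le> b n" for n
    using order_trans[OF norm_ge_zero le[of 0 n]] T_pos by simp
  have "norm (duhamel v t n - duhamel v' t n)
      = norm (integral {0..t} (\<lambda>s. heat (t - s) n *\<^sub>R (quad (v s) n - quad (v' s) n)))"
    using i by (simp add: duhamel_def integral_diff scaleR_diff_right norm_minus_commute)
  also have "\<dots> \<le> exp (- (t * k n)) * (\<gamma> * (conv b b n - conv b' b' n))"
  proof (rule norm_heat_integral_le[OF t])
    show "norm (quad (v s) n - quad (v' s) n) \<le> 2 * k n * exp (- (s * k n)) * (conv b b n - conv b' b' n)"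
      if "s \<in> {0..t}" for s
      using that t by (intro norm_quad_diff_le v v' le) auto
    show "0 \<le> conv b b n - conv b' b' n"
      using conv_mono[OF v(3) v(3) v'(2) b0 v'(2) b0] by simp
  qed (intro continuous_intros c)
  finally show ?thesis .
qed

section \<open>Picard iterates and their limit\<close>

lemma picard_props:
  shows picard_continuous: "continuous_on {0..T} (\<lambda>t. picard j t n)"
    and picard_bound: "t \<in> {0..T} \<Longrightarrow> norm (picard j t n) \<le> exp (- (t * k n)) * majorant j n"
    and picard_diff: "t \<in> {0..T} \<Longrightarrow> norm (picard (Suc j) t n - picard j t n)
        \<le> exp (- (t * k n)) * (majorant (Suc j) n - majorant j n)"
proof (induction j arbitrary: n t)
  case 0
  case 1 show ?case by simp
  case 2 show ?case by simp
  case 3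
  have "norm (picard (Suc 0) t n) = heat t n * norm (a n)"
    by (simp add: duhamel_def quad_def heat_def bounded_bilinear.zero_left[OF N_bilinear])
  also have "\<dots> \<le> (3 * exp (- (t * k n))) * norm (a n)"
    by (intro mult_right_mono norm_heat_le 3) auto
  finally show ?case by (simp add: conv_def ac_simps)
next
  case (Suc j)
  \<comment> \<open>The three claims are proved together because the bound for an iterate is
    obtained from the bound for its predecessor plus the bound for their difference; the majorants
    telescope.\<close>
  have b: "norm (picard (Suc j) t n) \<le> exp (- (t * k n)) * majorant (Suc j) n" if "t \<in> {0..T}" for t n
  proof -
    have "norm (picard (Suc j) t n) \<le> norm (picard j t n) + norm (picard (Suc j) t n - picard j t n)"
      by (metis add.commute diff_add_cancel norm_triangle_ineq)
    also have "\<dots> \<le> exp (- (t * k n)) * majorant j n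
        + exp (- (t * k n)) * (majorant (Suc j) n - majorant j n)"
      by (intro add_mono Suc.IH that)
    finally show ?thesis by (simp add: algebra_simps)
  qed
  have c: "continuous_on {0..T} (\<lambda>t. picard (Suc j) t n)" for n
    unfolding picard.simps
    by (intro duhamel_continuous continuous_quad[of _ "majorant j"] Suc.IH majorant_nonneg majorant_summable)
  case 1 show ?case by (rule c)
  case 2 then show ?case by (rule b)
  case 3
  have "norm (duhamel (picard (Suc j)) t n - duhamel (picard j) t n)
     \<le> exp (- (t * k n)) * (\<gamma> * (conv (majorant (Suc j)) (majorant (Suc j)) n - conv (majorant j) (majorant j) n))"
    by (rule norm_duhamel_diff_le) (intro b c Suc.IH majorant_nonneg majorant_summable 3; assumption)+
  then show ?case by (simp add: algebra_simps)
qed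

lemma picard_diff_le:
  assumes "i \<le> j" "t \<in> {0..T}"
  shows "norm (picard j t n - picard i t n) \<le> exp (- (t * k n)) * (majorant j n - majorant i n)"
  using assms(1)
proof (induction j rule: dec_induct)
  case (step j)
  have "norm (picard (Suc j) t n - picard i t n)
      \<le> norm (picard (Suc j) t n - picard j t n) + norm (picard j t n - picard i t n)"
    by (metis (no_types, opaque_lifting) diff_add_cancel add_diff_eq norm_triangle_ineq)
  also have "\<dots> \<le> exp (- (t * k n)) * (majorant (Suc j) n - majorant j n)
      + exp (- (t * k n)) * (majorant j n - majorant i n)"
    by (intro add_mono step.IH picard_diff assms(2))
  finally show ?case by (simp add: algebra_simps)
qed simp

definition majorant_lim :: "'i \<Rightarrow> real" where "majorant_lim n = lim (\<lambda>j. majorant j n)"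

lemma majorant_tendsto: "(\<lambda>j. majorant j n) \<longlonglongrightarrow> majorant_lim n"
proof -
  have "majorant j n \<le> 6 * mass" for j
    using finite_sum_le_infsum[OF majorant_summable, of "{n}" j] majorant_sum_le[of j] majorant_nonneg
    by simp
  then have "convergent (\<lambda>j. majorant j n)"
    using majorant_mono majorant_nonneg
    by (intro Bseq_monoseq_convergent BseqI'[of _ "6 * mass"] monoI1) auto
  then show ?thesis unfolding majorant_lim_def by (rule convergent_LIMSEQ_iff[THEN iffD1])
qed

lemma majorant_le_lim: "majorant j n \<le> majorant_lim n"
  by (rule incseq_le[OF incseq_SucI majorant_tendsto]) (rule majorant_Suc_le)

lemma majorant_lim_nonneg: "0 \<le> majorant_lim n"
  using majorant_le_lim[of 0 n] by simp

text \<open>Monotone convergence: the bound \<open>6 * mass\<close> on every finite partial sum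
  survives the limit in \<open>j\<close>.\<close>

lemma majorant_lim_summable: "majorant_lim summable_on UNIV"
proof (rule nonneg_bdd_above_summable_on)
  show "bdd_above (sum majorant_lim ` {F. F \<subseteq> UNIV \<and> finite F})"
  proof (rule bdd_aboveI2)
    fix F :: "'i set" assume "F \<in> {F. F \<subseteq> UNIV \<and> finite F}"
    then have F: "finite F" by simp
    have "(\<lambda>j. sum (majorant j) F) \<longlonglongrightarrow> sum majorant_lim F"
      by (intro tendsto_sum majorant_tendsto)
    moreover have "sum (majorant j) F \<le> 6 * mass" for j
      using finite_sum_le_infsum[OF majorant_summable F, of j] majorant_sum_le[of j] majorant_nonneg by simp
    ultimately show "sum majorant_lim F \<le> 6 * mass"
      by (intro LIMSEQ_le_const2) auto
  qed
qed (rule majorant_lim_nonneg)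

definition solution :: "real \<Rightarrow> 'i \<Rightarrow> 'b" where "solution t n = lim (\<lambda>j. picard j t n)"

text \<open>By \<open>picard_diff_le\<close> the increments of the iterates are bounded by those of
  a convergent real sequence, so the iterates are Cauchy.\<close>

lemma picard_tendsto:
  assumes "t \<in> {0..T}"
  shows "(\<lambda>j. picard j t n) \<longlonglongrightarrow> solution t n"
proof -
  have "Cauchy (\<lambda>j. picard j t n)"
  proof (rule metric_CauchyI)
    fix e :: real assume "e > 0"
    then obtain M where M: "\<And>i j. i \<ge> M \<Longrightarrow> j \<ge> M \<Longrightarrow> dist (majorant i n) (majorant j n) < e"
      using metric_CauchyD[OF LIMSEQ_imp_Cauchy[OF majorant_tendsto]] by blast
    have *: "dist (picard j t n) (picard i t n) < e" if "i \<ge> M" "j \<ge> i" for i j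
    proof -
      have "norm (picard j t n - picard i t n) \<le> exp (- (t * k n)) * (majorant j n - majorant i n)"
        using that assms by (intro picard_diff_le)
      also have "\<dots> \<le> 1 * (majorant j n - majorant i n)"
        using assms k_nonneg majorant_mono[OF that(2)] by (intro mult_right_mono) auto
      also have "\<dots> < e" using M[of j i] that by (auto simp: dist_real_def)
      finally show ?thesis by (simp add: dist_norm)
    qed
    show "\<exists>M. \<forall>i\<ge>M. \<forall>j\<ge>M. dist (picard i t n) (picard j t n) < e"
      by (rule exI[of _ M]) (metis * dist_commute nle_le)
  qed
  then show ?thesis unfolding solution_def by (simp add: Cauchy_convergent_iff convergent_LIMSEQ_iff)
qed

lemma solution_diff_le:
  assumes "t \<in> {0..T}"
  shows "norm (solution t n - picard j t n) \<le> exp (- (t * k n)) * (majorant_lim n - majorant j n)"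
proof (rule tendsto_le[of sequentially])
  show "(\<lambda>i. norm (picard i t n - picard j t n)) \<longlonglongrightarrow> norm (solution t n - picard j t n)"
    by (intro tendsto_intros picard_tendsto assms)
  show "(\<lambda>i. exp (- (t * k n)) * (majorant i n - majorant j n))
      \<longlonglongrightarrow> exp (- (t * k n)) * (majorant_lim n - majorant j n)"
    by (intro tendsto_intros majorant_tendsto)
  show "eventually (\<lambda>i. norm (picard i t n - picard j t n) \<le> exp (- (t * k n)) * (majorant i n - majorant j n)) sequentially"
    using picard_diff_le[OF _ assms] by (auto simp: eventually_sequentially)
qed simp

lemma solution_bound: "t \<in> {0..T} \<Longrightarrow> norm (solution t n) \<le> exp (- (t * k n)) * majorant_lim n"
  using solution_diff_le[of t n 0] by simp

lemma solution_continuous: "continuous_on {0..T} (\<lambda>t. solution t n)"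
proof (rule uniform_limit_theorem[of _ "\<lambda>j t. picard j t n" sequentially])
  show "eventually (\<lambda>j. continuous_on {0..T} (\<lambda>t. picard j t n)) sequentially"
    by (simp add: picard_continuous)
  show "uniform_limit {0..T} (\<lambda>j t. picard j t n) (\<lambda>t. solution t n) sequentially"
  proof (rule uniform_limitI)
    fix e :: real assume "e > 0"
    then have "eventually (\<lambda>j. dist (majorant j n) (majorant_lim n) < e) sequentially"
      using majorant_tendsto tendstoD by blast
    then show "eventually (\<lambda>j. \<forall>t\<in>{0..T}. dist (picard j t n) (solution t n) < e) sequentially"
    proof eventually_elim
      case (elim j)
      show ?case
      proof
        fix t assume t: "t \<in> {0..T}"
        have "dist (picard j t n) (solution t n) \<le> exp (- (t * k n)) * (majorant_lim n - majorant j n)"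
          using solution_diff_le[OF t] by (simp add: dist_norm norm_minus_commute)
        also have "\<dots> \<le> 1 * (majorant_lim n - majorant j n)"
          using t k_nonneg majorant_le_lim by (intro mult_right_mono) auto
        also have "\<dots> < e" using elim by (simp add: dist_real_def)
        finally show "dist (picard j t n) (solution t n) < e" .
      qed
    qed
  qed
qed simp

lemma solution_quad_continuous: "continuous_on {0..T} (\<lambda>t. quad (solution t) n)"
  by (intro continuous_quad[of _ majorant_lim] solution_continuous solution_bound majorant_lim_nonneg
      majorant_lim_summable)

text \<open>The Duhamel map applied to the limit differs from the next iterate by at most a multiple
  of \<open>conv majorant_lim majorant_lim n - conv (majorant j) (majorant j) n\<close>, which tends
  to 0 by dominated convergence.\<close>

lemma solution_eq:
  assumes t: "t \<in> {0..T}"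
  shows "solution t n = duhamel solution t n"
proof -
  have "(\<lambda>j. conv (majorant j) (majorant j) n) \<longlonglongrightarrow> conv majorant_lim majorant_lim n"
    unfolding conv_def
  proof (rule tendsto_infsum_dominated)
    show "(\<lambda>j. majorant j (n - m) * majorant j m) \<longlonglongrightarrow> majorant_lim (n - m) * majorant_lim m" for m
      by (intro tendsto_intros majorant_tendsto)
    show "(\<lambda>m. majorant_lim (n - m) * majorant_lim m) summable_on UNIV"
      by (rule conv_self_summable[OF majorant_lim_summable])
    show "\<forall>\<^sub>F j in sequentially. \<forall>m. norm (majorant j (n - m) * majorant j m) \<le> majorant_lim (n - m) * majorant_lim m"
      using majorant_nonneg majorant_le_lim majorant_lim_nonneg
      by (intro always_eventually allI) (simp add: abs_mult mult_mono)
  qed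
  then have "(\<lambda>j. exp (- (t * k n)) * (\<gamma> * (conv majorant_lim majorant_lim n - conv (majorant j) (majorant j) n)))
     \<longlonglongrightarrow> exp (- (t * k n)) * (\<gamma> * (conv majorant_lim majorant_lim n - conv majorant_lim majorant_lim n))"
    by (intro tendsto_intros)
  then have lim: "(\<lambda>j. exp (- (t * k n)) * (\<gamma> * (conv majorant_lim majorant_lim n - conv (majorant j) (majorant j) n)))
     \<longlonglongrightarrow> 0" by simp
  have "(\<lambda>j. duhamel solution t n - picard (Suc j) t n) \<longlonglongrightarrow> 0"
  proof (rule Lim_null_comparison[OF _ lim])
    show "\<forall>\<^sub>F j in sequentially. norm (duhamel solution t n - picard (Suc j) t n)
      \<le> exp (- (t * k n)) * (\<gamma> * (conv majorant_lim majorant_lim n - conv (majorant j) (majorant j) n))"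
      unfolding picard.simps
      by (intro always_eventually allI norm_duhamel_diff_le)
        (intro solution_bound majorant_lim_nonneg majorant_lim_summable solution_continuous picard_bound
          majorant_nonneg majorant_summable picard_continuous solution_diff_le t; assumption)+
  qed
  moreover have "(\<lambda>j. duhamel solution t n - picard (Suc j) t n) \<longlonglongrightarrow> duhamel solution t n - solution t n"
    by (intro tendsto_intros LIMSEQ_Suc picard_tendsto t)
  ultimately show ?thesis using LIMSEQ_unique by fastforce
qed

lemma solution_0: "solution 0 n = a n"
  using solution_eq[of 0 n] T_pos by (simp add: duhamel_def heat_def)

lemma solution_vector_derivative:
  assumes t: "t \<in> {0..T}"
  shows "((\<lambda>t. solution t n) has_vector_derivative (- (\<nu> * (k n)\<^sup>2) *\<^sub>R solution t n - quad (solution t) n))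
    (at t within {0..T})"
proof -
  define G where "G t = integral {0..t} (\<lambda>s. heat (- s) n *\<^sub>R quad (solution s) n)" for t
  have hc: "continuous_on {0..T} (\<lambda>s. heat (- s) n)"
    using heat_continuous[of "{0..T}" 0 n] by simp
  have "((\<lambda>u. integral {0..u} (\<lambda>s. heat (- s) n *\<^sub>R quad (solution s) n)) has_vector_derivative
      heat (- t) n *\<^sub>R quad (solution t) n) (at t within {0..T})"
    by (rule integral_has_vector_derivative[OF _ t])
      (intro continuous_intros hc solution_quad_continuous)
  then have dG: "(G has_vector_derivative heat (- t) n *\<^sub>R quad (solution t) n) (at t within {0..T})"
    by (simp add: G_def[abs_def])
  have dh: "((\<lambda>t. heat t n) has_real_derivative - (\<nu> * (k n)\<^sup>2) * heat t n) (at t within {0..T})"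
    unfolding heat_def by (auto intro!: derivative_eq_intros)
  have hh: "heat t n * heat (- t) n = 1" by (simp add: heat_def exp_add[symmetric])
  have eq: "solution s n = heat s n *\<^sub>R (a n - G s)" if "s \<in> {0..T}" for s
    using solution_eq[OF that, of n] unfolding duhamel_def heat_integral_eq G_def
    by (simp add: scaleR_diff_right)
  have "((\<lambda>t. heat t n *\<^sub>R (a n - G t)) has_vector_derivative
     (heat t n *\<^sub>R (0 - heat (- t) n *\<^sub>R quad (solution t) n) + (- (\<nu> * (k n)\<^sup>2) * heat t n) *\<^sub>R (a n - G t)))
     (at t within {0..T})"
    by (intro has_vector_derivative_scaleR dh has_vector_derivative_diff has_vector_derivative_const dG)
  moreover have "heat t n *\<^sub>R (0 - heat (- t) n *\<^sub>R quad (solution t) n) + (- (\<nu> * (k n)\<^sup>2) * heat t n) *\<^sub>R (a n - G t)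
      = - (\<nu> * (k n)\<^sup>2) *\<^sub>R solution t n - quad (solution t) n"
    using hh eq[OF t] by (simp add: scaleR_diff_right)
  ultimately have "((\<lambda>t. heat t n *\<^sub>R (a n - G t)) has_vector_derivative
     (- (\<nu> * (k n)\<^sup>2) *\<^sub>R solution t n - quad (solution t) n)) (at t within {0..T})" by simp
  then show ?thesis
    by (rule has_vector_derivative_transform[rotated 2]) (use eq t in auto)
qed

text \<open>Applied later to the scalar product with the frequency, this propagates
  incompressibility: the projected symbol takes values orthogonal to the frequency, so
  \<open>D\<close> kills every term of the Duhamel formula.\<close>

lemma solution_annihilated:
  assumes D: "bounded_linear D" and "\<And>v w. D (N n v w) = 0" and "D (a n) = 0" and t: "t \<in> {0..T}"
  shows "D (solution t n) = 0"
proof -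
  interpret bounded_linear D by (rule D)
  have q: "D (quad (solution s) n) = 0" if "s \<in> {0..T}" for s
  proof -
    have "(\<lambda>m. N n (solution s (n - m)) (solution s m)) summable_on UNIV"
      by (rule abs_summable_summable[OF quad_abs_summable])
       (use that solution_bound majorant_lim_nonneg majorant_lim_summable in auto)
    then have "D (quad (solution s) n) = (\<Sum>\<^sub>\<infinity>m. D (N n (solution s (n - m)) (solution s m)))"
      unfolding quad_def by (rule infsum_bounded_linear[OF D])
    then show ?thesis by (simp add: assms)
  qed
  have i: "(\<lambda>s. heat (t - s) n *\<^sub>R quad (solution s) n) integrable_on {0..t}"
    by (rule heat_integrable[OF solution_quad_continuous t])
  have "D (integral {0..t} (\<lambda>s. heat (t - s) n *\<^sub>R quad (solution s) n))
     = integral {0..t} (D \<circ> (\<lambda>s. heat (t - s) n *\<^sub>R quad (solution s) n))"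
    by (rule integral_linear[OF i D, symmetric])
  also have "\<dots> = integral {0..t} (\<lambda>s. 0)"
    by (rule Henstock_Kurzweil_Integration.integral_cong) (use q t in \<open>auto simp: scaleR\<close>)
  finally show ?thesis
    using solution_eq[OF t, of n] by (simp add: duhamel_def diff scaleR assms)
qed

text \<open>Applied later to complex conjugation, this makes the velocity real. The symmetry is
  proved for every Picard iterate by induction and passed to the limit, so no uniqueness statement
  for the fixed point is required.\<close>

lemma solution_involution:
  assumes J: "bounded_linear J" and N: "\<And>n v w. N (- n) (J v) (J w) = J (N n v w)"
    and k: "\<And>n. k (- n) = k n" and a: "\<And>n. a (- n) = J (a n)" and t: "t \<in> {0..T}"
  shows "solution t (- n) = J (solution t n)"
proof -
  interpret bounded_linear J by (rule J)
  have "picard j t (- n) = J (picard j t n)" if "t \<in> {0..T}" for j t n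
    using that
  proof (induction j arbitrary: t n)
    case (Suc j)
    have q: "quad (picard j s) (- n) = J (quad (picard j s) n)" if s: "s \<in> {0..T}" for s
    proof -
      have sm: "(\<lambda>m. N n (picard j s (n - m)) (picard j s m)) summable_on UNIV"
        by (rule abs_summable_summable[OF quad_abs_summable])
          (use s picard_bound majorant_nonneg majorant_summable in auto)
      have "quad (picard j s) (- n) = (\<Sum>\<^sub>\<infinity>m. N (- n) (picard j s (- n - m)) (picard j s m))"
        by (simp add: quad_def)
      also have "\<dots> = (\<Sum>\<^sub>\<infinity>m. N (- n) (picard j s (- n - (- m))) (picard j s (- m)))"
        by (rule infsum_reindex_bij_betw[symmetric]) (rule bij_uminus)
      also have "\<dots> = (\<Sum>\<^sub>\<infinity>m. J (N n (picard j s (n - m)) (picard j s m)))"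
      proof (rule infsum_cong)
        fix m
        have "picard j s (- n - (- m)) = J (picard j s (n - m))"
          using Suc.IH[OF s, of "n - m"] by (metis minus_diff_eq minus_diff_commute add.commute diff_minus_eq_add uminus_add_conv_diff)
        then show "N (- n) (picard j s (- n - (- m))) (picard j s (- m)) = J (N n (picard j s (n - m)) (picard j s m))"
          using Suc.IH[OF s, of m] by (simp add: N)
      qed
      also have "\<dots> = J (quad (picard j s) n)"
        unfolding quad_def by (rule infsum_bounded_linear[OF J sm, symmetric])
      finally show ?thesis .
    qed
    have i: "(\<lambda>s. heat (t - s) n *\<^sub>R quad (picard j s) n) integrable_on {0..t}"
    proof -
      have "continuous_on {0..T} (\<lambda>s. quad (picard j s) n)"
        by (intro continuous_quad[of _ "majorant j"] picard_continuous picard_bound majorant_nonneg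
            majorant_summable)
      then show ?thesis using Suc.prems by (rule heat_integrable)
    qed
    have h: "heat r (- n) = heat r n" for r by (simp add: heat_def k)
    have "J (integral {0..t} (\<lambda>s. heat (t - s) n *\<^sub>R quad (picard j s) n))
       = integral {0..t} (J \<circ> (\<lambda>s. heat (t - s) n *\<^sub>R quad (picard j s) n))"
      by (rule integral_linear[OF i J, symmetric])
    also have "\<dots> = integral {0..t} (\<lambda>s. heat (t - s) (- n) *\<^sub>R quad (picard j s) (- n))"
      by (rule Henstock_Kurzweil_Integration.integral_cong) (use q Suc.prems in \<open>auto simp: scaleR h\<close>)
    finally show ?case by (simp add: duhamel_def diff scaleR a h)
  qed (simp add: zero)
  then have "(\<lambda>j. picard j t (- n)) \<longlonglongrightarrow> J (solution t n)"
    using tendsto[OF picard_tendsto[OF t, of n]] t by simp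
  then show ?thesis using picard_tendsto[OF t, of "- n"] LIMSEQ_unique by blast
qed

text \<open>The smoothing of the heat factor turns any bound on the solution into a better bound on its
  nonlinear part.\<close>

lemma norm_solution_minus_heat_le:
  assumes \<beta>: "\<And>s n. s \<in> {0..T} \<Longrightarrow> norm (solution s n) \<le> \<beta> n" "\<beta> summable_on UNIV" and t: "t \<in> {0..T}"
  shows "norm (solution t n - heat t n *\<^sub>R a n) \<le> 2 * t * k n * conv \<beta> \<beta> n" (is ?A)
    and "k n * norm (solution t n - heat t n *\<^sub>R a n) \<le> 2 / \<nu> * conv \<beta> \<beta> n" (is ?B)
proof -
  have \<beta>0: "0 \<le> \<beta> n" for n using \<beta>(1)[of 0 n] T_pos order_trans[OF norm_ge_zero] by simp
  have c0: "0 \<le> conv \<beta> \<beta> n" by (simp add: conv_nonneg \<beta>0)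
  have i: "(\<lambda>s. heat (t - s) n *\<^sub>R quad (solution s) n) integrable_on {0..t}"
    by (rule heat_integrable[OF solution_quad_continuous t])
  \<comment> \<open>The estimate for \<open>quad\<close> at weight parameter 0, where the
    exponential weight is 1: only a bound by \<open>\<beta>\<close> that is uniform in time is
    assumed here.\<close>
  have q: "norm (quad (solution s) n) \<le> 2 * k n * conv \<beta> \<beta> n" if "s \<in> {0..t}" for s
    using norm_quad_le[of "solution s" 0 \<beta> n] \<beta> \<beta>0 that t by simp
  have eq: "norm (solution t n - heat t n *\<^sub>R a n)
      = norm (integral {0..t} (\<lambda>s. heat (t - s) n *\<^sub>R quad (solution s) n))"
    using solution_eq[OF t, of n] by (simp add: duhamel_def)
  have le: "norm (solution t n - heat t n *\<^sub>R a n) \<le> integral {0..t} (\<lambda>s. 2 * k n * conv \<beta> \<beta> n * heat (t - s) n)"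
    unfolding eq
  proof (rule Henstock_Kurzweil_Integration.integral_norm_bound_integral[OF i])
    show "(\<lambda>s. 2 * k n * conv \<beta> \<beta> n * heat (t - s) n) integrable_on {0..t}"
      by (intro integrable_continuous_interval continuous_intros heat_continuous)
    show "norm (heat (t - s) n *\<^sub>R quad (solution s) n) \<le> 2 * k n * conv \<beta> \<beta> n * heat (t - s) n"
      if "s \<in> {0..t}" for s
      using mult_left_mono[OF q[OF that], of "heat (t - s) n"] by (simp add: heat_def ac_simps)
  qed
  also have "\<dots> \<le> integral {0..t} (\<lambda>s. 2 * k n * conv \<beta> \<beta> n)"
  proof (rule integral_le)
    show "(\<lambda>s. 2 * k n * conv \<beta> \<beta> n * heat (t - s) n) integrable_on {0..t}"
      by (intro integrable_continuous_interval continuous_intros heat_continuous)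
    show "2 * k n * conv \<beta> \<beta> n * heat (t - s) n \<le> 2 * k n * conv \<beta> \<beta> n" if "s \<in> {0..t}" for s
      using that \<nu>_pos k_nonneg[of n] c0 by (intro mult_left_le) (auto simp: heat_def)
  qed auto
  also have "\<dots> = 2 * t * k n * conv \<beta> \<beta> n" using t by simp
  finally show ?A .
  show ?B
  proof (cases "k n = 0")
    case True then show ?thesis using c0 \<nu>_pos by simp
  next
    case False
    then have kp: "k n > 0" using k_nonneg[of n] by simp
    \<comment> \<open>No part of the heat factor is spent on a weight, so its integral is at most
      \<open>1 / (\<nu> * (k n)\<^sup>2)\<close>. Two powers of \<open>k n\<close> are gained
      against the one that the nonlinearity costs.\<close>
    have "((\<lambda>s. heat (t - s) n) has_integral
      (1 / (\<nu> * (k n)\<^sup>2)) * heat (t - t) n - (1 / (\<nu> * (k n)\<^sup>2)) * heat (t - 0) n) {0..t}"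
      unfolding heat_def
      by (rule fundamental_theorem_of_calculus)
       (use t kp \<nu>_pos in \<open>auto intro!: derivative_eq_intros simp flip: has_real_derivative_iff_has_vector_derivative\<close>)
    then have "integral {0..t} (\<lambda>s. heat (t - s) n) = (1 / (\<nu> * (k n)\<^sup>2)) * (1 - heat t n)"
      by (simp add: integral_unique heat_def algebra_simps)
    also have "\<dots> \<le> 1 / (\<nu> * (k n)\<^sup>2)"
      using kp \<nu>_pos by (intro mult_left_le) (auto simp: heat_def)
    finally have h: "integral {0..t} (\<lambda>s. heat (t - s) n) \<le> 1 / (\<nu> * (k n)\<^sup>2)" .
    have "k n * norm (solution t n - heat t n *\<^sub>R a n)
        \<le> k n * (2 * k n * conv \<beta> \<beta> n * integral {0..t} (\<lambda>s. heat (t - s) n))"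
      using le kp by (intro mult_left_mono) auto
    also have "\<dots> \<le> k n * (2 * k n * conv \<beta> \<beta> n * (1 / (\<nu> * (k n)\<^sup>2)))"
      using h kp c0 by (intro mult_left_mono) auto
    also have "\<dots> = 2 / \<nu> * conv \<beta> \<beta> n"
      using kp \<nu>_pos by (simp add: power2_eq_square)
    finally show ?thesis .
  qed
qed

end

section \<open>Periodic functions and their mean value\<close>

lemma spatially_periodic_shift:
  assumes "spatially_periodic L f"
  shows "f (x + (\<chi> i. L * of_int (k $ i))) = f x"
proof -
  have nat: "f (x + (L * of_nat m) *\<^sub>R axis i 1) = f x" for m i x
  proof (induction m)
    case (Suc m)
    have "x + (L * of_nat (Suc m)) *\<^sub>R axis i 1 = (x + (L * of_nat m) *\<^sub>R axis i 1) + L *\<^sub>R axis i (1::real)"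
      by (simp add: algebra_simps)
    then show ?case using assms Suc unfolding spatially_periodic_def by (simp only:)
  qed simp
  have int: "f (x + (L * of_int m) *\<^sub>R axis i 1) = f x" for m i x
  proof (cases "m \<ge> 0")
    case True then show ?thesis using nat[of x "nat m" i] by simp
  next
    case False
    then show ?thesis using nat[of "x + (L * of_int m) *\<^sub>R axis i 1" "nat (- m)" i] by simp
  qed
  have "x + (\<chi> i. L * of_int (k $ i)) = x + (L * of_int (k $ 1)) *\<^sub>R axis 1 1
      + (L * of_int (k $ 2)) *\<^sub>R axis 2 1 + (L * of_int (k $ 3)) *\<^sub>R axis 3 1"
    by (simp add: vec_eq_iff forall_3 axis_def)
  then show ?thesis by (simp only: int)
qed

lemma spatially_periodic_translate:
  assumes "spatially_periodic L f" shows "spatially_periodic L (\<lambda>x. f (x + y))"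
  unfolding spatially_periodic_def
proof (intro allI)
  fix x i
  have "x + L *\<^sub>R axis i 1 + y = (x + y) + L *\<^sub>R axis i 1" by (simp add: ac_simps)
  then show "f (x + L *\<^sub>R axis i 1 + y) = f (x + y)"
    using assms unfolding spatially_periodic_def by (simp only:)
qed

lemma spatially_periodic_partial_deriv:
  assumes "spatially_periodic L f" shows "spatially_periodic L (partial_deriv i f)"
  unfolding spatially_periodic_def partial_deriv_def
proof (intro allI)
  fix x j
  have "f (x + L *\<^sub>R axis j 1 + h *\<^sub>R axis i 1) = f (x + h *\<^sub>R axis i 1)" for h
    using spatially_periodic_translate[OF assms] unfolding spatially_periodic_def by blast
  then show "vector_derivative (\<lambda>h. f (x + L *\<^sub>R axis j 1 + h *\<^sub>R axis i 1)) (at 0)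
    = vector_derivative (\<lambda>h. f (x + h *\<^sub>R axis i 1)) (at 0)" by simp
qed

lemma has_derivative_partial_deriv:
  assumes "(f has_derivative f') (at x)"
  shows "partial_deriv i f x = f' (axis i 1)"
proof -
  have "((\<lambda>h. f (x + h *\<^sub>R axis i 1)) has_derivative (\<lambda>h. f' (h *\<^sub>R axis i 1))) (at 0)"
    by (rule has_derivative_compose[where f="\<lambda>h. x + h *\<^sub>R axis i 1" and g=f])
      (use assms in \<open>auto intro!: derivative_eq_intros\<close>)
  then have "((\<lambda>h. f (x + h *\<^sub>R axis i 1)) has_vector_derivative f' (axis i 1)) (at 0)"
    using linear_scale[OF bounded_linear.linear[OF has_derivative_bounded_linear[OF assms]]]
    by (simp add: has_vector_derivative_def)
  then show ?thesis unfolding partial_deriv_def by (rule vector_derivative_at)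
qed

lemma partial_deriv_line:
  assumes "\<And>x. f differentiable (at x)"
  shows "((\<lambda>s. f (x + s *\<^sub>R axis i 1)) has_vector_derivative partial_deriv i f (x + s *\<^sub>R axis i 1)) (at s within A)"
proof -
  obtain f' where f': "(f has_derivative f') (at (x + s *\<^sub>R axis i 1))"
    using assms differentiable_def by blast
  have "((\<lambda>h. f (x + h *\<^sub>R axis i 1)) has_derivative (\<lambda>h. f' (h *\<^sub>R axis i 1))) (at s within A)"
    by (rule has_derivative_compose[where f="\<lambda>h. x + h *\<^sub>R axis i 1" and g=f])
      (use f' in \<open>auto intro!: derivative_eq_intros\<close>)
  then show ?thesis
    using linear_scale[OF bounded_linear.linear[OF has_derivative_bounded_linear[OF f']]]
    by (simp add: has_vector_derivative_def has_derivative_partial_deriv[OF f'])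
qed

text \<open>The mean value theorem for \<open>s \<mapsto> f s - s *\<^sub>R l\<close>. The
  derivative is required only inside the interval and \<open>f\<close> merely has to be continuous
  at its ends; this is how derivatives at positive times determine the derivative at time 0.\<close>

lemma norm_increment_le:
  fixes f :: "real \<Rightarrow> 'b::euclidean_space"
  assumes t: "0 \<le> t" and c: "continuous_on {0..t} f"
    and d: "\<And>s. 0 < s \<Longrightarrow> s < t \<Longrightarrow> (f has_vector_derivative f' s) (at s)"
    and b: "\<And>s. 0 < s \<Longrightarrow> s < t \<Longrightarrow> norm (f' s - l) \<le> e"
  shows "norm (f t - f 0 - t *\<^sub>R l) \<le> t * e"
proof (cases "t = 0")
  case False
  then have t: "0 < t" using t by simp
  define g where "g s = f s - s *\<^sub>R l" for s
  have "\<exists>s\<in>{0<..<t}. norm (g t - g 0) \<le> norm ((t - 0) *\<^sub>R (f' s - l))"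
  proof (rule mvt_general[OF t, of g "\<lambda>s h. h *\<^sub>R (f' s - l)"])
    show "continuous_on {0..t} g" unfolding g_def by (intro continuous_intros c)
    fix s assume "0 < s" "s < t"
    then have "(g has_vector_derivative (f' s - 1 *\<^sub>R l)) (at s)"
      unfolding g_def by (auto intro!: derivative_eq_intros d)
    then show "(g has_derivative (\<lambda>h. h *\<^sub>R (f' s - l))) (at s)"
      by (simp add: has_vector_derivative_def)
  qed
  then obtain s where s: "0 < s" "s < t" "norm (g t - g 0) \<le> t * norm (f' s - l)" using t by auto
  moreover have "t * norm (f' s - l) \<le> t * e" using b[OF s(1,2)] t by (intro mult_left_mono) auto
  ultimately have "norm (g t - g 0) \<le> t * e" using s by linarith
  then show ?thesis by (simp add: g_def algebra_simps)
qed simp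

lemma C_class_Suc_imp: "C_class (Suc k) f \<Longrightarrow> C_class k f"
proof (induction k arbitrary: f)
  case 0
  then show ?case
    by (auto simp: continuous_on_eq_continuous_at intro: differentiable_imp_continuous_within)
qed auto

lemma C_class_le: "C_class k f \<Longrightarrow> j \<le> k \<Longrightarrow> C_class j f"
  by (induction k) (use C_class_Suc_imp le_Suc_eq in blast)+

lemma C_class_continuous: "C_class k f \<Longrightarrow> continuous_on UNIV f"
  using C_class_le[of k f 0] by simp

definition continuous_periodic :: "real \<Rightarrow> (real^3 \<Rightarrow> 'b::real_normed_vector) \<Rightarrow> bool" where
  "continuous_periodic L f \<longleftrightarrow> continuous_on UNIV f \<and> spatially_periodic L f"

lemma continuous_periodic_intros:
  assumes "continuous_periodic L f" "continuous_periodic L g"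
  shows "continuous_periodic L (\<lambda>x. f x + g x)" "continuous_periodic L (\<lambda>x. f x - g x)"
  using assms by (auto simp: continuous_periodic_def spatially_periodic_def intro!: continuous_intros)

lemma continuous_periodic_mult:
  fixes f g :: "real^3 \<Rightarrow> 'b::real_normed_algebra"
  assumes "continuous_periodic L f" "continuous_periodic L g"
  shows "continuous_periodic L (\<lambda>x. f x * g x)"
  using assms by (auto simp: continuous_periodic_def spatially_periodic_def intro!: continuous_intros)

lemma continuous_periodic_const: "continuous_periodic L (\<lambda>x. c)"
  by (simp add: continuous_periodic_def spatially_periodic_def)

lemma continuous_periodic_sum:
  "(\<And>i. i \<in> A \<Longrightarrow> continuous_periodic L (f i)) \<Longrightarrow> continuous_periodic L (\<lambda>x. \<Sum>i\<in>A. f i x)"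
  by (auto simp: continuous_periodic_def spatially_periodic_def intro!: continuous_intros)

lemma continuous_periodic_compose:
  assumes "continuous_periodic L f" "continuous_on UNIV h"
  shows "continuous_periodic L (\<lambda>x. h (f x))"
  using assms continuous_on_compose2[of UNIV h UNIV f]
  by (auto simp: continuous_periodic_def spatially_periodic_def)

lemma continuous_periodic_translate:
  assumes "continuous_periodic L f" shows "continuous_periodic L (\<lambda>x. f (x + y))"
  using assms unfolding continuous_periodic_def
  by (auto intro!: spatially_periodic_translate continuous_intros
      intro: continuous_on_compose2[of UNIV f UNIV "\<lambda>x. x + y"])

locale periodic_box =
  fixes L :: real
  assumes L_pos: "0 < L"
begin

lemma wrap_in_cube:
  obtains k where "x + (\<chi> i. L * of_int (k $ i)) \<in> period_cube L"
proof
  define k :: "int^3" where "k = (\<chi> i. - \<lfloor>x $ i / L\<rfloor>)"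
  have "0 \<le> x $ i + L * of_int (k $ i) \<and> x $ i + L * of_int (k $ i) \<le> L" for i
  proof -
    have "of_int \<lfloor>x $ i / L\<rfloor> \<le> x $ i / L" "x $ i / L \<le> of_int \<lfloor>x $ i / L\<rfloor> + 1" by linarith+
    then have "of_int \<lfloor>x $ i / L\<rfloor> * L \<le> x $ i" "x $ i \<le> (of_int \<lfloor>x $ i / L\<rfloor> + 1) * L"
      using L_pos by (simp_all only: pos_le_divide_eq pos_divide_le_eq)
    then show ?thesis by (simp add: k_def algebra_simps)
  qed
  then show "x + (\<chi> i. L * of_int (k $ i)) \<in> period_cube L"
    by (simp add: period_cube_def mem_box_cart)
qed

lemma continuous_periodic_bounded:
  assumes "continuous_periodic L f"
  obtains M where "M > 0" "\<And>x. norm (f x) \<le> M"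
proof -
  have "compact (f ` period_cube L)"
    using assms by (auto simp: continuous_periodic_def period_cube_def
        intro!: compact_continuous_image elim: continuous_on_subset)
  then obtain M where M: "M > 0" "\<And>x. x \<in> period_cube L \<Longrightarrow> norm (f x) \<le> M"
    using compact_imp_bounded bounded_pos by (metis image_eqI)
  have "norm (f x) \<le> M" for x
    using wrap_in_cube[of x] spatially_periodic_shift[of L f x] assms M
    unfolding continuous_periodic_def by metis
  then show ?thesis using M that by blast
qed

lemma continuous_periodic_uniformly_continuous:
  assumes "continuous_periodic L f" "e > 0"
  obtains d where "d > 0" "\<And>x y. norm (x - y) < d \<Longrightarrow> norm (f x - f y) < e"
proof -
  \<comment> \<open>The cube is enlarged by 1 on each side: after one point has been moved into the
    period cube, the other, which is at distance below 1, still lies in this compact set.\<close>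
  define C :: "(real^3) set" where "C = cbox (\<chi> i. -1) (\<chi> i. L + 1)"
  have "uniformly_continuous_on C f"
    using assms by (auto simp: continuous_periodic_def C_def
        intro!: compact_uniformly_continuous elim: continuous_on_subset)
  then obtain d where d: "d > 0" "\<And>x y. x \<in> C \<Longrightarrow> y \<in> C \<Longrightarrow> dist x y < d \<Longrightarrow> dist (f x) (f y) < e"
    using assms(2) unfolding uniformly_continuous_on_def by metis
  have "norm (f x - f y) < e" if xy: "norm (x - y) < min d 1" for x y
  proof -
    obtain k where k: "x + (\<chi> i. L * of_int (k $ i)) \<in> period_cube L" using wrap_in_cube by blast
    define w where "w = (\<chi> i. L * of_int (k $ i))"
    have x: "\<And>i. 0 \<le> (x + w) $ i \<and> (x + w) $ i \<le> L"
      using k by (simp add: period_cube_def mem_box_cart w_def)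
    have "\<bar>(x - y) $ i\<bar> < 1" for i
      using component_le_norm_cart[of "x - y" i] xy by linarith
    then have y: "-1 \<le> (y + w) $ i \<and> (y + w) $ i \<le> L + 1" for i
      using x[of i] by (auto simp: abs_less_iff dest!: meta_spec[of _ i])
    have "dist (f (x + w)) (f (y + w)) < e"
    proof (rule d(2))
      show "x + w \<in> C" "y + w \<in> C" unfolding C_def mem_box_cart vec_lambda_beta
        using x y by (intro allI conjI; smt (verit))+
      show "dist (x + w) (y + w) < d" using xy by (simp add: dist_norm)
    qed
    then show ?thesis
      using assms(1) spatially_periodic_shift[of L f] unfolding w_def continuous_periodic_def dist_norm by metis
  qed
  then show ?thesis using d that[of "min d 1"] by auto
qed

section \<open>Frequencies and plane waves\<close>

definition freq :: "int^3 \<Rightarrow> real^3" where "freq n = (\<chi> i. 2 * pi / L * of_int (n $ i))"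

definition wave :: "int^3 \<Rightarrow> real^3 \<Rightarrow> complex" where "wave n x = cis (freq n \<bullet> x)"

lemma freq_nth: "freq n $ i = 2 * pi / L * of_int (n $ i)" by (simp add: freq_def)

lemma freq_add: "freq (n + m) = freq n + freq m" by (simp add: freq_def vec_eq_iff distrib_left)
lemma freq_diff: "freq (n - m) = freq n - freq m" by (simp add: freq_def vec_eq_iff right_diff_distrib)
lemma freq_uminus: "freq (- n) = - freq n" by (simp add: freq_def vec_eq_iff)
lemma freq_0 [simp]: "freq 0 = 0" by (simp add: freq_def vec_eq_iff)
lemma freq_eq_0_iff: "freq n = 0 \<longleftrightarrow> n = 0" using L_pos by (simp add: freq_def vec_eq_iff)

lemma norm_freq_triangle: "norm (freq n) \<le> norm (freq (n - m)) + norm (freq m)"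
  using norm_triangle_ineq[of "freq (n - m)" "freq m"] by (simp add: freq_diff)

lemma norm_wave [simp]: "norm (wave n x) = 1" by (simp add: wave_def)
lemma wave_0 [simp]: "wave 0 x = 1" by (simp add: wave_def)
lemma wave_at_0 [simp]: "wave n 0 = 1" by (simp add: wave_def)
lemma wave_add_index: "wave (n + m) x = wave n x * wave m x"
  by (simp add: wave_def freq_add inner_add_left cis_mult)
lemma wave_add: "wave n (x + y) = wave n x * wave n y"
  by (simp add: wave_def inner_add_right cis_mult)
lemma cnj_wave: "cnj (wave n x) = wave (- n) x" by (simp add: wave_def freq_uminus cis_cnj)
lemma wave_minus: "wave n (- x) = wave (- n) x" by (simp add: wave_def freq_uminus)

lemma wave_axis: "wave n (s *\<^sub>R axis i 1) = cis (s * freq n $ i)"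
  by (simp add: wave_def inner_axis)

lemma wave_periodic: "spatially_periodic L (wave n)"
  using L_pos by (simp add: spatially_periodic_def wave_add wave_axis freq_nth)

lemma has_derivative_wave: "(wave n has_derivative (\<lambda>h. \<i> * of_real (freq n \<bullet> h) * wave n x)) (at x within A)"
proof -
  have "((\<lambda>x. cis (freq n \<bullet> x)) has_derivative (\<lambda>h. (freq n \<bullet> h) *\<^sub>R (\<i> * cis (freq n \<bullet> x)))) (at x within A)"
    by (rule has_derivative_cis) (auto intro!: derivative_eq_intros)
  then show ?thesis by (simp add: wave_def[abs_def] scaleR_conv_of_real mult_ac)
qed

lemma continuous_wave: "continuous_on A (wave n)"
  by (rule has_derivative_continuous_on) (rule has_derivative_wave)

lemma continuous_periodic_wave: "continuous_periodic L (wave n)"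
  by (simp add: continuous_periodic_def continuous_wave wave_periodic)

section \<open>The mean over a period\<close>

definition mean :: "(real^3 \<Rightarrow> 'b::banach) \<Rightarrow> 'b" where
  "mean f = (1 / L ^ 3) *\<^sub>R integral (period_cube L) f"

lemma continuous_periodic_integrable:
  fixes f :: "real^3 \<Rightarrow> 'b::banach"
  shows "continuous_periodic L f \<Longrightarrow> f integrable_on period_cube L"
  unfolding period_cube_def continuous_periodic_def
  by (auto intro: integrable_continuous continuous_on_subset)

lemma mean_const: "mean (\<lambda>x. c) = c"
proof -
  have "cbox (0::real^3) (\<chi> i. L) \<noteq> {}" using L_pos by (simp add: interval_ne_empty_cart)
  then have "measure lborel (cbox (0::real^3) (\<chi> i. L)) = L ^ 3"
    by (simp add: content_cbox_cart)
  then show ?thesis using L_pos by (simp add: mean_def period_cube_def)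
qed

lemma mean_add:
  "continuous_periodic L f \<Longrightarrow> continuous_periodic L g \<Longrightarrow> mean (\<lambda>x. f x + g x) = mean f + mean g"
  by (simp add: mean_def integral_add continuous_periodic_integrable scaleR_add_right)

lemma mean_diff:
  "continuous_periodic L f \<Longrightarrow> continuous_periodic L g \<Longrightarrow> mean (\<lambda>x. f x - g x) = mean f - mean g"
  by (simp add: mean_def integral_diff continuous_periodic_integrable scaleR_diff_right)

lemma mean_bounded_linear:
  "bounded_linear h \<Longrightarrow> continuous_periodic L f \<Longrightarrow> mean (\<lambda>x. h (f x)) = h (mean f)"
  using integral_linear[of f "period_cube L" h]
  by (simp add: mean_def o_def continuous_periodic_integrable linear_scale[OF bounded_linear.linear])

lemma mean_cmult:
  fixes f :: "real^3 \<Rightarrow> complex"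
  shows "continuous_periodic L f \<Longrightarrow> mean (\<lambda>x. c * f x) = c * mean f"
  by (rule mean_bounded_linear[OF bounded_linear_mult_right])

lemma mean_cnj: "continuous_periodic L f \<Longrightarrow> mean (\<lambda>x. cnj (f x)) = cnj (mean f)"
  by (rule mean_bounded_linear[OF bounded_linear_cnj])

lemma mean_of_real: "continuous_periodic L f \<Longrightarrow> mean (\<lambda>x. complex_of_real (f x)) = of_real (mean f)"
  by (rule mean_bounded_linear[OF bounded_linear_of_real])

lemma mean_sum:
  assumes "\<And>i. i \<in> A \<Longrightarrow> continuous_periodic L (f i)"
  shows "mean (\<lambda>x. \<Sum>i\<in>A. f i x) = (\<Sum>i\<in>A. mean (f i))"
  using assms
proof (induction A rule: infinite_finite_induct)
  case (insert i A)
  then show ?case by (simp add: mean_add continuous_periodic_sum)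
qed (simp_all add: mean_const)

lemma mean_mono:
  fixes f g :: "real^3 \<Rightarrow> real"
  assumes "continuous_periodic L f" "continuous_periodic L g" "\<And>x. f x \<le> g x"
  shows "mean f \<le> mean g"
  using assms L_pos by (auto simp: mean_def continuous_periodic_integrable intro!: divide_right_mono integral_le)

lemma norm_mean_le:
  fixes f :: "real^3 \<Rightarrow> 'b::banach"
  assumes "continuous_periodic L f" "continuous_periodic L g" "\<And>x. norm (f x) \<le> g x"
  shows "norm (mean f) \<le> mean g"
proof -
  have "norm (integral (period_cube L) f) \<le> integral (period_cube L) g"
    using assms by (intro Henstock_Kurzweil_Integration.integral_norm_bound_integral continuous_periodic_integrable)
  then show ?thesis using L_pos by (simp add: mean_def divide_right_mono)
qed

lemma norm_mean_le_const:
  fixes f :: "real^3 \<Rightarrow> 'b::banach"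
  assumes "continuous_periodic L f" "\<And>x. norm (f x) \<le> M"
  shows "norm (mean f) \<le> M"
  using norm_mean_le[OF assms(1) continuous_periodic_const assms(2)] by (simp add: mean_const)

text \<open>Cut and paste: the shifted cube is cut along the hyperplane where coordinate
  \<open>i\<close> equals \<open>L\<close>, and the part beyond is moved back by one period, where
  it fills the slab \<open>cbox 0 w\<close> that the shift has left uncovered.\<close>

lemma mean_translate_axis_small:
  fixes f :: "real^3 \<Rightarrow> 'b::banach"
  assumes f: "continuous_periodic L f" and c: "0 \<le> c" "c \<le> L"
  shows "mean (\<lambda>x. f (x + c *\<^sub>R axis i 1)) = mean f"
proof -
  define v :: "real^3" where "v = (\<chi> j. L)"
  define w :: "real^3" where "w = (\<chi> j. if j = i then c else L)"
  define e :: "real^3" where "e = axis i 1"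
  have int: "f integrable_on cbox a b" for a b
    using f by (auto simp: continuous_periodic_def intro: integrable_continuous continuous_on_subset)
  have e: "e \<in> Basis" by (simp add: e_def axis_in_Basis_iff)
  have en: "x \<bullet> e = x $ i" for x by (simp add: e_def inner_axis)
  have enth: "e $ j = (if j = i then 1 else 0)" for j by (simp add: e_def axis_def)
  have mem: "x \<in> cbox a b \<longleftrightarrow> (a $ i \<le> x $ i \<and> x $ i \<le> b $ i) \<and> (\<forall>j. j \<noteq> i \<longrightarrow> a $ j \<le> x $ j \<and> x $ j \<le> b $ j)"
    for x a b :: "real^3" unfolding mem_box_cart by metis
  have 1: "cbox (c *\<^sub>R e) (v + c *\<^sub>R e) \<inter> {x. x \<bullet> e \<le> L} = cbox 0 v \<inter> {x. x \<bullet> e \<ge> c}"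
    using c by (auto simp: mem en enth v_def)
  have 2: "cbox (c *\<^sub>R e) (v + c *\<^sub>R e) \<inter> {x. x \<bullet> e \<ge> L} = cbox (0 + L *\<^sub>R e) (w + L *\<^sub>R e)"
    using c by (auto simp: mem en enth v_def w_def)
  have 3: "cbox 0 v \<inter> {x. x \<bullet> e \<le> c} = cbox 0 w"
    using c by (auto simp: mem en v_def w_def)
  have "integral (cbox 0 v) (\<lambda>x. f (x + c *\<^sub>R e)) = integral (cbox (0 + c *\<^sub>R e) (v + c *\<^sub>R e)) f"
    using integral_shift_cbox_plus[of 0 v f "c *\<^sub>R e"] by (simp add: o_def add.commute)
  also have "\<dots> = integral (cbox 0 v \<inter> {x. x \<bullet> e \<ge> c}) f + integral (cbox (0 + L *\<^sub>R e) (w + L *\<^sub>R e)) f"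
    using integral_split[OF int e, of "c *\<^sub>R e" "v + c *\<^sub>R e" L] by (simp only: 1 2 add_0)
  also have "integral (cbox (0 + L *\<^sub>R e) (w + L *\<^sub>R e)) f = integral (cbox 0 w) (f \<circ> ((+) (L *\<^sub>R e)))"
    by (rule integral_shift_cbox_plus[symmetric])
  also have "f \<circ> ((+) (L *\<^sub>R e)) = f"
    using f by (auto simp: continuous_periodic_def spatially_periodic_def e_def add.commute)
  also have "integral (cbox 0 v \<inter> {x. x \<bullet> e \<ge> c}) f + integral (cbox 0 w) f = integral (cbox 0 v) f"
    using integral_split[OF int e, of 0 v c] by (simp only: 3 add.commute)
  finally show ?thesis by (simp add: mean_def period_cube_def v_def e_def)
qed

lemma mean_translate_axis:
  fixes f :: "real^3 \<Rightarrow> 'b::banach"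
  assumes f: "continuous_periodic L f"
  shows "mean (\<lambda>x. f (x + c *\<^sub>R axis i 1)) = mean f"
proof -
  define m where "m = \<lfloor>c / L\<rfloor>"
  define r where "r = c - L * of_int m"
  have "of_int m \<le> c / L" "c / L \<le> of_int m + 1" unfolding m_def by linarith+
  then have r: "0 \<le> r" "r \<le> L" using L_pos by (simp_all add: r_def field_simps)
  have "f (x + c *\<^sub>R axis i 1) = f (x + r *\<^sub>R axis i 1)" for x
  proof -
    have "x + c *\<^sub>R axis i 1 = (x + r *\<^sub>R axis i 1) + (\<chi> j. L * of_int ((\<chi> j. if j = i then m else 0) $ j))"
      by (simp add: vec_eq_iff axis_def r_def)
    then show ?thesis using f spatially_periodic_shift unfolding continuous_periodic_def by metis
  qed
  then show ?thesis using mean_translate_axis_small[OF f r] by simp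
qed

lemma mean_translate:
  fixes f :: "real^3 \<Rightarrow> 'b::banach"
  assumes f: "continuous_periodic L f"
  shows "mean (\<lambda>x. f (x + y)) = mean f"
proof -
  have "x + y = x + (y$1) *\<^sub>R axis 1 1 + (y$2) *\<^sub>R axis 2 1 + (y$3) *\<^sub>R axis 3 1" for x
    by (simp add: vec_eq_iff forall_3 axis_def)
  then have "mean (\<lambda>x. f (x + y)) = mean (\<lambda>x. f (x + (y$1) *\<^sub>R axis 1 1 + (y$2) *\<^sub>R axis 2 1 + (y$3) *\<^sub>R axis 3 1))"
    by (simp only:)
  also have "\<dots> = mean (\<lambda>x. f (x + (y$2) *\<^sub>R axis 2 1 + (y$3) *\<^sub>R axis 3 1))"
    by (rule mean_translate_axis[of "\<lambda>x. f (x + (y$2) *\<^sub>R axis 2 1 + (y$3) *\<^sub>R axis 3 1)"])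
      (use continuous_periodic_translate[OF f, of "(y$2) *\<^sub>R axis 2 1 + (y$3) *\<^sub>R axis 3 1"] in \<open>simp add: add.assoc\<close>)
  also have "\<dots> = mean (\<lambda>x. f (x + (y$3) *\<^sub>R axis 3 1))"
    by (rule mean_translate_axis[of "\<lambda>x. f (x + (y$3) *\<^sub>R axis 3 1)"])
      (rule continuous_periodic_translate[OF f])
  also have "\<dots> = mean f" by (rule mean_translate_axis[OF f])
  finally show ?thesis .
qed

text \<open>A difference quotient has mean 0 by translation invariance, and it converges uniformly
  to the derivative because the derivative is uniformly continuous. This gives integration by parts
  without an iterated integral.\<close>

lemma mean_partial_deriv:
  fixes f :: "real^3 \<Rightarrow> 'b::euclidean_space"
  assumes f: "spatially_periodic L f" "\<And>x. f differentiable (at x)" "continuous_on UNIV (partial_deriv i f)"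
  shows "mean (partial_deriv i f) = 0"
proof -
  have cf: "continuous_periodic L f"
    using f(1,2) differentiable_imp_continuous_within
    by (auto simp: continuous_periodic_def continuous_on_eq_continuous_at)
  have cp: "continuous_periodic L (partial_deriv i f)"
    using f(1,3) by (simp add: continuous_periodic_def spatially_periodic_partial_deriv)
  have "norm (mean (partial_deriv i f)) \<le> e" if e: "e > 0" for e
  proof -
    obtain d where d: "d > 0" "\<And>x y. norm (x - y) < d \<Longrightarrow> norm (partial_deriv i f x - partial_deriv i f y) < e"
      using continuous_periodic_uniformly_continuous[OF cp e] by blast
    define h where "h = d / 2"
    have h: "h > 0" "h < d" using d by (auto simp: h_def)
    define q where "q x = (1 / h) *\<^sub>R (f (x + h *\<^sub>R axis i 1) - f x)" for x
    have cq: "continuous_periodic L q"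
      unfolding q_def using continuous_periodic_intros(2)[OF continuous_periodic_translate[OF cf] cf]
      by (rule continuous_periodic_compose) (intro continuous_intros)
    have "mean q = 0"
      unfolding q_def
      using mean_bounded_linear[OF bounded_linear_scaleR_right continuous_periodic_intros(2)[OF continuous_periodic_translate[OF cf] cf]]
        mean_diff[OF continuous_periodic_translate[OF cf] cf] mean_translate[OF cf]
      by simp
    moreover have "norm (q x - partial_deriv i f x) \<le> e" for x
    proof -
      have "norm (f (x + h *\<^sub>R axis i 1) - f (x + 0 *\<^sub>R axis i 1) - h *\<^sub>R partial_deriv i f x) \<le> h * e"
      proof (rule norm_increment_le)
        show "continuous_on {0..h} (\<lambda>s. f (x + s *\<^sub>R axis i 1))"
          using cf by (auto simp: continuous_periodic_def intro!: continuous_intros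
              intro: continuous_on_compose2[of UNIV f _ "\<lambda>s. x + s *\<^sub>R axis i 1"])
        show "((\<lambda>s. f (x + s *\<^sub>R axis i 1)) has_vector_derivative partial_deriv i f (x + s *\<^sub>R axis i 1)) (at s)" for s
          by (rule partial_deriv_line[OF f(2)])
        show "norm (partial_deriv i f (x + s *\<^sub>R axis i 1) - partial_deriv i f x) \<le> e"
          if "0 < s" "s < h" for s
          using d(2)[of "x + s *\<^sub>R axis i 1" x] that h by (simp add: less_imp_le)
      qed (use h in simp)
      moreover have "q x - partial_deriv i f x
          = (1 / h) *\<^sub>R (f (x + h *\<^sub>R axis i 1) - f x - h *\<^sub>R partial_deriv i f x)"
        using h by (simp add: q_def scaleR_diff_right)
      ultimately show ?thesis using h by (simp only: norm_scaleR) (simp add: divide_le_eq mult.commute)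
    qed
    ultimately show ?thesis
      using norm_mean_le_const[OF continuous_periodic_intros(2)[OF cq cp], of e] mean_diff[OF cq cp] by simp
  qed
  then show ?thesis by (metis field_le_epsilon add.left_neutral norm_le_zero_iff)
qed

end

section \<open>Fourier coefficients and Fourier series\<close>

lemma has_vector_derivative_imp_partial_deriv:
  "((\<lambda>h. f (x + h *\<^sub>R axis i 1)) has_vector_derivative d) (at 0) \<Longrightarrow> partial_deriv i f x = d"
  unfolding partial_deriv_def by (rule vector_derivative_at)

lemma partial_deriv_mult:
  fixes f g :: "real^3 \<Rightarrow> 'b::real_normed_algebra"
  assumes "f differentiable (at x)" "g differentiable (at x)"
  shows "partial_deriv i (\<lambda>x. f x * g x) x = f x * partial_deriv i g x + partial_deriv i f x * g x"
proof -
  obtain f' g' where d: "(f has_derivative f') (at x)" "(g has_derivative g') (at x)"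
    using assms differentiable_def by blast
  show ?thesis
    using has_derivative_partial_deriv[OF has_derivative_mult[OF d], of i]
      has_derivative_partial_deriv[OF d(1), of i] has_derivative_partial_deriv[OF d(2), of i] by simp
qed

lemma partial_deriv_bounded_linear:
  assumes "bounded_linear h" "f differentiable (at x)"
  shows "partial_deriv i (\<lambda>x. h (f x)) x = h (partial_deriv i f x)"
proof -
  obtain f' where f': "(f has_derivative f') (at x)" using assms(2) differentiable_def by blast
  show ?thesis
    using has_derivative_partial_deriv[OF bounded_linear.has_derivative[OF assms(1) f'], of i]
      has_derivative_partial_deriv[OF f', of i] by simp
qed

lemma C_class_bounded_linear:
  "bounded_linear h \<Longrightarrow> C_class k f \<Longrightarrow> C_class k (\<lambda>x. h (f x))"
proof (induction k arbitrary: f)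
  case 0
  then show ?case by (simp add: bounded_linear.continuous_on)
next
  case (Suc k)
  have d: "f differentiable (at x)" for x using Suc.prems(2) by simp
  have "partial_deriv i (\<lambda>x. h (f x)) = (\<lambda>x. h (partial_deriv i f x))" for i
    using partial_deriv_bounded_linear[OF Suc.prems(1) d] by blast
  moreover have "(\<lambda>x. h (f x)) differentiable (at x)" for x
    using d[of x] bounded_linear.has_derivative[OF Suc.prems(1)] unfolding differentiable_def by blast
  ultimately show ?case using Suc by simp
qed

lemma has_derivative_vec_lambda:
  fixes f :: "3 \<Rightarrow> 'a::real_normed_vector \<Rightarrow> real"
  assumes "\<And>j. (f j has_derivative f' j) (at x within A)"
  shows "((\<lambda>x. \<chi> j. f j x) has_derivative (\<lambda>h. \<chi> j. f' j h)) (at x within A)"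
  unfolding has_derivative_componentwise_within[of "\<lambda>x. \<chi> j. f j x"]
  using assms by (auto simp: Basis_vec_def inner_axis)

lemma partial_deriv_vec_lambda:
  fixes f :: "3 \<Rightarrow> real^3 \<Rightarrow> real"
  assumes "\<And>j. f j differentiable (at x)"
  shows "partial_deriv i (\<lambda>x. \<chi> j. f j x) x = (\<chi> j. partial_deriv i (f j) x)"
    and "(\<lambda>x. \<chi> j. f j x) differentiable (at x)"
proof -
  obtain f' where f': "\<And>j. (f j has_derivative f' j) (at x)"
    using assms unfolding differentiable_def by metis
  show "partial_deriv i (\<lambda>x. \<chi> j. f j x) x = (\<chi> j. partial_deriv i (f j) x)"
    using has_derivative_partial_deriv[OF has_derivative_vec_lambda[OF f'], of i]
      has_derivative_partial_deriv[OF f'] by simp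
  show "(\<lambda>x. \<chi> j. f j x) differentiable (at x)"
    unfolding differentiable_def by (rule exI) (rule has_derivative_vec_lambda[OF f'])
qed

lemma C_class_vec_lambda:
  fixes f :: "3 \<Rightarrow> real^3 \<Rightarrow> real"
  shows "(\<And>j. C_class k (f j)) \<Longrightarrow> C_class k (\<lambda>x. \<chi> j. f j x)"
proof (induction k arbitrary: f)
  case 0
  then show ?case by (simp add: continuous_on_vec_lambda)
next
  case (Suc k)
  have d: "f j differentiable (at x)" for j x using Suc.prems by simp
  have "partial_deriv i (\<lambda>x. \<chi> j. f j x) = (\<lambda>x. \<chi> j. partial_deriv i (f j) x)" for i
    by (intro ext partial_deriv_vec_lambda(1) d)
  moreover have "C_class k (\<lambda>x. \<chi> j. partial_deriv i (f j) x)" for i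
    using Suc by simp
  ultimately show ?case using partial_deriv_vec_lambda(2)[OF d] by simp
qed

context periodic_box
begin

definition cf :: "(real^3 \<Rightarrow> complex) \<Rightarrow> int^3 \<Rightarrow> complex" where
  "cf f n = mean (\<lambda>x. f x * wave (- n) x)"

definition series :: "(int^3 \<Rightarrow> complex) \<Rightarrow> real^3 \<Rightarrow> complex" where
  "series c x = (\<Sum>\<^sub>\<infinity>n. c n * wave n x)"

lemma continuous_periodic_mult_wave:
  "continuous_periodic L f \<Longrightarrow> continuous_periodic L (\<lambda>x. f x * wave n x)"
  by (intro continuous_periodic_mult continuous_periodic_wave)

lemma series_summable: "c abs_summable_on UNIV \<Longrightarrow> (\<lambda>n. c n * wave n x) summable_on UNIV"
  by (rule abs_summable_summable) (simp add: norm_mult)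

lemma continuous_periodic_series:
  assumes "c abs_summable_on UNIV" shows "continuous_periodic L (series c)"
  unfolding continuous_periodic_def
proof
  show "continuous_on UNIV (series c)"
    unfolding series_def[abs_def]
    by (rule continuous_on_infsum[OF _ _ assms]) (auto simp: norm_mult intro!: continuous_intros continuous_wave)
  show "spatially_periodic L (series c)"
    using wave_periodic by (simp add: spatially_periodic_def series_def)
qed

lemma series_add:
  "c abs_summable_on UNIV \<Longrightarrow> d abs_summable_on UNIV \<Longrightarrow> series (\<lambda>n. c n + d n) x = series c x + series d x"
  unfolding series_def by (simp add: distrib_right infsum_add series_summable)

lemma series_diff:
  "c abs_summable_on UNIV \<Longrightarrow> d abs_summable_on UNIV \<Longrightarrow> series (\<lambda>n. c n - d n) x = series c x - series d x"
  unfolding series_def by (simp add: left_diff_distrib infsum_diff series_summable)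

lemma series_cmult: "series (\<lambda>n. k * c n) x = k * series c x"
  unfolding series_def by (simp add: mult.assoc infsum_cmult_right')

lemma series_mult:
  assumes "c abs_summable_on UNIV" "d abs_summable_on UNIV"
  shows "series c x * series d x = series (conv c d) x"
proof -
  have a: "(\<lambda>n. c n * wave n x) abs_summable_on UNIV" "(\<lambda>n. d n * wave n x) abs_summable_on UNIV"
    using assms by (simp_all add: norm_mult)
  have "conv (\<lambda>n. c n * wave n x) (\<lambda>n. d n * wave n x) n = conv c d n * wave n x" for n
  proof -
    have "c (n - m) * wave (n - m) x * (d m * wave m x) = c (n - m) * d m * wave n x" for m
      using wave_add_index[of "n - m" m x] by simp
    then have "(\<lambda>m. c (n - m) * wave (n - m) x * (d m * wave m x)) = (\<lambda>m. c (n - m) * d m * wave n x)" by blast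
    then show ?thesis by (simp only: conv_def infsum_cmult_left')
  qed
  then show ?thesis using infsum_conv[OF a] by (simp add: series_def)
qed

text \<open>Translation by half a wavelength along an axis with \<open>n $ i \<noteq> 0\<close>
  reverses the sign of the wave but preserves its mean.\<close>

lemma mean_wave: "mean (wave n) = (if n = 0 then 1 else 0)"
proof (cases "n = 0")
  case True
  then have "wave n = (\<lambda>x. 1)" by (simp add: fun_eq_iff)
  then show ?thesis using True by (simp add: mean_const)
next
  case False
  then obtain i where i: "n $ i \<noteq> 0" by (auto simp: vec_eq_iff)
  define s where "s = L / (2 * of_int (n $ i))"
  have "s * freq n $ i = pi" using i L_pos by (simp add: s_def freq_nth field_simps)
  then have "wave n (x + s *\<^sub>R axis i 1) = - wave n x" for x
    by (simp add: wave_add wave_axis)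
  then have "mean (wave n) = mean (\<lambda>x. - wave n x)"
    using mean_translate[OF continuous_periodic_wave, of n "s *\<^sub>R axis i 1"] by simp
  also have "\<dots> = - mean (wave n)"
    using mean_cmult[OF continuous_periodic_wave, of "-1" n] by simp
  finally show ?thesis using False by simp
qed

lemma mean_series:
  assumes "c abs_summable_on UNIV" shows "mean (series c) = c 0"
proof -
  have u: "uniform_limit (period_cube L) (\<lambda>X x. \<Sum>n\<in>X. c n * wave n x) (series c) (finite_subsets_at_top UNIV)"
    unfolding series_def[abs_def] using assms
    by (intro Weierstrass_m_test_general[where M="\<lambda>n. norm (c n)"]) (auto simp: norm_mult)
  have cp: "continuous_periodic L (\<lambda>x. \<Sum>n\<in>X. c n * wave n x)" for X
    by (intro continuous_periodic_sum continuous_periodic_mult continuous_periodic_const continuous_periodic_wave)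
  have "((\<lambda>X. integral (period_cube L) (\<lambda>x. \<Sum>n\<in>X. c n * wave n x)) \<longlongrightarrow> integral (period_cube L) (series c))
     (finite_subsets_at_top UNIV)"
  proof -
    obtain I J where IJ: "\<And>X. ((\<lambda>x. \<Sum>n\<in>X. c n * wave n x) has_integral I X) (cbox 0 (\<chi> i. L))"
      "(series c has_integral J) (cbox 0 (\<chi> i. L))" "(I \<longlongrightarrow> J) (finite_subsets_at_top UNIV)"
    proof (rule uniform_limit_integral_cbox[OF u[unfolded period_cube_def]])
      show "continuous_on (cbox 0 (\<chi> i. L)) (\<lambda>x. \<Sum>n\<in>X. c n * wave n x)" for X
        using cp[of X] by (auto simp: continuous_periodic_def elim: continuous_on_subset)
    qed (use that in auto)
    then show ?thesis
      by (simp add: integral_unique[OF IJ(1)] integral_unique[OF IJ(2)] period_cube_def)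
  qed
  then have "((\<lambda>X. mean (\<lambda>x. \<Sum>n\<in>X. c n * wave n x)) \<longlongrightarrow> mean (series c)) (finite_subsets_at_top UNIV)"
    unfolding mean_def by (intro tendsto_intros)
  moreover have "mean (\<lambda>x. \<Sum>n\<in>X. c n * wave n x) = (if 0 \<in> X then c 0 else 0)" if "finite X" for X
  proof -
    have "mean (\<lambda>x. \<Sum>n\<in>X. c n * wave n x) = (\<Sum>n\<in>X. mean (\<lambda>x. c n * wave n x))"
      by (intro mean_sum continuous_periodic_mult continuous_periodic_const continuous_periodic_wave)
    also have "\<dots> = (\<Sum>n\<in>X. if n = 0 then c 0 else 0)"
      by (intro sum.cong) (auto simp: mean_cmult continuous_periodic_wave mean_wave)
    finally show ?thesis using that by simp
  qed
  \<comment> \<open>Every finite index set that contains 0 already gives the value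
    \<open>c 0\<close>, so the limit along finite sets is that of an eventually constant
    function.\<close>
  then have "eventually (\<lambda>X. mean (\<lambda>x. \<Sum>n\<in>X. c n * wave n x) = c 0) (finite_subsets_at_top UNIV)"
    unfolding eventually_finite_subsets_at_top by (intro exI[of _ "{0}"]) auto
  then have "((\<lambda>X. mean (\<lambda>x. \<Sum>n\<in>X. c n * wave n x)) \<longlongrightarrow> c 0) (finite_subsets_at_top UNIV)"
    by (rule tendsto_eventually)
  ultimately show ?thesis
    by (rule tendsto_unique[OF finite_subsets_at_top_neq_bot])
qed

lemma cf_series:
  assumes c: "c abs_summable_on UNIV" shows "cf (series c) n = c n"
proof -
  have b: "bij_betw (\<lambda>m. m + n) UNIV (UNIV :: (int^3) set)"
    by (rule bij_betwI[where g="\<lambda>m. m - n"]) auto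
  have "series c x * wave (- n) x = series (\<lambda>m. c (m + n)) x" for x
  proof -
    have "series c x * wave (- n) x = (\<Sum>\<^sub>\<infinity>m. c m * wave m x * wave (- n) x)"
      by (simp add: series_def infsum_cmult_left')
    also have "\<dots> = (\<Sum>\<^sub>\<infinity>m. c (m + n) * wave (m + n) x * wave (- n) x)"
      by (rule infsum_reindex_bij_betw[OF b, symmetric])
    also have "\<dots> = series (\<lambda>m. c (m + n)) x"
      by (simp add: series_def mult.assoc flip: wave_add_index)
    finally show ?thesis .
  qed
  moreover have "(\<lambda>m. c (m + n)) abs_summable_on UNIV"
    using c summable_on_reindex_bij_betw[OF b, of "\<lambda>m. norm (c m)"] by simp
  ultimately show ?thesis using mean_series by (simp add: cf_def)
qed

lemma cf_diff: "continuous_periodic L f \<Longrightarrow> continuous_periodic L g \<Longrightarrow> cf (\<lambda>x. f x - g x) n = cf f n - cf g n"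
  by (simp add: cf_def left_diff_distrib mean_diff continuous_periodic_mult_wave)

lemma cf_sum: "(\<And>i. i \<in> A \<Longrightarrow> continuous_periodic L (f i)) \<Longrightarrow> cf (\<lambda>x. \<Sum>i\<in>A. f i x) n = (\<Sum>i\<in>A. cf (f i) n)"
  by (simp add: cf_def sum_distrib_right mean_sum continuous_periodic_mult_wave)

lemma norm_cf_le:
  assumes "continuous_periodic L f" "\<And>x. norm (f x) \<le> M" shows "norm (cf f n) \<le> M"
  unfolding cf_def
  by (rule norm_mean_le_const) (use assms in \<open>auto simp: norm_mult intro: continuous_periodic_mult_wave\<close>)

lemma cf_cnj:
  assumes "continuous_periodic L f" shows "cf (\<lambda>x. cnj (f x)) n = cnj (cf f (- n))"
  using mean_cnj[OF continuous_periodic_mult_wave[OF assms, of n]] by (simp add: cf_def cnj_wave)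

text \<open>Integration by parts without boundary terms: the derivative of \<open>f\<close> times
  the conjugate wave has mean 0.\<close>

lemma cf_partial_deriv:
  assumes f: "spatially_periodic L f" "\<And>x. f differentiable (at x)" "continuous_on UNIV (partial_deriv i f)"
  shows "cf (partial_deriv i f) n = \<i> * of_real (freq n $ i) * cf f n"
proof -
  have cf: "continuous_periodic L f"
    using f(1,2) differentiable_imp_continuous_within
    by (auto simp: continuous_periodic_def continuous_on_eq_continuous_at)
  have cp: "continuous_periodic L (partial_deriv i f)"
    using f(1,3) by (simp add: continuous_periodic_def spatially_periodic_partial_deriv)
  have dw: "wave (- n) differentiable (at x)" for x
    using has_derivative_wave differentiable_def by blast
  have pw: "partial_deriv i (wave (- n)) x = - (\<i> * of_real (freq n $ i)) * wave (- n) x" for x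
    using has_derivative_partial_deriv[OF has_derivative_wave, of i "- n" x]
    by (simp add: freq_uminus inner_axis)
  have eq: "partial_deriv i (\<lambda>x. f x * wave (- n) x)
      = (\<lambda>x. partial_deriv i f x * wave (- n) x - \<i> * of_real (freq n $ i) * (f x * wave (- n) x))"
    by (simp add: fun_eq_iff partial_deriv_mult[OF f(2) dw] pw)
  have "mean (partial_deriv i (\<lambda>x. f x * wave (- n) x)) = 0"
  proof (rule mean_partial_deriv)
    show "spatially_periodic L (\<lambda>x. f x * wave (- n) x)"
      using continuous_periodic_mult_wave[OF cf] by (simp add: continuous_periodic_def)
    show "(\<lambda>x. f x * wave (- n) x) differentiable (at x)" for x
      by (intro differentiable_mult f dw)
    show "continuous_on UNIV (partial_deriv i (\<lambda>x. f x * wave (- n) x))"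
      unfolding eq using cf f(3) by (auto simp: continuous_periodic_def intro!: continuous_intros continuous_wave)
  qed
  then show ?thesis
    unfolding eq using cf cp
    by (simp add: mean_diff mean_cmult cf_def continuous_periodic_mult continuous_periodic_mult_wave continuous_periodic_const)
qed

section \<open>Bessel's inequality and Parseval's identity\<close>

lemma continuous_periodic_norm_square:
  fixes f :: "real^3 \<Rightarrow> complex"
  shows "continuous_periodic L f \<Longrightarrow> continuous_periodic L (\<lambda>x. (norm (f x))\<^sup>2)"
  by (erule continuous_periodic_compose) (intro continuous_intros)

lemma bessel_finite:
  assumes f: "continuous_periodic L f" and F: "finite F"
  shows "(\<Sum>n\<in>F. (norm (cf f n))\<^sup>2) \<le> mean (\<lambda>x. (norm (f x))\<^sup>2)"
proof -
  define P where "P x = (\<Sum>n\<in>F. cf f n * wave n x)" for x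
  have cpP: "continuous_periodic L P"
    unfolding P_def by (intro continuous_periodic_sum continuous_periodic_mult continuous_periodic_const continuous_periodic_wave)
  have cnjP: "continuous_periodic L (\<lambda>x. cnj (P x))" and cnjf: "continuous_periodic L (\<lambda>x. cnj (f x))"
    by (rule continuous_periodic_compose[OF cpP] continuous_periodic_compose[OF f], intro continuous_intros)+
  have cnjP_eq: "cnj (P x) = (\<Sum>n\<in>F. cnj (cf f n) * wave (- n) x)" for x
    by (simp add: P_def cnj_wave)
  have fP: "mean (\<lambda>x. f x * cnj (P x)) = (\<Sum>n\<in>F. of_real ((norm (cf f n))\<^sup>2))"
  proof -
    have "mean (\<lambda>x. f x * cnj (P x)) = mean (\<lambda>x. \<Sum>n\<in>F. cnj (cf f n) * (f x * wave (- n) x))"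
      by (simp add: cnjP_eq sum_distrib_left mult_ac)
    also have "\<dots> = (\<Sum>n\<in>F. cnj (cf f n) * cf f n)"
      using f by (simp add: mean_sum mean_cmult cf_def continuous_periodic_mult continuous_periodic_const continuous_periodic_wave)
    finally show ?thesis by (simp add: complex_norm_square mult.commute del: of_real_power)
  qed
  have PP: "mean (\<lambda>x. P x * cnj (P x)) = (\<Sum>n\<in>F. of_real ((norm (cf f n))\<^sup>2))"
  proof -
    have "mean (\<lambda>x. P x * cnj (P x)) = mean (\<lambda>x. \<Sum>n\<in>F. \<Sum>m\<in>F. (cf f n * cnj (cf f m)) * wave (n - m) x)"
    proof -
      have "P x * cnj (P x) = (\<Sum>n\<in>F. \<Sum>m\<in>F. (cf f n * cnj (cf f m)) * wave (n - m) x)" for x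
      proof -
        have "wave (n - m) x = wave n x * wave (- m) x" for n m using wave_add_index[of n "- m" x] by simp
        then show ?thesis unfolding cnjP_eq unfolding P_def sum_product by (simp add: mult_ac)
      qed
      then show ?thesis by simp
    qed
    also have "\<dots> = (\<Sum>n\<in>F. \<Sum>m\<in>F. (cf f n * cnj (cf f m)) * mean (wave (n - m)))"
      by (simp add: mean_sum mean_cmult continuous_periodic_sum continuous_periodic_mult continuous_periodic_const continuous_periodic_wave)
    also have "\<dots> = (\<Sum>n\<in>F. cf f n * cnj (cf f n))"
      using F by (simp add: mean_wave if_distrib cong: if_cong)
    finally show ?thesis by (simp add: complex_norm_square del: of_real_power)
  qed
  have Pf: "mean (\<lambda>x. P x * cnj (f x)) = (\<Sum>n\<in>F. of_real ((norm (cf f n))\<^sup>2))"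
    using mean_cnj[OF continuous_periodic_mult[OF f cnjP]] fP by (simp add: mult.commute)
  have c2: "continuous_periodic L (\<lambda>x. (norm (f x - P x))\<^sup>2)"
    by (intro continuous_periodic_norm_square continuous_periodic_intros f cpP)
  have "0 = mean (\<lambda>x. 0::real)" by (simp add: mean_const)
  also have "\<dots> \<le> mean (\<lambda>x. (norm (f x - P x))\<^sup>2)"
    by (rule mean_mono[OF continuous_periodic_const c2]) simp
  finally have "0 \<le> mean (\<lambda>x. (norm (f x - P x))\<^sup>2)" .
  moreover have "complex_of_real (mean (\<lambda>x. (norm (f x - P x))\<^sup>2))
      = of_real (mean (\<lambda>x. (norm (f x))\<^sup>2) - (\<Sum>n\<in>F. (norm (cf f n))\<^sup>2))"
  proof -
    have "complex_of_real (mean (\<lambda>x. (norm (f x - P x))\<^sup>2))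
        = mean (\<lambda>x. (f x * cnj (f x) - f x * cnj (P x)) - (P x * cnj (f x) - P x * cnj (P x)))"
      by (simp add: mean_of_real[OF c2, symmetric] complex_norm_square algebra_simps del: of_real_power)
    also have "\<dots> = (mean (\<lambda>x. f x * cnj (f x)) - mean (\<lambda>x. f x * cnj (P x))) - (mean (\<lambda>x. P x * cnj (f x)) - mean (\<lambda>x. P x * cnj (P x)))"
      using f cpP cnjP cnjf by (simp add: mean_diff continuous_periodic_mult continuous_periodic_intros)
    also have "mean (\<lambda>x. f x * cnj (f x)) = of_real (mean (\<lambda>x. (norm (f x))\<^sup>2))"
      using mean_of_real[OF continuous_periodic_norm_square[OF f]] by (simp add: complex_norm_square del: of_real_power)
    finally show ?thesis by (simp add: fP PP Pf)
  qed
  ultimately show ?thesis by (simp only: of_real_eq_iff)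
qed

lemma bessel:
  assumes f: "continuous_periodic L f"
  shows "(\<lambda>n. (norm (cf f n))\<^sup>2) summable_on UNIV"
    and "(\<Sum>\<^sub>\<infinity>n. (norm (cf f n))\<^sup>2) \<le> mean (\<lambda>x. (norm (f x))\<^sup>2)"
proof -
  show s: "(\<lambda>n. (norm (cf f n))\<^sup>2) summable_on UNIV"
    by (rule nonneg_bdd_above_summable_on) (auto intro!: bdd_aboveI2 bessel_finite f)
  show "(\<Sum>\<^sub>\<infinity>n. (norm (cf f n))\<^sup>2) \<le> mean (\<lambda>x. (norm (f x))\<^sup>2)"
    by (rule infsum_le_finite_sums[OF s]) (auto intro!: bessel_finite f)
qed

text \<open>Parseval's identity for absolutely convergent series: the square of the modulus is the
  Fourier series of \<open>c\<close> convolved with its conjugate reflection \<open>d\<close>, and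
  the mean picks out the coefficient at 0.\<close>

lemma mean_norm_square_series:
  assumes c: "c abs_summable_on UNIV"
  shows "mean (\<lambda>x. (norm (series c x))\<^sup>2) = (\<Sum>\<^sub>\<infinity>n. (norm (c n))\<^sup>2)"
proof -
  define d where "d n = cnj (c (- n))" for n
  have b: "bij_betw uminus UNIV (UNIV :: (int^3) set)" by (rule bij_uminus)
  have d: "d abs_summable_on UNIV"
    using c summable_on_reindex_bij_betw[OF b, of "\<lambda>m. norm (c m)"] by (simp add: d_def)
  have "cnj (series c x) = series d x" for x
  proof -
    have "cnj (series c x) = (\<Sum>\<^sub>\<infinity>n. cnj (c n) * wave (- n) x)"
      by (simp add: series_def cnj_wave flip: infsum_cnj)
    also have "\<dots> = series d x"
      using infsum_reindex_bij_betw[OF b, of "\<lambda>n. d n * wave n x"] by (simp add: series_def d_def)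
    finally show ?thesis .
  qed
  then have "complex_of_real ((norm (series c x))\<^sup>2) = series (conv c d) x" for x
    using series_mult[OF c d, of x] by (simp only: complex_norm_square)
  then have "complex_of_real (mean (\<lambda>x. (norm (series c x))\<^sup>2)) = mean (series (conv c d))"
    using mean_of_real[OF continuous_periodic_norm_square[OF continuous_periodic_series[OF c]]] by simp
  also have "\<dots> = conv c d 0" by (rule mean_series[OF conv_abs_summable[OF c d]])
  also have "\<dots> = (\<Sum>\<^sub>\<infinity>m. of_real ((norm (c (- m)))\<^sup>2))"
    by (simp add: conv_def d_def complex_norm_square del: of_real_power)
  also have "\<dots> = (\<Sum>\<^sub>\<infinity>m. of_real ((norm (c m))\<^sup>2))"
    by (rule infsum_reindex_bij_betw[OF b])
  also have "\<dots> = of_real (\<Sum>\<^sub>\<infinity>m. (norm (c m))\<^sup>2)"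
  proof (rule infsum_bounded_linear[OF bounded_linear_of_real, symmetric])
    show "(\<lambda>m. (norm (c m))\<^sup>2) summable_on UNIV"
      using bessel(1)[OF continuous_periodic_series[OF c]] cf_series[OF c] by simp
  qed
  finally show ?thesis by (simp only: of_real_eq_iff)
qed

text \<open>The summability that allows \<open>k\<close> termwise differentiations: each derivative
  consumes one power of the weight, and at weight 0 the series is still absolutely convergent, hence
  continuous.\<close>

definition weighted_summable :: "nat \<Rightarrow> (int^3 \<Rightarrow> complex) \<Rightarrow> bool" where
  "weighted_summable k c \<longleftrightarrow> (\<lambda>n. (1 + norm (freq n)) ^ k * norm (c n)) summable_on UNIV"

lemma weighted_summable_le:
  assumes "weighted_summable k c" "j \<le> k" shows "weighted_summable j c"
  unfolding weighted_summable_def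
  by (rule summable_on_comparison_test[OF assms(1)[unfolded weighted_summable_def]])
    (use assms(2) in \<open>auto intro!: mult_right_mono power_increasing\<close>)

lemma weighted_summable_abs: "weighted_summable k c \<Longrightarrow> c abs_summable_on UNIV"
  using weighted_summable_le[of k c 0] by (simp add: weighted_summable_def)

definition deriv_coeff :: "3 \<Rightarrow> (int^3 \<Rightarrow> complex) \<Rightarrow> int^3 \<Rightarrow> complex" where
  "deriv_coeff i c n = \<i> * of_real (freq n $ i) * c n"

lemma norm_deriv_coeff_le: "norm (deriv_coeff i c n) \<le> norm (freq n) * norm (c n)"
  unfolding deriv_coeff_def by (simp add: norm_mult mult_right_mono component_le_norm_cart)

lemma weighted_summable_deriv:
  assumes "weighted_summable (Suc k) c" shows "weighted_summable k (deriv_coeff i c)"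
  unfolding weighted_summable_def
proof (rule summable_on_comparison_test[OF assms[unfolded weighted_summable_def]])
  fix n
  have "(1 + norm (freq n)) ^ k * norm (deriv_coeff i c n) \<le> (1 + norm (freq n)) ^ k * ((1 + norm (freq n)) * norm (c n))"
    using norm_deriv_coeff_le[of i c n] norm_ge_zero[of "c n"] unfolding distrib_right mult_1
    by (intro mult_left_mono) (linarith, simp)
  then show "(1 + norm (freq n)) ^ k * norm (deriv_coeff i c n) \<le> (1 + norm (freq n)) ^ Suc k * norm (c n)"
    by (simp add: mult_ac)
qed auto

lemma has_derivative_series:
  assumes "weighted_summable 1 c"
  shows "(series c has_derivative (\<lambda>h. \<Sum>\<^sub>\<infinity>n. c n * (\<i> * of_real (freq n \<bullet> h) * wave n x))) (at x)"
  unfolding series_def[abs_def]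
proof (rule has_derivative_infsum[where X=UNIV and M="\<lambda>n. (1 + norm (freq n)) * norm (c n)"])
  show "((\<lambda>x. c n * wave n x) has_derivative (\<lambda>h. c n * (\<i> * of_real (freq n \<bullet> h) * wave n y))) (at y)" for n y
    by (rule has_derivative_mult_right[OF has_derivative_wave])
  show "norm (c n * (\<i> * of_real (freq n \<bullet> h) * wave n y)) \<le> (1 + norm (freq n)) * norm (c n) * norm h" for n y h
  proof -
    have "\<bar>freq n \<bullet> h\<bar> \<le> (1 + norm (freq n)) * norm h"
      using Cauchy_Schwarz_ineq2[of "freq n" h] by (smt (verit) mult_right_mono norm_ge_zero)
    then have "norm (c n) * \<bar>freq n \<bullet> h\<bar> \<le> norm (c n) * ((1 + norm (freq n)) * norm h)"
      by (rule mult_left_mono) simp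
    then show ?thesis by (simp add: norm_mult mult_ac)
  qed
  show "(\<lambda>n. (1 + norm (freq n)) * norm (c n)) summable_on UNIV"
    using assms by (simp add: weighted_summable_def)
  show "(\<lambda>n. c n * wave n y) summable_on UNIV" for y
    by (rule series_summable[OF weighted_summable_abs[OF assms]])
qed auto

lemma partial_deriv_series:
  assumes "weighted_summable 1 c" shows "partial_deriv i (series c) = series (deriv_coeff i c)"
  using has_derivative_partial_deriv[OF has_derivative_series[OF assms], of i]
  by (simp add: fun_eq_iff series_def deriv_coeff_def inner_axis mult_ac)

lemma C_class_series: "weighted_summable k c \<Longrightarrow> C_class k (series c)"
proof (induction k arbitrary: c)
  case 0
  then show ?case using continuous_periodic_series[OF weighted_summable_abs] by (simp add: continuous_periodic_def)
next
  case (Suc k)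
  have 1: "weighted_summable 1 c" using Suc.prems by (rule weighted_summable_le) simp
  show ?case
    using has_derivative_series[OF 1] partial_deriv_series[OF 1] Suc.IH[OF weighted_summable_deriv[OF Suc.prems]]
    by (auto simp: differentiable_def)
qed

end

section \<open>Density of trigonometric polynomials\<close>

context periodic_box
begin

text \<open>Building polynomials one wave at a time gives closure under sums and products by
  induction, without bookkeeping of supports; finitely supported coefficients are recovered
  afterwards in \<open>trig_poly_eq_series\<close>.\<close>

inductive trig_poly :: "(real^3 \<Rightarrow> complex) \<Rightarrow> bool" where
  zero: "trig_poly (\<lambda>x. 0)"
| add_wave: "trig_poly f \<Longrightarrow> trig_poly (\<lambda>x. f x + c * wave n x)"

lemma trig_poly_wave: "trig_poly (\<lambda>x. c * wave n x)"
  using trig_poly.add_wave[OF trig_poly.zero, of c n] by simp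

lemma trig_poly_const: "trig_poly (\<lambda>x. c)"
  using trig_poly_wave[of c 0] by simp

lemma trig_poly_add:
  assumes f: "trig_poly f" and "trig_poly g" shows "trig_poly (\<lambda>x. f x + g x)"
  using assms(2)
proof (induction g rule: trig_poly.induct)
  case (add_wave g c n)
  from trig_poly.add_wave[OF add_wave.IH, of c n]
  show ?case by (simp add: add.assoc)
qed (simp add: f)

lemma trig_poly_mult_wave: "trig_poly f \<Longrightarrow> trig_poly (\<lambda>x. f x * (c * wave n x))"
proof (induction f rule: trig_poly.induct)
  case (add_wave f d m)
  have "(\<lambda>x. (f x + d * wave m x) * (c * wave n x)) = (\<lambda>x. f x * (c * wave n x) + d * c * wave (m + n) x)"
    by (simp add: fun_eq_iff wave_add_index algebra_simps)
  then show ?case using trig_poly.add_wave[OF add_wave.IH] by simp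
qed (simp add: trig_poly.zero)

lemma trig_poly_mult:
  assumes f: "trig_poly f" and "trig_poly g" shows "trig_poly (\<lambda>x. f x * g x)"
  using assms(2)
proof (induction g rule: trig_poly.induct)
  case (add_wave g c n)
  have "(\<lambda>x. f x * (g x + c * wave n x)) = (\<lambda>x. f x * g x + f x * (c * wave n x))"
    by (simp add: fun_eq_iff distrib_left)
  then show ?case using trig_poly_add[OF add_wave.IH trig_poly_mult_wave[OF f]] by simp
qed (simp add: trig_poly.zero)

lemma trig_poly_power: "trig_poly f \<Longrightarrow> trig_poly (\<lambda>x. f x ^ N)"
  by (induction N) (auto intro: trig_poly_const trig_poly_mult)

lemma trig_poly_continuous_periodic: "trig_poly f \<Longrightarrow> continuous_periodic L f"
  by (induction rule: trig_poly.induct)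
    (auto intro!: continuous_periodic_const continuous_periodic_intros continuous_periodic_mult continuous_periodic_wave)

lemma trig_poly_eq_series:
  assumes "trig_poly f"
  shows "\<exists>c. finite {n. c n \<noteq> 0} \<and> f = series c"
  using assms
proof (induction rule: trig_poly.induct)
  case zero
  then show ?case by (intro exI[of _ "\<lambda>n. 0"]) (simp add: series_def fun_eq_iff)
next
  case (add_wave f k m)
  then obtain c where c: "finite {n. c n \<noteq> 0}" "f = series c" by blast
  define d where "d n = (if n = m then k else 0)" for n
  have fd: "finite {n. d n \<noteq> 0}" by (rule finite_subset[of _ "{m}"]) (auto simp: d_def)
  have abs: "c abs_summable_on UNIV" "d abs_summable_on UNIV"
    using c(1) fd by (auto intro: finite_nonzero_values_imp_summable_on)
  have "series d x = k * wave m x" for x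
  proof -
    have "series d x = (\<Sum>\<^sub>\<infinity>n\<in>{m}. d n * wave n x)"
      unfolding series_def by (rule infsum_cong_neutral) (auto simp: d_def)
    then show ?thesis by (simp add: d_def)
  qed
  then have "(\<lambda>x. f x + k * wave m x) = series (\<lambda>n. c n + d n)"
    by (simp add: fun_eq_iff c(2) series_add[OF abs])
  moreover have "finite {n. c n + d n \<noteq> 0}"
    by (rule finite_subset[OF _ finite_UnI[OF c(1) fd]]) auto
  ultimately show ?case by (intro exI[of _ "\<lambda>n. c n + d n"] conjI)
qed

text \<open>The unnormalised de la Vallee-Poussin kernel: the base is the square of
  \<open>cos (pi * t / L)\<close>, so this is a nonnegative trigonometric polynomial that
  concentrates at the multiples of \<open>L\<close> as \<open>M\<close> grows.\<close>

definition bump1 :: "nat \<Rightarrow> real \<Rightarrow> real" where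
  "bump1 M t = ((1 + cos (2 * pi / L * t)) / 2) ^ M"

definition bump :: "nat \<Rightarrow> real^3 \<Rightarrow> real" where
  "bump M y = bump1 M (y $ 1) * bump1 M (y $ 2) * bump1 M (y $ 3)"

lemma bump_nonneg: "0 \<le> bump M y"
proof -
  have "0 \<le> 1 + cos t" for t :: real using cos_ge_minus_one[of t] by linarith
  then show ?thesis by (simp add: bump_def bump1_def)
qed

lemma trig_poly_cos: "trig_poly (\<lambda>y. of_real (cos (2 * pi / L * y $ i)))"
proof -
  have "complex_of_real (cos (2 * pi / L * y $ i)) = (1/2) * wave (axis i 1) y + (1/2) * wave (- axis i 1) y" for y
  proof -
    have "freq (axis i 1) \<bullet> y = 2 * pi / L * y $ i"
    proof -
      have "freq (axis i 1) = axis i (2 * pi / L)" by (simp add: vec_eq_iff freq_nth axis_def)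
      then show ?thesis by (simp add: inner_axis')
    qed
    then show ?thesis by (simp add: wave_def freq_uminus complex_eq_iff)
  qed
  then show ?thesis using trig_poly_add[OF trig_poly_wave trig_poly_wave] by (simp only:)
qed

lemma trig_poly_bump: "trig_poly (\<lambda>y. of_real (bump M y))"
proof -
  have 1: "trig_poly (\<lambda>y. of_real (bump1 M (y $ i)))" for i
  proof -
    have "trig_poly (\<lambda>y. ((1/2) * (1 + of_real (cos (2 * pi / L * y $ i)))) ^ M)"
      by (intro trig_poly_power trig_poly_mult trig_poly_const trig_poly_add trig_poly_cos)
    then show ?thesis by (simp add: bump1_def)
  qed
  show ?thesis unfolding bump_def of_real_mult by (intro trig_poly_mult 1)
qed

lemma continuous_periodic_Re:
  fixes f :: "real^3 \<Rightarrow> real"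
  assumes "trig_poly (\<lambda>x. of_real (f x))" shows "continuous_periodic L f"
  using continuous_periodic_compose[OF trig_poly_continuous_periodic[OF assms], of Re]
  by (simp add: continuous_intros)

lemma continuous_periodic_bump: "continuous_periodic L (bump M)"
  by (rule continuous_periodic_Re[OF trig_poly_bump])

lemma mean_bump_pos: "0 < mean (bump M)"
proof -
  have cont: "continuous_on (cbox 0 (\<chi> i. L)) (bump M)"
    using continuous_periodic_bump[of M] by (auto simp: continuous_periodic_def elim: continuous_on_subset)
  have "integral (cbox 0 (\<chi> i. L)) (bump M) \<noteq> 0"
  proof
    assume "integral (cbox 0 (\<chi> i. L)) (bump M) = 0"
    then have "(bump M has_integral 0) (cbox 0 (\<chi> i. L))"
      using integrable_integral[OF integrable_continuous[OF cont]] by simp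
    then have "bump M 0 = 0"
      by (rule has_integral_0_cbox_imp_0[OF cont bump_nonneg])
        (use L_pos in \<open>auto simp: interval_ne_empty_cart mem_box_cart\<close>)
    then show False by (simp add: bump_def bump1_def)
  qed
  moreover have "0 \<le> integral (cbox 0 (\<chi> i. L)) (bump M)"
    by (rule integral_nonneg[OF integrable_continuous[OF cont]]) (simp add: bump_nonneg)
  ultimately show ?thesis using L_pos by (simp add: mean_def period_cube_def)
qed

text \<open>Integrating the derivative of \<open>sin (\<kappa> y\<^sub>i) bump M y\<close> over a period gives the exact second moment
  of the kernel.\<close>

lemma mean_bump_one_minus_cos:
  "mean (\<lambda>y. (1 - cos (2 * pi / L * y $ i)) * bump M y) = mean (bump M) / (real M + 1)"
proof -
  define k where "k = 2 * pi / L"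
  have k: "k \<noteq> 0" using L_pos by (simp add: k_def)
  define F where "F y = sin (k * y $ i) * bump M y" for y
  define C where "C y = 1 - cos (k * y $ i)" for y :: "real^3"
  \<comment> \<open>For \<open>M = 0\<close> the truncated exponent \<open>M - 1\<close> is 0, which
    is harmless because the factor \<open>real M\<close> vanishes.\<close>
  have d1: "(bump1 M has_real_derivative (- (real M) * k / 2 * sin (k * t) * ((1 + cos (k * t)) / 2) ^ (M - 1))) (at t)" for t
    unfolding bump1_def k_def[symmetric] by (auto intro!: derivative_eq_intros)
  \<comment> \<open>Writing \<open>sin\<^sup>2\<close> as \<open>(1 - cos) * (1 + cos)\<close>
    restores the power lost by differentiation, so the derivative of \<open>sin * bump1\<close> is
    again a multiple of the kernel.\<close>
  have alg: "k * cos (k * t) * bump1 M t + sin (k * t) * (- (real M) * k / 2 * sin (k * t) * ((1 + cos (k * t)) / 2) ^ (M - 1))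
     = k * (bump1 M t - (real M + 1) * (1 - cos (k * t)) * bump1 M t)" for t
  proof (cases M)
    case 0 then show ?thesis by (simp add: bump1_def algebra_simps)
  next
    case (Suc N)
    have "sin (k * t) * sin (k * t) = (1 - cos (k * t)) * (1 + cos (k * t))"
      by (simp add: sin_squared_eq algebra_simps flip: power2_eq_square)
    moreover have "sin (k * t) * (- (real M) * k / 2 * sin (k * t) * ((1 + cos (k * t)) / 2) ^ (M - 1))
        = - (real M) * k / 2 * (sin (k * t) * sin (k * t)) * ((1 + cos (k * t)) / 2) ^ (M - 1)" by simp
    ultimately have "sin (k * t) * (- (real M) * k / 2 * sin (k * t) * ((1 + cos (k * t)) / 2) ^ (M - 1))
        = - (real M) * k * (1 - cos (k * t)) * (((1 + cos (k * t)) / 2) * ((1 + cos (k * t)) / 2) ^ (M - 1))"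
      by (simp only:) (simp del: distrib_left_numeral distrib_right_numeral)
    also have "((1 + cos (k * t)) / 2) * ((1 + cos (k * t)) / 2) ^ (M - 1) = bump1 M t"
      using Suc by (simp add: bump1_def k_def)
    finally show ?thesis by (simp add: algebra_simps)
  qed
  have d2: "((\<lambda>t. sin (k * t) * bump1 M t) has_real_derivative k * (bump1 M t - (real M + 1) * (1 - cos (k * t)) * bump1 M t)) (at t)" for t
    proof -
    have ds: "((\<lambda>t. sin (k * t)) has_real_derivative k * cos (k * t)) (at t)"
      by (auto intro!: derivative_eq_intros)
    show ?thesis
      using DERIV_mult[OF ds d1] unfolding alg[symmetric] by (simp only: mult.commute[of "sin (k * t)"])
  qed
  \<comment> \<open>The product of the other two factors of the kernel, constant along axis
    \<open>i\<close>.\<close>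
  define R where "R y = (\<Prod>j\<in>UNIV - {i}. bump1 M (y $ j))" for y :: "real^3"
  have bR: "bump M y = bump1 M (y $ i) * R y" for y
  proof -
    have "bump M y = (\<Prod>j\<in>UNIV. bump1 M (y $ j))" unfolding bump_def UNIV_3 by (simp add: mult.assoc)
    then show ?thesis by (simp add: R_def prod.remove[of UNIV i])
  qed
  have pF: "partial_deriv i F y = k * (bump M y - (real M + 1) * (C y * bump M y))" for y
  proof (rule has_vector_derivative_imp_partial_deriv)
    have R: "R (y + h *\<^sub>R axis i 1) = R y" for h
      unfolding R_def by (intro prod.cong) (auto simp: axis_def)
    have "((\<lambda>h. sin (k * (y $ i + h)) * bump1 M (y $ i + h)) has_real_derivative
      k * (bump1 M (y $ i) - (real M + 1) * (1 - cos (k * y $ i)) * bump1 M (y $ i))) (at 0)"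
      using DERIV_shift[of "\<lambda>t. sin (k * t) * bump1 M t" _ 0 "y $ i"] d2[of "y $ i"] by (simp add: add.commute)
    then have "((\<lambda>h. sin (k * (y $ i + h)) * bump1 M (y $ i + h) * R y) has_real_derivative
      k * (bump1 M (y $ i) - (real M + 1) * (1 - cos (k * y $ i)) * bump1 M (y $ i)) * R y) (at 0)"
      by (rule DERIV_cmult_right)
    then show "((\<lambda>h. F (y + h *\<^sub>R axis i 1)) has_vector_derivative k * (bump M y - (real M + 1) * (C y * bump M y))) (at 0)"
      by (simp add: F_def bR R C_def has_real_derivative_iff_has_vector_derivative algebra_simps)
  qed
  have cC: "continuous_periodic L C"
    unfolding C_def k_def
    by (intro continuous_periodic_intros continuous_periodic_const continuous_periodic_Re trig_poly_cos)
  have cCb: "continuous_periodic L (\<lambda>y. C y * bump M y)"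
    by (rule continuous_periodic_mult[OF cC continuous_periodic_bump])
  have "mean (partial_deriv i F) = 0"
  proof (rule mean_partial_deriv)
    show "spatially_periodic L F"
    proof -
      have "sin (k * (y + L *\<^sub>R axis j 1) $ i) = sin (k * y $ i)" for y :: "real^3" and j
        using L_pos by (simp add: axis_def k_def distrib_left)
      then show ?thesis
        using continuous_periodic_bump[of M] by (simp add: F_def spatially_periodic_def continuous_periodic_def)
    qed
    have b1: "(\<lambda>y::real^3. bump1 M (y $ j)) differentiable (at x)" for j x
    proof -
      have "((\<lambda>y::real^3. y $ j) has_derivative (\<lambda>h. h $ j)) (at x)"
        by (rule bounded_linear_imp_has_derivative[OF bounded_linear_vec_nth])
      from has_derivative_compose[OF this d1[unfolded has_field_derivative_def]]
      show ?thesis by (auto simp: differentiable_def)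
    qed
    have s1: "(\<lambda>y::real^3. sin (k * y $ j)) differentiable (at x)" for j x
    proof -
      have "((\<lambda>y::real^3. k * y $ j) has_derivative (\<lambda>h. k * h $ j)) (at x)"
        by (rule has_derivative_mult_right[OF bounded_linear_imp_has_derivative[OF bounded_linear_vec_nth]])
      from has_derivative_sin[OF this] show ?thesis by (auto simp: differentiable_def)
    qed
    show "F differentiable (at x)" for x
      unfolding F_def bump_def by (intro differentiable_mult s1 b1)
    show "continuous_on UNIV (partial_deriv i F)"
      unfolding pF[abs_def] using continuous_periodic_bump[of M] cCb
      by (auto simp: continuous_periodic_def intro!: continuous_intros)
  qed
  moreover have "mean (partial_deriv i F) = k * (mean (bump M) - (real M + 1) * mean (\<lambda>y. C y * bump M y))"
  proof -
    have c1: "continuous_periodic L (\<lambda>y. (real M + 1) * (C y * bump M y))"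
      by (intro continuous_periodic_mult continuous_periodic_const cC continuous_periodic_bump)
    have "mean (\<lambda>y. k * (bump M y - (real M + 1) * (C y * bump M y)))
       = k * mean (\<lambda>y. bump M y - (real M + 1) * (C y * bump M y))"
      by (rule mean_bounded_linear[OF bounded_linear_mult_right])
        (intro continuous_periodic_intros continuous_periodic_bump c1)
    also have "mean (\<lambda>y. bump M y - (real M + 1) * (C y * bump M y)) = mean (bump M) - mean (\<lambda>y. (real M + 1) * (C y * bump M y))"
      by (rule mean_diff[OF continuous_periodic_bump c1])
    also have "mean (\<lambda>y. (real M + 1) * (C y * bump M y)) = (real M + 1) * mean (\<lambda>y. C y * bump M y)"
      by (rule mean_bounded_linear[OF bounded_linear_mult_right cCb])
    finally show ?thesis by (simp add: pF[abs_def])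
  qed
  ultimately have "mean (bump M) = (real M + 1) * mean (\<lambda>y. C y * bump M y)" using k by simp
  then show ?thesis by (simp add: C_def k_def field_simps)
qed

text \<open>Near the period lattice the increment of \<open>g\<close> is below \<open>e\<close> by
  uniform continuity. Away from it some \<open>1 - cos\<close> is at least a fixed
  \<open>\<eta> > 0\<close>, and \<open>K = 2 * M / \<eta>\<close> makes the sum dominate the
  trivial bound \<open>2 * M\<close>. In this form the error of the kernel approximation is computed
  by its moments alone.\<close>

lemma modulus_one_minus_cos:
  assumes g: "continuous_periodic L g" and e: "e > 0"
  obtains K where "K \<ge> 0" "\<And>x y. norm (g (x + y) - g x) \<le> e + K * (\<Sum>i\<in>UNIV. 1 - cos (2 * pi / L * y $ i))"
proof -
  define k where "k = 2 * pi / L"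
  have k: "k > 0" using L_pos by (simp add: k_def)
  obtain M where M: "M > 0" "\<And>x. norm (g x) \<le> M" using continuous_periodic_bounded[OF g] by blast
  obtain d0 where d0: "d0 > 0" "\<And>x y. norm (x - y) < d0 \<Longrightarrow> norm (g x - g y) < e"
    using continuous_periodic_uniformly_continuous[OF g e] by blast
  \<comment> \<open>Capping at \<open>L\<close> keeps \<open>k * (d / 3)\<close> inside the interval
    from 0 to \<open>pi\<close>, where the cosine is decreasing. The third is there because a vector
    of norm at least \<open>d\<close> has a coordinate of size at least
    \<open>d / 3\<close>.\<close>
  define d where "d = min d0 L"
  have d: "d > 0" "d \<le> L" "\<And>x y. norm (x - y) < d \<Longrightarrow> norm (g x - g y) < e"
    using d0 L_pos by (auto simp: d_def)
  define \<eta> where "\<eta> = 1 - cos (k * (d / 3))"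
  have kd: "0 < k * (d / 3)" "k * (d / 3) \<le> pi"
  proof -
    have "k * (d / 3) \<le> k * (L / 2)" using d k by (intro mult_left_mono) auto
    then show "k * (d / 3) \<le> pi" using L_pos by (simp add: k_def)
  qed (use k d in simp)
  have \<eta>: "\<eta> > 0" using cos_monotone_0_pi[of 0 "k * (d / 3)"] kd by (simp add: \<eta>_def)
  define K where "K = 2 * M / \<eta>"
  have K: "K \<ge> 0" using M \<eta> by (simp add: K_def)
  have c0: "0 \<le> 1 - cos t" for t :: real by simp
  have "norm (g (x + y) - g x) \<le> e + K * (\<Sum>i\<in>UNIV. 1 - cos (k * y $ i))" for x y
  proof -
    \<comment> \<open>Rounding to the nearest lattice point gives a representative \<open>w\<close>
      of the shift with coordinates at most \<open>L / 2\<close>, so again the cosine is monotone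
      where it is compared.\<close>
    define m :: "int^3" where "m = (\<chi> i. - round (y $ i / L))"
    define w where "w = y + (\<chi> i. L * of_int (m $ i))"
    have w: "\<bar>w $ i\<bar> \<le> L / 2" for i
    proof -
      have "\<bar>of_int (round (y $ i / L)) - y $ i / L\<bar> \<le> 1 / 2" by (rule of_int_round_abs_le)
      then have "\<bar>of_int (round (y $ i / L)) - y $ i / L\<bar> * L \<le> 1 / 2 * L" using L_pos by (intro mult_right_mono) auto
      also have "\<bar>of_int (round (y $ i / L)) - y $ i / L\<bar> * L = \<bar>(of_int (round (y $ i / L)) - y $ i / L) * L\<bar>"
        using L_pos by (simp add: abs_mult)
      also have "(of_int (round (y $ i / L)) - y $ i / L) * L = - w $ i"
        using L_pos by (simp add: w_def m_def field_simps)
      finally show ?thesis by simp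
    qed
    have gw: "g (x + w) = g (x + y)"
      using spatially_periodic_shift[of L g "x + y" m] g by (simp add: w_def continuous_periodic_def add.assoc)
    have cw: "cos (k * y $ i) = cos (k * \<bar>w $ i\<bar>)" for i
    proof -
      have "k * w $ i = k * y $ i + 2 * pi * of_int (m $ i)"
        using L_pos by (simp add: w_def k_def algebra_simps)
      then have "cos (k * w $ i) = cos (k * y $ i)"
        by (simp add: cos_add)
      then show ?thesis by (simp add: abs_if)
    qed
    show ?thesis
    proof (cases "norm w < d")
      case True
      then have "norm (g (x + w) - g x) < e" by (intro d(3)) simp
      moreover have "0 \<le> K * (\<Sum>i\<in>UNIV. 1 - cos (k * y $ i))" using K by (intro mult_nonneg_nonneg sum_nonneg c0)
      ultimately show ?thesis by (simp add: gw)
    next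
      case False
      have "\<exists>i. d / 3 \<le> \<bar>w $ i\<bar>"
      proof (rule ccontr)
        assume "\<not> ?thesis"
        then have "\<bar>w $ i\<bar> < d / 3" for i by (auto simp: not_le)
        from this[of 1] this[of 2] this[of 3] have "(\<Sum>i\<in>UNIV. \<bar>w $ i\<bar>) < d" unfolding sum_3 by linarith
        then show False using False norm_le_l1_cart[of w] by linarith
      qed
      then obtain i where i: "d / 3 \<le> \<bar>w $ i\<bar>" by blast
      have "cos (k * \<bar>w $ i\<bar>) \<le> cos (k * (d / 3))"
      proof (rule cos_monotone_0_pi_le)
        have "k * \<bar>w $ i\<bar> \<le> k * (L / 2)" using w[of i] k by (intro mult_left_mono) auto
        then show "k * \<bar>w $ i\<bar> \<le> pi" using L_pos by (simp add: k_def)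
      qed (use i k kd in auto)
      then have "\<eta> \<le> 1 - cos (k * y $ i)" by (simp add: \<eta>_def cw)
      also have "\<dots> \<le> (\<Sum>i\<in>UNIV. 1 - cos (k * y $ i))" by (rule member_le_sum) auto
      finally have "K * \<eta> \<le> K * (\<Sum>i\<in>UNIV. 1 - cos (k * y $ i))" using K by (rule mult_left_mono)
      then have "2 * M \<le> K * (\<Sum>i\<in>UNIV. 1 - cos (k * y $ i))" using \<eta> by (simp add: K_def)
      moreover have "norm (g (x + y) - g x) \<le> M + M"
        by (rule order_trans[OF norm_triangle_ineq4 add_mono[OF M(2) M(2)]])
      ultimately show ?thesis using e by linarith
    qed
  qed
  then show ?thesis using K that unfolding k_def by blast
qed

text \<open>The approximant is the convolution of \<open>g\<close> with the normalised kernel. By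
  \<open>modulus_one_minus_cos\<close> and the exact moments the error is at most
  \<open>e / 2 + 3 * K / (real M + 1)\<close>.\<close>

lemma trig_poly_dense:
  assumes g: "continuous_periodic L g" and e: "e > 0"
  obtains c where "finite {n. c n \<noteq> 0}" "c abs_summable_on UNIV" "\<And>x. norm (g x - series c x) \<le> e"
proof -
  define k where "k = 2 * pi / L"
  obtain K where K: "K \<ge> 0" "\<And>x y. norm (g (x + y) - g x) \<le> e / 2 + K * (\<Sum>i\<in>UNIV. 1 - cos (k * y $ i))"
    using modulus_one_minus_cos[OF g, of "e / 2", folded k_def] e by auto
  \<comment> \<open>Large enough for the three moments together to contribute at most
    \<open>e / 2\<close>.\<close>
  obtain M :: nat where M: "6 * K / e < real M" using reals_Archimedean2 by blast
  define J where "J = mean (bump M)"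
  have J: "J > 0" by (simp add: J_def mean_bump_pos)
  define h where "h x = mean (\<lambda>y. g (x + y) * of_real (bump M y)) * of_real (1 / J)" for x
  have cb: "continuous_periodic L (\<lambda>y. complex_of_real (bump M y))"
    by (rule trig_poly_continuous_periodic[OF trig_poly_bump])
  have gx: "continuous_periodic L (\<lambda>y. g (x + y))" for x
    using continuous_periodic_translate[OF g, of x] by (simp add: add.commute)
  have ccos: "continuous_periodic L (\<lambda>y. 1 - cos (k * y $ i))" for i
    by (intro continuous_periodic_intros continuous_periodic_const continuous_periodic_Re trig_poly_cos[folded k_def])
  have close: "norm (h x - g x) \<le> e" for x
  proof -
    have "(h x - g x) * of_real J = mean (\<lambda>y. g (x + y) * of_real (bump M y)) - g x * of_real J"
      using J by (simp add: h_def left_diff_distrib)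
    also have "g x * of_real J = mean (\<lambda>y. g x * of_real (bump M y))"
      by (simp add: J_def mean_cmult[OF cb] mean_of_real[OF continuous_periodic_bump])
    also have "mean (\<lambda>y. g (x + y) * of_real (bump M y)) - \<dots> = mean (\<lambda>y. g (x + y) * of_real (bump M y) - g x * of_real (bump M y))"
      by (intro mean_diff[symmetric] continuous_periodic_mult gx cb continuous_periodic_const)
    finally have "norm (h x - g x) * J = norm (mean (\<lambda>y. g (x + y) * of_real (bump M y) - g x * of_real (bump M y)))"
      using J by (metis abs_of_pos norm_mult norm_of_real)
    also have "\<dots> \<le> mean (\<lambda>y. e / 2 * bump M y + K * (\<Sum>i\<in>UNIV. (1 - cos (k * y $ i)) * bump M y))"
    proof (rule norm_mean_le)
      show "continuous_periodic L (\<lambda>y. g (x + y) * of_real (bump M y) - g x * of_real (bump M y))"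
        by (intro continuous_periodic_intros continuous_periodic_mult gx cb continuous_periodic_const)
      show "continuous_periodic L (\<lambda>y. e / 2 * bump M y + K * (\<Sum>i\<in>UNIV. (1 - cos (k * y $ i)) * bump M y))"
        by (intro continuous_periodic_intros continuous_periodic_mult continuous_periodic_const continuous_periodic_bump
            continuous_periodic_sum ccos)
      fix y
      have "norm (g (x + y) * of_real (bump M y) - g x * of_real (bump M y)) = norm (g (x + y) - g x) * bump M y"
        using bump_nonneg[of M y] by (simp flip: left_diff_distrib add: norm_mult)
      also have "\<dots> \<le> (e / 2 + K * (\<Sum>i\<in>UNIV. 1 - cos (k * y $ i))) * bump M y"
        using K(2) bump_nonneg by (intro mult_right_mono) auto
      finally show "norm (g (x + y) * of_real (bump M y) - g x * of_real (bump M y))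
        \<le> e / 2 * bump M y + K * (\<Sum>i\<in>UNIV. (1 - cos (k * y $ i)) * bump M y)"
        by (simp add: distrib_right sum_distrib_right mult.assoc)
    qed
    also have "\<dots> = e / 2 * J + K * (\<Sum>i\<in>(UNIV::3 set). J / (real M + 1))"
    proof -
      have c2: "continuous_periodic L (\<lambda>y. \<Sum>i\<in>UNIV. (1 - cos (k * y $ i)) * bump M y)"
        by (intro continuous_periodic_mult continuous_periodic_bump continuous_periodic_sum ccos)
      have "mean (\<lambda>y. \<Sum>i\<in>UNIV. (1 - cos (k * y $ i)) * bump M y) = (\<Sum>i\<in>(UNIV::3 set). J / (real M + 1))"
        by (subst mean_sum) (auto simp: J_def mean_bump_one_minus_cos[folded k_def] intro!: continuous_periodic_mult ccos continuous_periodic_bump)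
      moreover have "mean (\<lambda>y. K * (\<Sum>i\<in>UNIV. (1 - cos (k * y $ i)) * bump M y))
          = K * mean (\<lambda>y. \<Sum>i\<in>UNIV. (1 - cos (k * y $ i)) * bump M y)"
        by (rule mean_bounded_linear[OF bounded_linear_mult_right c2])
      moreover have "mean (\<lambda>y. e / 2 * bump M y) = e / 2 * J"
        unfolding J_def by (rule mean_bounded_linear[OF bounded_linear_mult_right continuous_periodic_bump])
      moreover have "mean (\<lambda>y. e / 2 * bump M y + K * (\<Sum>i\<in>UNIV. (1 - cos (k * y $ i)) * bump M y))
          = mean (\<lambda>y. e / 2 * bump M y) + mean (\<lambda>y. K * (\<Sum>i\<in>UNIV. (1 - cos (k * y $ i)) * bump M y))"
        by (intro mean_add continuous_periodic_mult[OF continuous_periodic_const] continuous_periodic_bump c2)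
      ultimately show ?thesis by (simp only:)
    qed
    also have "\<dots> = (e / 2 + 3 * K / (real M + 1)) * J" by (simp add: algebra_simps)
    finally have "norm (h x - g x) \<le> e / 2 + 3 * K / (real M + 1)" using J by simp
    also have "3 * K / (real M + 1) \<le> e / 2"
    proof -
      have "6 * K < real M * e" using M e by (simp add: divide_less_eq)
      then have "6 * K \<le> e * (real M + 1)" using e by (simp add: algebra_simps)
      then show ?thesis by (simp add: field_simps)
    qed
    finally show ?thesis by simp
  qed
  \<comment> \<open>With \<open>x\<close> in the argument of the kernel instead of \<open>g\<close>,
    every wave of the kernel splits into a factor in \<open>x\<close> and a factor in
    \<open>y\<close>, so the integral is again a finite combination of waves in
    \<open>x\<close>.\<close>
  have trig: "trig_poly (\<lambda>x. mean (\<lambda>y. g y * f (y - x)))" if "trig_poly f" for f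
    using that
  proof (induction rule: trig_poly.induct)
    case zero then show ?case by (simp add: mean_const trig_poly.zero)
  next
    case (add_wave f c n)
    have cf': "continuous_periodic L (\<lambda>y. f (y - x))" for x
      using continuous_periodic_translate[OF trig_poly_continuous_periodic[OF add_wave.hyps], of "- x"] by simp
    have "mean (\<lambda>y. g y * (f (y - x) + c * wave n (y - x)))
      = mean (\<lambda>y. g y * f (y - x)) + (c * mean (\<lambda>y. g y * wave n y)) * wave (- n) x" for x
    proof -
      have "wave n (y - x) = wave (- n) x * wave n y" for y
        using wave_add[of n y "- x"] by (simp add: wave_minus)
      then have "(\<lambda>y. g y * (f (y - x) + c * wave n (y - x)))
          = (\<lambda>y. g y * f (y - x) + (c * wave (- n) x) * (g y * wave n y))"
        by (simp add: fun_eq_iff algebra_simps)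
      then show ?thesis
        using g cf' by (simp add: mean_add mean_cmult continuous_periodic_mult continuous_periodic_mult_wave continuous_periodic_const)
    qed
    then show ?case using trig_poly.add_wave[OF add_wave.IH] by simp
  qed
  have "trig_poly h"
  proof -
    have "mean (\<lambda>y. g (x + y) * of_real (bump M y)) = mean (\<lambda>y. g y * of_real (bump M (y - x)))" for x
    proof -
      have "continuous_periodic L (\<lambda>y. g y * of_real (bump M (y - x)))"
        using continuous_periodic_mult[OF g continuous_periodic_translate[OF cb, of "- x"]] by simp
      from mean_translate[OF this, of x] show ?thesis by (simp add: add.commute)
    qed
    then show ?thesis
      unfolding h_def[abs_def] using trig_poly_mult[OF trig[OF trig_poly_bump[of M]] trig_poly_const] by (simp only:)
  qed
  then obtain c where c: "finite {n. c n \<noteq> 0}" "h = series c" using trig_poly_eq_series by blast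
  have "c abs_summable_on UNIV" using c(1) by (auto intro: finite_nonzero_values_imp_summable_on)
  then show ?thesis using c close that[of c] by (simp add: norm_minus_commute)
qed

end

section \<open>The periodic heat semigroup\<close>

text \<open>The exponent 4 that is available on the lattice is shared equally among three
  coordinates; \<open>4 / 3 > 1\<close> is what makes each one-dimensional factor summable.\<close>

lemma summable_on_int_powr:
  fixes \<kappa> :: real
  assumes "\<kappa> > 0"
  shows "(\<lambda>j::int. (1 + \<kappa> * \<bar>of_int j\<bar>) powr (- 4 / 3)) summable_on UNIV"
proof -
  define q where "q j = (1 + \<kappa> * \<bar>of_int j\<bar>) powr (- 4 / 3)" for j :: int
  have "summable (\<lambda>m::nat. (1 + \<kappa> * real m) powr (- 4 / 3))"
  proof (rule summable_comparison_test)
    show "summable (\<lambda>m. \<kappa> powr (- 4 / 3) * real m powr (- 4 / 3))"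
      by (intro summable_mult) (simp add: summable_real_powr_iff)
    have "(1 + \<kappa> * real m) powr (- 4 / 3) \<le> \<kappa> powr (- 4 / 3) * real m powr (- 4 / 3)" if "m \<ge> 1" for m
    proof -
      have "(1 + \<kappa> * real m) powr (- 4 / 3) \<le> (\<kappa> * real m) powr (- 4 / 3)"
        using assms that by (intro powr_mono2') auto
      then show ?thesis using assms by (simp add: powr_mult)
    qed
    then show "\<exists>N. \<forall>m\<ge>N. norm ((1 + \<kappa> * real m) powr (- 4 / 3)) \<le> \<kappa> powr (- 4 / 3) * real m powr (- 4 / 3)"
      by (intro exI[of _ 1]) simp
  qed
  then have s: "(\<lambda>m::nat. (1 + \<kappa> * real m) powr (- 4 / 3)) summable_on UNIV"
    by (simp add: summable_on_UNIV_nonneg_real_iff)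
  have "q summable_on range int"
    using s by (subst summable_on_reindex) (simp_all add: q_def o_def)
  moreover have "q summable_on range (\<lambda>m. - int m)"
    using s by (subst summable_on_reindex) (auto simp: q_def o_def inj_def)
  ultimately have "q summable_on (range int \<union> range (\<lambda>m. - int m))" by (rule summable_on_union)
  moreover have "range int \<union> range (\<lambda>m. - int m) = UNIV"
  proof -
    have "j \<in> range int \<union> range (\<lambda>m. - int m)" for j
    proof (cases "j \<ge> 0")
      case True then have "j = int (nat j)" by simp
      then show ?thesis by blast
    next
      case False then have "j = - int (nat (- j))" by simp
      then show ?thesis by blast
    qed
    then show ?thesis by blast
  qed
  ultimately show ?thesis by (simp add: q_def[abs_def])
qed

lemma summable_on_prod3:
  fixes q :: "int \<Rightarrow> real"
  assumes q: "q summable_on UNIV" "\<And>j. 0 \<le> q j"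
  shows "(\<lambda>n::int^3. q (n $ 1) * (q (n $ 2) * q (n $ 3))) summable_on UNIV"
proof -
  have abs: "q abs_summable_on UNIV" using q by simp
  have pair: "(\<lambda>p. f (fst p) * g (snd p)) abs_summable_on UNIV \<times> UNIV"
    if "f abs_summable_on UNIV" "g abs_summable_on UNIV" for f :: "'x \<Rightarrow> real" and g :: "'y \<Rightarrow> real"
    unfolding Infinite_Sum.abs_summable_on_Sigma_iff using that
    by (auto simp: infsum_cmult_right abs_mult infsum_nonneg intro!: summable_on_cmult_left summable_on_cmult_right)
  have "(\<lambda>p. q (fst p) * (q (fst (snd p)) * q (snd (snd p)))) abs_summable_on UNIV \<times> (UNIV \<times> UNIV)"
    using pair[OF abs, of "\<lambda>p. q (fst p) * q (snd p)"] pair[OF abs abs] by simp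
  then have s: "(\<lambda>p. q (fst p) * (q (fst (snd p)) * q (snd (snd p)))) summable_on UNIV"
    using abs_summable_summable by fastforce
  have b: "bij_betw (\<lambda>n::int^3. (n $ 1, n $ 2, n $ 3)) UNIV UNIV"
  proof (rule bij_betwI[where g="\<lambda>(a, b, c). \<chi> i. if i = 1 then a else if i = 2 then b else c"])
  qed (auto simp: vec_eq_iff forall_3)
  show ?thesis
    using summable_on_reindex_bij_betw[OF b, of "\<lambda>p. q (fst p) * (q (fst (snd p)) * q (snd (snd p)))"] s by simp
qed

text \<open>The exponential series gives \<open>x ^ j / fact j \<le> exp x\<close>; here
  \<open>x = t * (1 + r)\<close>. This is the smoothing estimate: the exponential weight beats every
  power of the frequency, with a constant that blows up as \<open>t\<close> tends to 0.\<close>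

lemma power_mult_exp_le:
  fixes r t :: real
  assumes "0 \<le> r" "0 < t"
  shows "(1 + r) ^ j * exp (- (t * r)) \<le> fact j * exp t / t ^ j"
proof -
  have "(t * (1 + r)) ^ j / fact j \<le> exp (t * (1 + r))"
  proof -
    have "(\<Sum>i\<in>{j}. (t * (1 + r)) ^ i /\<^sub>R fact i) \<le> (\<Sum>i. (t * (1 + r)) ^ i /\<^sub>R fact i)"
      using assms by (intro sum_le_suminf summable_exp_generic) auto
    then show ?thesis by (simp add: exp_def divide_inverse mult.commute)
  qed
  then have "(t * (1 + r)) ^ j \<le> fact j * exp (t * (1 + r))"
    by (simp add: divide_le_eq mult.commute)
  also have "exp (t * (1 + r)) = exp t * exp (t * r)" by (simp add: distrib_left exp_add)
  finally have "t ^ j * (1 + r) ^ j \<le> fact j * (exp t * exp (t * r))" by (simp only: power_mult_distrib)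
  then have "t ^ j * (1 + r) ^ j * exp (- (t * r)) \<le> fact j * (exp t * exp (t * r)) * exp (- (t * r))"
    by (rule mult_right_mono) simp
  also have "\<dots> = fact j * exp t" by (simp add: exp_minus)
  finally show ?thesis using assms by (simp add: le_divide_eq mult_ac)
qed

lemma cos_power_limit: "(\<lambda>N. cos (a / sqrt (real N)) ^ N) \<longlonglongrightarrow> exp (- (a\<^sup>2 / 2))" for a :: real
  unfolding power2_eq_square by real_asymp

context periodic_box
begin

text \<open>The power \<open>- 4\<close> is split into three powers \<open>- 4 / 3\<close>, each
  bounded by the factor of one coordinate, since a coordinate is at most the norm. It converges
  because 4 exceeds the dimension.\<close>

lemma lattice_summable: "(\<lambda>n. 1 / (1 + norm (freq n)) ^ 4) summable_on UNIV"
proof -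
  define \<kappa> where "\<kappa> = 2 * pi / L"
  have \<kappa>: "\<kappa> > 0" using L_pos by (simp add: \<kappa>_def)
  define q where "q j = (1 + \<kappa> * \<bar>of_int j\<bar>) powr (- 4 / 3)" for j :: int
  have s: "(\<lambda>n::int^3. q (n $ 1) * (q (n $ 2) * q (n $ 3))) summable_on UNIV"
    using summable_on_prod3[OF summable_on_int_powr[OF \<kappa>]] by (simp add: q_def)
  show ?thesis
  proof (rule summable_on_comparison_test[OF s])
    fix n
    define r where "r = 1 + norm (freq n)"
    have r: "r > 0" by (simp add: r_def add_pos_nonneg)
    have q: "r powr (- 4 / 3) \<le> q (n $ i)" for i
    proof -
      have "\<kappa> * \<bar>of_int (n $ i)\<bar> \<le> norm (freq n)"
        using component_le_norm_cart[of "freq n" i] L_pos by (simp add: freq_nth \<kappa>_def abs_mult)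
      then show ?thesis unfolding q_def r_def using \<kappa> by (intro powr_mono2') (auto simp: add_pos_nonneg)
    qed
    have "1 / r ^ 4 = r powr (- 4)" using r by (simp add: powr_minus_divide powr_realpow)
    also have "\<dots> = r powr (- 4 / 3) * (r powr (- 4 / 3) * r powr (- 4 / 3))" by (simp flip: powr_add)
    also have "\<dots> \<le> q (n $ 1) * (q (n $ 2) * q (n $ 3))"
      by (intro mult_mono q mult_nonneg_nonneg) (auto simp: q_def)
    finally show "1 / (1 + norm (freq n)) ^ 4 \<le> q (n $ 1) * (q (n $ 2) * q (n $ 3))" by (simp add: r_def)
  qed auto
qed

definition heat_mult :: "real \<Rightarrow> int^3 \<Rightarrow> real" where
  "heat_mult \<tau> n = exp (- (\<tau> * (norm (freq n))\<^sup>2))"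

lemma heat_mult_nonneg: "0 \<le> heat_mult \<tau> n" by (simp add: heat_mult_def)
lemma heat_mult_le_1: "0 \<le> \<tau> \<Longrightarrow> heat_mult \<tau> n \<le> 1" by (simp add: heat_mult_def)
lemma heat_mult_0 [simp]: "heat_mult 0 n = 1" by (simp add: heat_mult_def)

lemma heat_mult_bound:
  assumes "\<tau> > 0" shows "\<exists>C. \<forall>n. (1 + norm (freq n)) ^ j * heat_mult \<tau> n \<le> C"
proof (intro exI allI)
  fix n
  define r where "r = norm (freq n)"
  \<comment> \<open>The square bounds the Gaussian by an exponential in \<open>r\<close>, to which
    \<open>power_mult_exp_le\<close> applies at time \<open>2 * \<tau>\<close>.\<close>
  have "0 \<le> \<tau> * (r - 1)\<^sup>2" using assms by simp
  then have "- (\<tau> * r\<^sup>2) \<le> \<tau> - 2 * \<tau> * r" by (simp add: power2_eq_square algebra_simps)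
  then have "heat_mult \<tau> n \<le> exp (\<tau> - 2 * \<tau> * r)" by (simp add: heat_mult_def r_def)
  also have "\<dots> = exp \<tau> * exp (- (2 * \<tau> * r))" by (simp add: exp_add[symmetric])
  finally have "(1 + r) ^ j * heat_mult \<tau> n \<le> (1 + r) ^ j * (exp \<tau> * exp (- (2 * \<tau> * r)))"
    by (intro mult_left_mono) (simp_all add: r_def)
  also have "\<dots> = exp \<tau> * ((1 + r) ^ j * exp (- ((2 * \<tau>) * r)))" by simp
  also have "\<dots> \<le> exp \<tau> * (fact j * exp (2 * \<tau>) / (2 * \<tau>) ^ j)"
    using assms by (intro mult_left_mono power_mult_exp_le) (auto simp: r_def)
  finally show "(1 + norm (freq n)) ^ j * heat_mult \<tau> n \<le> exp \<tau> * (fact j * exp (2 * \<tau>) / (2 * \<tau>) ^ j)"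
    by (simp add: r_def)
qed

lemma weighted_heat_summable:
  assumes "\<tau> > 0" shows "(\<lambda>n. (1 + norm (freq n)) ^ j * heat_mult \<tau> n) summable_on UNIV"
proof -
  obtain C where C: "\<And>n. (1 + norm (freq n)) ^ (j + 4) * heat_mult \<tau> n \<le> C"
    using heat_mult_bound[OF assms] by blast
  show ?thesis
  proof (rule summable_on_comparison_test[OF summable_on_cmult_right[OF lattice_summable, of C]])
    fix n
    have p: "0 < (1 + norm (freq n)) ^ 4" by (rule zero_less_power) (simp add: add_pos_nonneg)
    have "(1 + norm (freq n)) ^ j * heat_mult \<tau> n * (1 + norm (freq n)) ^ 4 \<le> C"
      using C[of n] by (simp only: power_add mult_ac)
    then have "(1 + norm (freq n)) ^ j * heat_mult \<tau> n \<le> C / (1 + norm (freq n)) ^ 4"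
      by (simp only: pos_le_divide_eq[OF p])
    then show "(1 + norm (freq n)) ^ j * heat_mult \<tau> n \<le> C * (1 / (1 + norm (freq n)) ^ 4)" by simp
  qed (simp add: heat_mult_nonneg)
qed

lemma heat_summable: "\<tau> > 0 \<Longrightarrow> heat_mult \<tau> summable_on UNIV"
  using weighted_heat_summable[of \<tau> 0] by simp

text \<open>Multiplying the coefficients by \<open>cos (h * freq n $ i)\<close> replaces the
  function by the average of its translates by \<open>h\<close> and \<open>- h\<close> along axis
  \<open>i\<close>, which keeps a supremum bound.\<close>

lemma norm_series_cos_le:
  assumes c: "c abs_summable_on UNIV" and M: "\<And>x. norm (series c x) \<le> M"
  shows "norm (series (\<lambda>n. of_real (cos (h * freq n $ i) ^ N) * c n) x) \<le> M"
proof (induction N arbitrary: x)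
  case (Suc N)
  define d where "d n = of_real (cos (h * freq n $ i) ^ N) * c n" for n
  have "\<bar>cos (h * freq n $ i) ^ N\<bar> \<le> 1" for n by (simp add: power_abs power_le_one)
  then have d: "d abs_summable_on UNIV"
    by (intro abs_summable_on_le[OF c]) (simp add: d_def norm_mult mult_left_le_one_le del: of_real_power)
  have "series (\<lambda>n. of_real (cos (h * freq n $ i) ^ Suc N) * c n) x
      = (1/2) * (series d (x + h *\<^sub>R axis i 1) + series d (x + (- h) *\<^sub>R axis i 1))"
  proof -
    have "of_real (cos (h * freq n $ i) ^ Suc N) * c n * wave n x
        = (1/2) * (d n * wave n (x + h *\<^sub>R axis i 1) + d n * wave n (x + (- h) *\<^sub>R axis i 1))" for n
    proof -
      have "complex_of_real (cos a) = (1/2) * (cis a + cis (- a))" for a by (simp add: complex_eq_iff)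
      then have eq: "complex_of_real (cos (h * freq n $ i)) = (1/2) * (wave n (h *\<^sub>R axis i 1) + wave n ((- h) *\<^sub>R axis i 1))"
        by (simp only: wave_axis) simp
      show ?thesis
        unfolding wave_add d_def power_Suc of_real_mult eq by (simp only: algebra_simps)
    qed
    then have "series (\<lambda>n. of_real (cos (h * freq n $ i) ^ Suc N) * c n) x
        = (\<Sum>\<^sub>\<infinity>n. (1/2) * (d n * wave n (x + h *\<^sub>R axis i 1) + d n * wave n (x + (- h) *\<^sub>R axis i 1)))"
      unfolding series_def by (simp only:)
    also have "\<dots> = (1/2) * (\<Sum>\<^sub>\<infinity>n. d n * wave n (x + h *\<^sub>R axis i 1) + d n * wave n (x + (- h) *\<^sub>R axis i 1))"
      by (rule infsum_cmult_right')
    also have "(\<Sum>\<^sub>\<infinity>n. d n * wave n (x + h *\<^sub>R axis i 1) + d n * wave n (x + (- h) *\<^sub>R axis i 1))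
        = series d (x + h *\<^sub>R axis i 1) + series d (x + (- h) *\<^sub>R axis i 1)"
      unfolding series_def by (intro infsum_add series_summable d)
    finally show ?thesis .
  qed
  also have "norm \<dots> \<le> (1/2) * (M + M)"
    using norm_triangle_le[OF add_mono[OF Suc.IH[of "x + h *\<^sub>R axis i 1"] Suc.IH[of "x + (- h) *\<^sub>R axis i 1"]]]
    by (simp add: norm_mult d_def[abs_def])
  finally show ?case by simp
qed (simp add: M)

text \<open>The Gaussian is a product over the coordinates, so the three cosine multipliers are
  applied in succession with step \<open>sqrt (2 * \<tau> / N)\<close>. The limit in
  \<open>N\<close> is dominated by the coefficients themselves.\<close>

lemma norm_series_heat_le:
  assumes c: "c abs_summable_on UNIV" and M: "\<And>x. norm (series c x) \<le> M" and \<tau>: "\<tau> \<ge> 0"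
  shows "norm (series (\<lambda>n. of_real (heat_mult \<tau> n) * c n) x) \<le> M"
proof -
  define p where "p N i n = cos (sqrt (2 * \<tau>) / sqrt (real N) * freq n $ i) ^ N" for N i n
  have p1: "\<bar>p N i n\<bar> \<le> 1" for N i n by (simp add: p_def power_abs power_le_one)
  have step: "norm (series (\<lambda>n. of_real (p N i n) * d n) x) \<le> M \<and> (\<lambda>n. of_real (p N i n) * d n) abs_summable_on UNIV"
    if "d abs_summable_on UNIV" "\<And>x. norm (series d x) \<le> M" for d N i x
  proof
    show "norm (series (\<lambda>n. of_real (p N i n) * d n) x) \<le> M"
      unfolding p_def by (rule norm_series_cos_le[OF that])
    show "(\<lambda>n. of_real (p N i n) * d n) abs_summable_on UNIV"
      by (rule abs_summable_on_le[OF that(1)]) (simp add: norm_mult mult_left_le_one_le p1)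
  qed
  have "norm (series (\<lambda>n. of_real (p N 3 n) * (of_real (p N 2 n) * (of_real (p N 1 n) * c n))) x) \<le> M" for N
  proof -
    have 1: "norm (series (\<lambda>n. of_real (p N 1 n) * c n) x) \<le> M" for x
      using step[OF c M] by blast
    have 2: "(\<lambda>n. of_real (p N 1 n) * c n) abs_summable_on UNIV" using step[OF c M] by blast
    have 3: "norm (series (\<lambda>n. of_real (p N 2 n) * (of_real (p N 1 n) * c n)) x) \<le> M" for x
      using step[OF 2 1] by blast
    have 4: "(\<lambda>n. of_real (p N 2 n) * (of_real (p N 1 n) * c n)) abs_summable_on UNIV"
      using step[OF 2 1] by blast
    show ?thesis using step[OF 4 3] by blast
  qed
  moreover have "(\<lambda>N. series (\<lambda>n. of_real (p N 3 n) * (of_real (p N 2 n) * (of_real (p N 1 n) * c n))) x)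
     \<longlonglongrightarrow> series (\<lambda>n. of_real (heat_mult \<tau> n) * c n) x"
    unfolding series_def
  proof (rule tendsto_infsum_dominated[OF _ _ c])
    fix n
    have pl: "(\<lambda>N. p N i n) \<longlonglongrightarrow> exp (- (\<tau> * (freq n $ i)\<^sup>2))" for i
      using cos_power_limit[of "sqrt (2 * \<tau>) * freq n $ i"] \<tau> by (simp add: p_def power_mult_distrib)
    have h: "heat_mult \<tau> n = exp (- (\<tau> * (freq n $ 3)\<^sup>2)) * (exp (- (\<tau> * (freq n $ 2)\<^sup>2)) * exp (- (\<tau> * (freq n $ 1)\<^sup>2)))"
    proof -
      have "(norm (freq n))\<^sup>2 = (freq n $ 1)\<^sup>2 + (freq n $ 2)\<^sup>2 + (freq n $ 3)\<^sup>2"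
        by (simp add: norm_vec_def L2_set_def sum_nonneg sum_3)
      then show ?thesis by (simp add: heat_mult_def algebra_simps flip: exp_add)
    qed
    show "(\<lambda>N. of_real (p N 3 n) * (of_real (p N 2 n) * (of_real (p N 1 n) * c n)) * wave n x)
      \<longlonglongrightarrow> of_real (heat_mult \<tau> n) * c n * wave n x"
      unfolding h of_real_mult mult.assoc by (intro tendsto_intros pl)
    show "\<forall>\<^sub>F N in sequentially. \<forall>n. norm (of_real (p N 3 n) * (of_real (p N 2 n) * (of_real (p N 1 n) * c n)) * wave n x) \<le> norm (c n)"
    proof (intro always_eventually allI)
      fix N n
      have "\<bar>p N 3 n\<bar> * (\<bar>p N 2 n\<bar> * (\<bar>p N 1 n\<bar> * norm (c n))) \<le> 1 * (1 * (1 * norm (c n)))"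
        by (intro mult_mono p1) auto
      then show "norm (of_real (p N 3 n) * (of_real (p N 2 n) * (of_real (p N 1 n) * c n)) * wave n x) \<le> norm (c n)"
        by (simp add: norm_mult)
    qed
  qed
  ultimately show ?thesis by (intro LIMSEQ_le_const2[OF tendsto_norm]) auto
qed

lemma heat_cf_summable:
  assumes g: "continuous_periodic L g" and \<tau>: "\<tau> > 0"
  shows "(\<lambda>n. of_real (heat_mult \<tau> n) * cf g n) abs_summable_on UNIV"
proof -
  obtain M where "\<And>x. norm (g x) \<le> M" using continuous_periodic_bounded[OF g] by blast
  then have M: "norm (cf g n) \<le> M" for n using norm_cf_le[OF g] by blast
  show ?thesis
    by (rule abs_summable_on_le[OF summable_on_cmult_left[OF heat_summable[OF \<tau>], of M]])
      (use M in \<open>auto simp: norm_mult heat_mult_nonneg intro!: mult_left_mono\<close>)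
qed

text \<open>The contraction extends to continuous \<open>g\<close> with coefficients that need not
  be summable: a trigonometric polynomial within \<open>d\<close> of \<open>g\<close> has
  coefficients within \<open>d\<close> as well, and the heat factor makes this coefficient error
  summable.\<close>

lemma norm_heat_cf_le:
  assumes g: "continuous_periodic L g" and M: "\<And>x. norm (g x) \<le> M" and \<tau>: "\<tau> > 0"
  shows "norm (series (\<lambda>n. of_real (heat_mult \<tau> n) * cf g n) x) \<le> M"
proof (rule field_le_epsilon)
  fix e :: real assume e: "e > 0"
  define Z where "Z = (\<Sum>\<^sub>\<infinity>n. heat_mult \<tau> n)"
  have Z: "Z \<ge> 0" by (simp add: Z_def infsum_nonneg heat_mult_nonneg)
  \<comment> \<open>The approximation error enters once through the supremum, as \<open>d\<close>,
    and once through the coefficients, as \<open>Z * d\<close>; together they are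
    \<open>e\<close>.\<close>
  define d where "d = e / (1 + Z)"
  have d: "d > 0" using e Z by (simp add: d_def)
  obtain c where c: "c abs_summable_on UNIV" "\<And>x. norm (g x - series c x) \<le> d"
    using trig_poly_dense[OF g d] by metis
  have cf_close: "norm (cf g n - c n) \<le> d" for n
    using norm_cf_le[OF continuous_periodic_intros(2)[OF g continuous_periodic_series[OF c(1)]] c(2), of n]
    by (simp add: cf_diff[OF g continuous_periodic_series[OF c(1)]] cf_series[OF c(1)])
  have hc: "(\<lambda>n. of_real (heat_mult \<tau> n) * c n) abs_summable_on UNIV"
    by (rule abs_summable_on_le[OF c(1)]) (use \<tau> in \<open>simp add: norm_mult heat_mult_nonneg heat_mult_le_1 mult_left_le_one_le\<close>)
  have diff: "(\<lambda>n. of_real (heat_mult \<tau> n) * (cf g n - c n)) abs_summable_on UNIV"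
    "norm (series (\<lambda>n. of_real (heat_mult \<tau> n) * (cf g n - c n)) x) \<le> Z * d"
  proof -
    have b: "norm (of_real (heat_mult \<tau> n) * (cf g n - c n)) \<le> heat_mult \<tau> n * d" for n
      using cf_close[of n] by (auto simp: norm_mult heat_mult_nonneg intro!: mult_left_mono)
    have s: "(\<lambda>n. heat_mult \<tau> n * d) summable_on UNIV" by (rule summable_on_cmult_left[OF heat_summable[OF \<tau>]])
    show 1: "(\<lambda>n. of_real (heat_mult \<tau> n) * (cf g n - c n)) abs_summable_on UNIV"
      by (rule abs_summable_on_le[OF s b])
    have "norm (series (\<lambda>n. of_real (heat_mult \<tau> n) * (cf g n - c n)) x) \<le> (\<Sum>\<^sub>\<infinity>n. heat_mult \<tau> n * d)"
      unfolding series_def by (rule norm_infsum_le_infsum[OF s]) (use b in \<open>simp add: norm_mult\<close>)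
    then show "norm (series (\<lambda>n. of_real (heat_mult \<tau> n) * (cf g n - c n)) x) \<le> Z * d"
      by (simp add: Z_def infsum_cmult_left')
  qed
  have "series (\<lambda>n. of_real (heat_mult \<tau> n) * cf g n) x
      = series (\<lambda>n. of_real (heat_mult \<tau> n) * (cf g n - c n) + of_real (heat_mult \<tau> n) * c n) x"
    by (simp add: algebra_simps)
  also have "\<dots> = series (\<lambda>n. of_real (heat_mult \<tau> n) * (cf g n - c n)) x + series (\<lambda>n. of_real (heat_mult \<tau> n) * c n) x"
    by (rule series_add[OF diff(1) hc])
  also have "norm \<dots> \<le> Z * d + (M + d)"
  proof (rule norm_triangle_le[OF add_mono[OF diff(2)]])
    have "norm (series c x) \<le> M + d" for x
      using M[of x] c(2)[of x] norm_triangle_ineq2[of "series c x" "g x"] by (simp add: norm_minus_commute)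
    then show "norm (series (\<lambda>n. of_real (heat_mult \<tau> n) * c n) x) \<le> M + d"
      using \<tau> by (intro norm_series_heat_le[OF c(1)]) auto
  qed
  also have "\<dots> = M + d * (1 + Z)" by (simp add: algebra_simps)
  also have "d * (1 + Z) = e" using Z by (simp add: d_def)
  finally show "norm (series (\<lambda>n. of_real (heat_mult \<tau> n) * cf g n) x) \<le> M + e" .
qed

text \<open>For a trigonometric polynomial the convergence is that of a dominated sum. The
  contraction property keeps the difference between \<open>g\<close> and the polynomial small at all
  positive times, so three terms of size at most \<open>e / 4\<close> remain.\<close>

theorem heat_approximation:
  assumes g: "continuous_periodic L g" and e: "e > 0"
  obtains d where "d > 0"
    "\<And>\<tau> x. 0 < \<tau> \<Longrightarrow> \<tau> < d \<Longrightarrow> norm (series (\<lambda>n. of_real (heat_mult \<tau> n) * cf g n) x - g x) < e"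
proof -
  obtain c where c: "finite {n. c n \<noteq> 0}" "c abs_summable_on UNIV" "\<And>x. norm (g x - series c x) \<le> e / 4"
    using trig_poly_dense[OF g, of "e / 4"] e by auto
  have hs: "(\<lambda>n. of_real (heat_mult \<tau> n) * c n) abs_summable_on UNIV" if "\<tau> \<ge> 0" for \<tau>
    by (rule abs_summable_on_le[OF c(2)]) (use that in \<open>simp add: norm_mult heat_mult_nonneg heat_mult_le_1 mult_left_le_one_le\<close>)
  have "((\<lambda>\<tau>. \<Sum>\<^sub>\<infinity>n. (1 - heat_mult \<tau> n) * norm (c n)) \<longlongrightarrow> (\<Sum>\<^sub>\<infinity>n::int^3. 0)) (at_right 0)"
  proof (rule tendsto_infsum_dominated[OF _ _ c(2)])
    fix n
    have "((\<lambda>\<tau>. heat_mult \<tau> n) \<longlongrightarrow> heat_mult 0 n) (at_right 0)"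
      unfolding heat_mult_def by (intro tendsto_intros)
    then have "((\<lambda>\<tau>. (1 - heat_mult \<tau> n) * norm (c n)) \<longlongrightarrow> (1 - heat_mult 0 n) * norm (c n)) (at_right 0)"
      by (intro tendsto_intros)
    then show "((\<lambda>\<tau>. (1 - heat_mult \<tau> n) * norm (c n)) \<longlongrightarrow> 0) (at_right 0)" by simp
    show "\<forall>\<^sub>F \<tau> in at_right 0. \<forall>n. norm ((1 - heat_mult \<tau> n) * norm (c n)) \<le> norm (c n)"
      unfolding eventually_at_right_field
      by (rule exI[of _ 1]) (auto simp: abs_mult heat_mult_le_1 heat_mult_nonneg intro!: mult_left_le_one_le)
  qed
  then have "\<forall>\<^sub>F \<tau> in at_right 0. dist (\<Sum>\<^sub>\<infinity>n. (1 - heat_mult \<tau> n) * norm (c n)) 0 < e / 4"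
    using e by (intro tendstoD) auto
  then obtain d where d: "d > 0" "\<And>\<tau>. 0 < \<tau> \<Longrightarrow> \<tau> < d \<Longrightarrow> \<bar>\<Sum>\<^sub>\<infinity>n. (1 - heat_mult \<tau> n) * norm (c n)\<bar> < e / 4"
    unfolding eventually_at_right_field by (auto simp: dist_real_def)
  have "norm (series (\<lambda>n. of_real (heat_mult \<tau> n) * cf g n) x - g x) < e" if \<tau>: "0 < \<tau>" "\<tau> < d" for \<tau> x
  proof -
    define \<phi> where "\<phi> x = g x - series c x" for x
    have cp: "continuous_periodic L \<phi>"
      unfolding \<phi>_def by (intro continuous_periodic_intros g continuous_periodic_series c)
    have cf\<phi>: "cf \<phi> n = cf g n - c n" for n
      unfolding \<phi>_def by (simp add: cf_diff[OF g continuous_periodic_series[OF c(2)]] cf_series[OF c(2)])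
    have 1: "norm (series (\<lambda>n. of_real (heat_mult \<tau> n) * cf \<phi> n) x) \<le> e / 4"
      by (rule norm_heat_cf_le[OF cp _ \<tau>(1)]) (unfold \<phi>_def, rule c(3))
    have eq: "series (\<lambda>n. of_real (heat_mult \<tau> n) * cf g n) x
       = series (\<lambda>n. of_real (heat_mult \<tau> n) * cf \<phi> n) x + series (\<lambda>n. of_real (heat_mult \<tau> n) * c n) x"
      using series_add[OF heat_cf_summable[OF cp \<tau>(1)] hs[of \<tau>], of x] \<tau> by (simp add: cf\<phi> algebra_simps)
    have 2: "norm (series c x - series (\<lambda>n. of_real (heat_mult \<tau> n) * c n) x) \<le> (\<Sum>\<^sub>\<infinity>n. (1 - heat_mult \<tau> n) * norm (c n))"
    proof -
      have "series c x - series (\<lambda>n. of_real (heat_mult \<tau> n) * c n) x = series (\<lambda>n. c n - of_real (heat_mult \<tau> n) * c n) x"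
        using series_diff[OF c(2) hs[of \<tau>]] \<tau> by simp
      also have "norm \<dots> \<le> (\<Sum>\<^sub>\<infinity>n. (1 - heat_mult \<tau> n) * norm (c n))"
        unfolding series_def
      proof (rule norm_infsum_le_infsum)
        show "(\<lambda>n. (1 - heat_mult \<tau> n) * norm (c n)) summable_on UNIV"
          by (rule summable_on_comparison_test[OF c(2)])
            (use \<tau> in \<open>auto simp: heat_mult_le_1 heat_mult_nonneg intro!: mult_left_le_one_le\<close>)
        show "norm ((c n - of_real (heat_mult \<tau> n) * c n) * wave n x) \<le> (1 - heat_mult \<tau> n) * norm (c n)" for n
        proof -
          have "c n - of_real (heat_mult \<tau> n) * c n = of_real (1 - heat_mult \<tau> n) * c n" by (simp add: algebra_simps)
          then show ?thesis using heat_mult_le_1[of \<tau> n] \<tau> by (simp add: norm_mult del: of_real_diff)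
        qed
      qed
      finally show ?thesis .
    qed
    have "norm (series (\<lambda>n. of_real (heat_mult \<tau> n) * cf g n) x - g x)
       \<le> norm (series (\<lambda>n. of_real (heat_mult \<tau> n) * cf \<phi> n) x)
        + norm (series c x - series (\<lambda>n. of_real (heat_mult \<tau> n) * c n) x) + norm (g x - series c x)"
      unfolding eq by norm
    then show ?thesis using 1 2 d(2)[OF \<tau>] c(3)[of x] e by linarith
  qed
  then show ?thesis using d that by blast
qed

text \<open>Fourier inversion by heat summation: as the time tends to 0 the damped series tends to
  the undamped one by dominated convergence, and to \<open>g\<close> by
  \<open>heat_approximation\<close>.\<close>

theorem series_cf:
  assumes g: "continuous_periodic L g" and c: "cf g abs_summable_on UNIV"
  shows "series (cf g) = g"
proof
  fix x
  have "((\<lambda>\<tau>. series (\<lambda>n. of_real (heat_mult \<tau> n) * cf g n) x) \<longlongrightarrow> series (cf g) x) (at_right 0)"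
    unfolding series_def
  proof (rule tendsto_infsum_dominated[OF _ _ c])
    fix n
    have "((\<lambda>\<tau>. heat_mult \<tau> n) \<longlongrightarrow> heat_mult 0 n) (at_right 0)"
      unfolding heat_mult_def by (intro tendsto_intros)
    then have "((\<lambda>\<tau>. of_real (heat_mult \<tau> n) * cf g n * wave n x) \<longlongrightarrow> of_real (heat_mult 0 n) * cf g n * wave n x) (at_right 0)"
      by (intro tendsto_intros)
    then show "((\<lambda>\<tau>. of_real (heat_mult \<tau> n) * cf g n * wave n x) \<longlongrightarrow> cf g n * wave n x) (at_right 0)" by simp
    show "\<forall>\<^sub>F \<tau> in at_right 0. \<forall>n. norm (of_real (heat_mult \<tau> n) * cf g n * wave n x) \<le> norm (cf g n)"
      unfolding eventually_at_right_field
      by (rule exI[of _ 1]) (auto simp: norm_mult heat_mult_le_1 heat_mult_nonneg intro!: mult_left_le_one_le)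
  qed
  moreover have "((\<lambda>\<tau>. series (\<lambda>n. of_real (heat_mult \<tau> n) * cf g n) x) \<longlongrightarrow> g x) (at_right 0)"
  proof (rule tendstoI)
    fix e :: real assume "e > 0"
    then obtain d where "d > 0" "\<And>\<tau> x. 0 < \<tau> \<Longrightarrow> \<tau> < d \<Longrightarrow> norm (series (\<lambda>n. of_real (heat_mult \<tau> n) * cf g n) x - g x) < e"
      using heat_approximation[OF g] by metis
    then show "\<forall>\<^sub>F \<tau> in at_right 0. dist (series (\<lambda>n. of_real (heat_mult \<tau> n) * cf g n) x) (g x) < e"
      unfolding eventually_at_right_field dist_norm by blast
  qed
  ultimately show "series (cf g) x = g x"
    by (rule tendsto_unique[rotated]) simp
qed

end

section \<open>The projected equation on the Fourier side\<close>

text \<open>Bilinear, without conjugation: up to the factor \<open>\<i>\<close> it is the symbol of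
  the divergence.\<close>

definition cdot :: "real^3 \<Rightarrow> complex^3 \<Rightarrow> complex" where
  "cdot \<xi> v = (\<Sum>i\<in>UNIV. of_real (\<xi> $ i) * v $ i)"

lemma norm_vec_scale: "norm (c *s v) = norm c * norm (v :: complex^3)"
  by (simp add: norm_vec_def norm_mult L2_set_def power_mult_distrib real_sqrt_mult flip: sum_distrib_left)

lemma norm_cdot_le: "norm (cdot \<xi> v) \<le> norm \<xi> * norm v"
proof -
  have "norm (cdot \<xi> v) \<le> (\<Sum>i\<in>UNIV. \<bar>\<xi> $ i\<bar> * \<bar>norm (v $ i)\<bar>)"
    unfolding cdot_def by (rule order_trans[OF norm_sum]) (simp add: norm_mult)
  also have "\<dots> \<le> L2_set (\<lambda>i. \<xi> $ i) UNIV * L2_set (\<lambda>i. norm (v $ i)) UNIV"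
    by (rule L2_set_mult_ineq)
  finally show ?thesis by (simp add: norm_vec_def L2_set_def)
qed

lemma cdot_add: "cdot \<xi> (v + w) = cdot \<xi> v + cdot \<xi> w"
  by (simp add: cdot_def distrib_left sum.distrib)

lemma cdot_scaleR: "cdot \<xi> (r *\<^sub>R v) = r *\<^sub>R cdot \<xi> v"
  by (simp add: cdot_def scaleR_sum_right)

lemma cdot_add_left: "cdot (\<xi> + \<eta>) v = cdot \<xi> v + cdot \<eta> v"
  by (simp add: cdot_def distrib_right sum.distrib)

lemma bounded_linear_cdot: "bounded_linear (cdot \<xi>)"
  by (rule bounded_linear_intro[where K="norm \<xi>"])
    (auto simp: cdot_add cdot_scaleR mult.commute[of _ "norm \<xi>"] intro: norm_cdot_le)

text \<open>The symbol of \<open>(v, w) \<mapsto> P (v \<sqdot> \<nabla>) w\<close> for divergence free \<open>v\<close>, where \<open>P\<close> is the Leray projection.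
  At frequency zero the division by zero is harmless, since the first factor vanishes.\<close>

definition leray_symbol :: "real^3 \<Rightarrow> complex^3 \<Rightarrow> complex^3 \<Rightarrow> complex^3" where
  "leray_symbol \<xi> v w = (\<i> * cdot \<xi> v) *s (w - (cdot \<xi> w / of_real ((norm \<xi>)\<^sup>2)) *s (\<chi> j. of_real (\<xi> $ j)))"

lemma leray_symbol_nth: "leray_symbol \<xi> v w $ j
    = \<i> * cdot \<xi> v * w $ j - of_real (\<xi> $ j) * (\<i> * cdot \<xi> v * cdot \<xi> w) / of_real ((norm \<xi>)\<^sup>2)"
  by (simp add: leray_symbol_def algebra_simps)

lemma norm_leray_symbol_le: "norm (leray_symbol \<xi> v w) \<le> 2 * norm \<xi> * norm v * norm w"
proof (cases "\<xi> = 0")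
  case True
  then show ?thesis by (simp add: leray_symbol_def cdot_def norm_vec_scale)
next
  case False
  have nx: "norm (\<chi> j. complex_of_real (\<xi> $ j)) = norm \<xi>" by (simp add: norm_vec_def)
  have "norm (w - (cdot \<xi> w / of_real ((norm \<xi>)\<^sup>2)) *s (\<chi> j. of_real (\<xi> $ j)))
      \<le> norm w + norm (cdot \<xi> w) / (norm \<xi>)\<^sup>2 * norm \<xi>"
    by (rule order_trans[OF norm_triangle_ineq4]) (simp add: norm_vec_scale nx norm_divide norm_power)
  also have "norm (cdot \<xi> w) / (norm \<xi>)\<^sup>2 * norm \<xi> \<le> (norm \<xi> * norm w) / (norm \<xi>)\<^sup>2 * norm \<xi>"
    by (intro mult_right_mono divide_right_mono norm_cdot_le) auto
  also have "\<dots> = norm w" using False by (simp add: power2_eq_square)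
  finally have "norm (leray_symbol \<xi> v w) \<le> (norm \<xi> * norm v) * (2 * norm w)"
    unfolding leray_symbol_def norm_vec_scale
    by (intro mult_mono) (auto simp: norm_mult norm_cdot_le)
  then show ?thesis by (simp add: mult_ac)
qed

lemma bounded_bilinear_leray_symbol: "bounded_bilinear (leray_symbol \<xi>)"
proof
  show "\<exists>K. \<forall>v w. norm (leray_symbol \<xi> v w) \<le> norm v * norm w * K"
    using norm_leray_symbol_le[of \<xi>] by (intro exI[of _ "2 * norm \<xi>"]) (simp add: mult_ac)
qed (auto simp: vec_eq_iff leray_symbol_nth cdot_add cdot_scaleR scaleR_conv_of_real[where 'a=complex]
    add_divide_distrib diff_divide_distrib algebra_simps)

lemma cdot_leray_symbol: "cdot \<xi> (leray_symbol \<xi> v w) = 0"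
proof (cases "\<xi> = 0")
  case False
  have "(\<Sum>j\<in>UNIV. of_real (\<xi> $ j) * complex_of_real (\<xi> $ j)) = of_real ((norm \<xi>)\<^sup>2)"
    by (simp add: norm_vec_def L2_set_def sum_nonneg power2_eq_square)
  then have "cdot \<xi> (\<chi> j. of_real (\<xi> $ j)) = of_real ((norm \<xi>)\<^sup>2)" by (simp add: cdot_def)
  moreover have "cdot \<xi> (c *s z - d *s y) = c * cdot \<xi> z - d * cdot \<xi> y" for c d z y
    by (simp add: cdot_def right_diff_distrib sum_subtractf sum_distrib_left mult_ac)
  from this[of 1] have "cdot \<xi> (z - d *s y) = cdot \<xi> z - d * cdot \<xi> y" for d z y by simp
  moreover have "cdot \<xi> (c *s z) = c * cdot \<xi> z" for c z
    by (simp add: cdot_def sum_distrib_left mult_ac)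
  ultimately show ?thesis using False by (simp add: leray_symbol_def)
qed (simp add: cdot_def)

definition cnj_vec :: "complex^3 \<Rightarrow> complex^3" where "cnj_vec v = (\<chi> j. cnj (v $ j))"

lemma bounded_linear_cnj_vec: "bounded_linear cnj_vec"
  by (rule bounded_linear_intro[where K=1]) (auto simp: cnj_vec_def vec_eq_iff norm_vec_def scaleR_conv_of_real[where 'a=complex])

text \<open>The sign from the reflected frequency and the sign from conjugating \<open>\<i>\<close>
  cancel. This is the compatibility that \<open>solution_involution\<close> requires for
  conjugation.\<close>

lemma leray_symbol_cnj: "leray_symbol (- \<xi>) (cnj_vec v) (cnj_vec w) = cnj_vec (leray_symbol \<xi> v w)"
proof -
  have c: "cdot (- \<xi>) (cnj_vec v) = - cnj (cdot \<xi> v)" for v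
    by (simp add: cdot_def cnj_vec_def sum_negf)
  show ?thesis
    by (simp add: vec_eq_iff leray_symbol_nth c) (simp add: cnj_vec_def leray_symbol_nth)
qed

context periodic_box
begin

lemma series_real:
  assumes "\<And>n. c (- n) = cnj (c n)" shows "cnj (series c x) = series c x"
proof -
  have "cnj (series c x) = (\<Sum>\<^sub>\<infinity>n. c (- n) * wave (- n) x)"
    by (simp add: series_def cnj_wave assms flip: infsum_cnj)
  also have "\<dots> = series c x"
    unfolding series_def by (rule infsum_reindex_bij_betw) (rule bij_uminus)
  finally show ?thesis .
qed

lemma series_has_vector_derivative:
  assumes X: "convex X" "t \<in> X"
    and d: "\<And>n s. s \<in> X \<Longrightarrow> ((\<lambda>s. c s n) has_vector_derivative c' s n) (at s within X)"
    and b: "\<And>n s. s \<in> X \<Longrightarrow> norm (c' s n) \<le> M n" and M: "M summable_on UNIV"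
    and s: "\<And>s. s \<in> X \<Longrightarrow> c s abs_summable_on UNIV"
  shows "((\<lambda>s. series (c s) x) has_vector_derivative series (c' t) x) (at t within X)"
proof -
  have M0: "0 \<le> M n" for n using b[OF X(2), of n] norm_ge_zero order_trans by blast
  have "((\<lambda>s. \<Sum>\<^sub>\<infinity>n. c s n * wave n x) has_derivative (\<lambda>h. \<Sum>\<^sub>\<infinity>n. h *\<^sub>R (c' t n * wave n x))) (at t within X)"
  proof (rule has_derivative_infsum[OF X _ _ M M0])
    show "((\<lambda>s. c s n * wave n x) has_derivative (\<lambda>h. h *\<^sub>R (c' y n * wave n x))) (at y within X)" if "y \<in> X" for n y
      using has_vector_derivative_mult_left[OF d[OF that], of n "wave n x"] by (simp add: has_vector_derivative_def)
    show "norm (h *\<^sub>R (c' y n * wave n x)) \<le> M n * norm h" if "y \<in> X" for n y h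
      using b[OF that, of n] by (simp add: norm_mult mult.commute mult_left_mono)
    show "(\<lambda>n. c y n * wave n x) summable_on UNIV" if "y \<in> X" for y
      by (rule series_summable[OF s[OF that]])
  qed
  then show ?thesis by (simp add: has_vector_derivative_def series_def infsum_scaleR_right)
qed

lemma deriv_coeff_twice_sum:
  "(\<Sum>i\<in>UNIV. deriv_coeff i (deriv_coeff i c) n) = - of_real ((norm (freq n))\<^sup>2) * c n"
proof -
  have "(\<Sum>i\<in>UNIV. complex_of_real (freq n $ i) * of_real (freq n $ i)) = of_real ((norm (freq n))\<^sup>2)"
    by (simp add: norm_vec_def L2_set_def sum_nonneg power2_eq_square)
  moreover have "(\<Sum>i\<in>UNIV. deriv_coeff i (deriv_coeff i c) n)
      = - (\<Sum>i\<in>UNIV. complex_of_real (freq n $ i) * of_real (freq n $ i)) * c n"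
    by (simp add: deriv_coeff_def sum_distrib_left sum_negf mult_ac)
  ultimately show ?thesis by simp
qed

definition coeff :: "(real^3 \<Rightarrow> real^3) \<Rightarrow> int^3 \<Rightarrow> complex^3" where
  "coeff v n = (\<chi> j. cf (\<lambda>x. of_real (v x $ j)) n)"

end

locale navier_stokes_data = periodic_box L for L +
  fixes u0 :: "real^3 \<Rightarrow> real^3" and \<nu> T :: real
  assumes \<nu>_positive: "0 < \<nu>" and T_positive: "0 < T" and T_upper: "T \<le> 2 * \<nu>"
    and u0_periodic: "spatially_periodic L u0" and u0_C2: "C_class 2 u0"
    and u0_div: "\<And>x. divergence u0 x = 0"
    and coeff_summable: "coeff u0 abs_summable_on UNIV"
    and T_smallness: "72 * sqrt (2 * T / \<nu>) * (\<Sum>\<^sub>\<infinity>n. norm (coeff u0 n)) \<le> 1"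
begin

sublocale quadratic_convolution_system "\<lambda>n. norm (freq n)" "\<lambda>n. leray_symbol (freq n)" "coeff u0" \<nu> T
  by (rule quadratic_convolution_system.intro)
    (auto intro: \<nu>_positive T_positive norm_freq_triangle bounded_bilinear_leray_symbol norm_leray_symbol_le
      coeff_summable T_upper T_smallness)

lemma heat_eq: "heat t n = heat_mult (\<nu> * t) n" by (simp add: heat_def heat_mult_def)

definition U0 :: "3 \<Rightarrow> real^3 \<Rightarrow> complex" where "U0 j x = of_real (u0 x $ j)"

lemma bounded_linear_component: "bounded_linear (\<lambda>v :: real^3. complex_of_real (v $ j))"
  by (rule bounded_linear_compose[OF bounded_linear_of_real bounded_linear_vec_nth])

lemma U0_C2: "C_class 2 (U0 j)"
  using C_class_bounded_linear[OF bounded_linear_component u0_C2] by (simp add: U0_def[abs_def])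

lemma U0_periodic: "spatially_periodic L (U0 j)"
  using u0_periodic by (simp add: U0_def spatially_periodic_def)

lemma U0_differentiable: "U0 j differentiable (at x)" "partial_deriv i (U0 j) differentiable (at x)"
  using U0_C2[of j] by (simp_all add: numeral_2_eq_2)

lemma u0_differentiable: "u0 differentiable (at x)" "partial_deriv i u0 differentiable (at x)"
  using u0_C2 by (simp_all add: numeral_2_eq_2)

lemma U0_continuous_periodic: "continuous_periodic L (U0 j)" "continuous_periodic L (partial_deriv i (U0 j))"
    "continuous_periodic L (partial_deriv l (partial_deriv i (U0 j)))"
  using C_class_continuous[OF U0_C2[of j]] U0_C2[of j] U0_periodic
    spatially_periodic_partial_deriv[OF spatially_periodic_partial_deriv[OF U0_periodic]]
    spatially_periodic_partial_deriv[OF U0_periodic] C_class_continuous[of "Suc 0" "partial_deriv i (U0 j)"]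
  by (auto simp: continuous_periodic_def numeral_2_eq_2)

lemma partial_deriv_U0: "partial_deriv i (U0 j) = (\<lambda>x. of_real (partial_deriv i u0 x $ j))"
  using partial_deriv_bounded_linear[OF bounded_linear_component u0_differentiable(1)]
  by (simp add: U0_def[abs_def] fun_eq_iff)

lemma cf_U0: "cf (U0 j) n = coeff u0 n $ j" by (simp add: coeff_def U0_def[abs_def])

lemma cf_partial_U0: "cf (partial_deriv i (U0 j)) = deriv_coeff i (cf (U0 j))"
  using cf_partial_deriv[OF U0_periodic U0_differentiable(1), of i j] U0_continuous_periodic(2)[of i j]
  by (simp add: fun_eq_iff deriv_coeff_def continuous_periodic_def)

lemma cf_partial2_U0: "cf (partial_deriv l (partial_deriv i (U0 j))) = deriv_coeff l (deriv_coeff i (cf (U0 j)))"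
  using cf_partial_deriv[OF spatially_periodic_partial_deriv[OF U0_periodic] U0_differentiable(2), of l i j]
    U0_continuous_periodic(3)[of l i j]
  by (simp add: fun_eq_iff deriv_coeff_def continuous_periodic_def cf_partial_U0)

lemma coeff_div_free: "cdot (freq n) (coeff u0 n) = 0"
proof -
  have "(\<Sum>i\<in>UNIV. partial_deriv i (U0 i) x) = 0" for x
    using u0_div[of x] by (simp add: divergence_def partial_deriv_U0 flip: of_real_sum)
  then have "cf (\<lambda>x. \<Sum>i\<in>UNIV. partial_deriv i (U0 i) x) n = 0" by (simp add: cf_def mean_const)
  then have "(\<Sum>i\<in>UNIV. deriv_coeff i (cf (U0 i)) n) = 0"
    by (simp add: cf_sum U0_continuous_periodic cf_partial_U0)
  then have "\<i> * cdot (freq n) (coeff u0 n) = 0"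
    by (simp add: deriv_coeff_def cdot_def cf_U0 sum_distrib_left mult.assoc)
  then show ?thesis by simp
qed

lemma coeff_real: "coeff u0 (- n) = cnj_vec (coeff u0 n)"
proof -
  have "cf (U0 j) (- n) = cnj (cf (U0 j) n)" for j
    using cf_cnj[OF U0_continuous_periodic(1), of j "- n"] by (simp add: U0_def[abs_def])
  then show ?thesis by (simp add: vec_eq_iff cnj_vec_def cf_U0[symmetric])
qed

section \<open>The velocity as a Fourier series\<close>

definition vc :: "3 \<Rightarrow> real \<Rightarrow> int^3 \<Rightarrow> complex" where "vc j t n = solution t n $ j"

lemma vc_0: "vc j 0 = cf (U0 j)" by (simp add: vc_def fun_eq_iff solution_0 cf_U0)

lemma norm_vc_le: "norm (vc j t n) \<le> norm (solution t n)"
  unfolding vc_def by (rule Finite_Cartesian_Product.norm_nth_le)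

lemma vc_bound: "t \<in> {0..T} \<Longrightarrow> norm (vc j t n) \<le> exp (- (t * norm (freq n))) * majorant_lim n"
  using norm_vc_le solution_bound order_trans by blast

lemma vc_bound0: "t \<in> {0..T} \<Longrightarrow> norm (vc j t n) \<le> majorant_lim n"
  using vc_bound[of t j n] mult_right_mono[of "exp (- (t * norm (freq n)))" 1 "majorant_lim n"] majorant_lim_nonneg[of n]
  by fastforce

lemma vc_abs_summable: "t \<in> {0..T} \<Longrightarrow> vc j t abs_summable_on UNIV"
  by (rule abs_summable_on_le[OF majorant_lim_summable]) (rule vc_bound0)

text \<open>At positive times the exponential weight beats the \<open>k\<close>-th power of the
  frequency, so the series may be differentiated termwise any number of times.\<close>

lemma vc_weighted_summable:
  assumes t: "0 < t" "t \<le> T" shows "weighted_summable k (vc j t)"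
  unfolding weighted_summable_def
proof (rule summable_on_comparison_test)
  show "(\<lambda>n. fact k * exp t / t ^ k * majorant_lim n) summable_on UNIV"
    by (rule summable_on_cmult_right[OF majorant_lim_summable])
  fix n
  have "(1 + norm (freq n)) ^ k * norm (vc j t n) \<le> (1 + norm (freq n)) ^ k * (exp (- (t * norm (freq n))) * majorant_lim n)"
    using t by (intro mult_left_mono vc_bound) auto
  also have "\<dots> = ((1 + norm (freq n)) ^ k * exp (- (t * norm (freq n)))) * majorant_lim n" by simp
  also have "\<dots> \<le> fact k * exp t / t ^ k * majorant_lim n"
    using t by (intro mult_right_mono power_mult_exp_le majorant_lim_nonneg) auto
  finally show "(1 + norm (freq n)) ^ k * norm (vc j t n) \<le> fact k * exp t / t ^ k * majorant_lim n" .
qed auto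

lemma vc_real: "t \<in> {0..T} \<Longrightarrow> vc j t (- n) = cnj (vc j t n)"
  using solution_involution[OF bounded_linear_cnj_vec, where t=t and n=n]
  by (simp add: vc_def freq_uminus leray_symbol_cnj coeff_real) (simp add: cnj_vec_def)

lemma vc_div_free: "t \<in> {0..T} \<Longrightarrow> (\<Sum>i\<in>UNIV. of_real (freq n $ i) * vc i t n) = 0"
  using solution_annihilated[OF bounded_linear_cdot[of "freq n"], where n=n and t=t]
  by (simp add: cdot_leray_symbol coeff_div_free) (simp add: cdot_def vc_def)

definition vel :: "3 \<Rightarrow> real \<Rightarrow> real^3 \<Rightarrow> complex" where "vel j t = series (vc j t)"

text \<open>Fourier inversion for the datum; the summability it needs is that of the coefficients at
  time 0.\<close>

lemma vel_0: "vel j 0 = U0 j"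
  unfolding vel_def vc_0
  using vc_abs_summable[of 0 j] T_positive by (intro series_cf U0_continuous_periodic) (simp add: vc_0)

lemma vel_real: "t \<in> {0..T} \<Longrightarrow> cnj (vel j t x) = vel j t x"
  unfolding vel_def by (rule series_real) (rule vc_real)

lemma vel_continuous_periodic: "t \<in> {0..T} \<Longrightarrow> continuous_periodic L (vel j t)"
  unfolding vel_def by (rule continuous_periodic_series[OF vc_abs_summable])

lemma vel_C_class: "0 < t \<Longrightarrow> t \<le> T \<Longrightarrow> C_class k (vel j t)"
  unfolding vel_def by (rule C_class_series[OF vc_weighted_summable])

text \<open>For \<open>t > 0\<close> the regularity comes from the series, at \<open>t = 0\<close>
  from the datum itself, since the second derivatives there need not have absolutely convergent
  Fourier series.\<close>

lemma vel_C2: "t \<in> {0..T} \<Longrightarrow> C_class 2 (vel j t)"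
  using vel_C_class[of t 2 j] vel_0[of j] U0_C2[of j] by (cases "t = 0") auto

lemma vel_periodic: "t \<in> {0..T} \<Longrightarrow> spatially_periodic L (vel j t)"
  using vel_continuous_periodic by (simp add: continuous_periodic_def)

lemma vel_differentiable:
  assumes "t \<in> {0..T}" shows "vel j t differentiable (at x)" "partial_deriv i (vel j t) differentiable (at x)"
  using vel_C2[OF assms, of j] by (simp_all add: numeral_2_eq_2)

lemma vel_deriv_continuous_periodic:
  assumes "t \<in> {0..T}"
  shows "continuous_periodic L (partial_deriv i (vel j t))"
    "continuous_periodic L (partial_deriv l (partial_deriv i (vel j t)))"
  using vel_C2[OF assms, of j] vel_periodic[OF assms]
    spatially_periodic_partial_deriv[OF spatially_periodic_partial_deriv[OF vel_periodic[OF assms]]]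
    spatially_periodic_partial_deriv[OF vel_periodic[OF assms]] C_class_continuous[of "Suc 0" "partial_deriv i (vel j t)"]
  by (auto simp: continuous_periodic_def numeral_2_eq_2)

lemma partial_vel: "0 < t \<Longrightarrow> t \<le> T \<Longrightarrow> partial_deriv i (vel j t) = series (deriv_coeff i (vc j t))"
  unfolding vel_def by (rule partial_deriv_series[OF vc_weighted_summable])

lemma partial2_vel: "0 < t \<Longrightarrow> t \<le> T \<Longrightarrow>
    partial_deriv l (partial_deriv i (vel j t)) = series (deriv_coeff l (deriv_coeff i (vc j t)))"
  using partial_deriv_series[OF weighted_summable_deriv[OF vc_weighted_summable]] by (simp add: partial_vel)

lemma div_vel: "t \<in> {0..T} \<Longrightarrow> (\<Sum>i\<in>UNIV. partial_deriv i (vel i t) x) = 0"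
proof (cases "t = 0")
  case True
  then show ?thesis
    using u0_div[of x] by (simp add: vel_0 divergence_def partial_deriv_U0 flip: of_real_sum)
next
  case False
  assume "t \<in> {0..T}"
  then have t: "0 < t" "t \<le> T" "t \<in> {0..T}" using False by auto
  have s: "deriv_coeff i (vc i t) abs_summable_on UNIV" for i
    by (rule weighted_summable_abs[OF weighted_summable_deriv[OF vc_weighted_summable[OF t(1,2)], of 0]])
  have "(\<Sum>i\<in>UNIV. partial_deriv i (vel i t) x) = (\<Sum>\<^sub>\<infinity>n. \<Sum>i\<in>UNIV. deriv_coeff i (vc i t) n * wave n x)"
    by (simp add: partial_vel[OF t(1,2)] series_def infsum_sum series_summable[OF s])
  also have "\<dots> = (\<Sum>\<^sub>\<infinity>n::int^3. 0)"
  proof (rule infsum_cong)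
    fix n
    have "(\<Sum>i\<in>UNIV. deriv_coeff i (vc i t) n * wave n x)
        = \<i> * (\<Sum>i\<in>UNIV. of_real (freq n $ i) * vc i t n) * wave n x"
      by (simp add: deriv_coeff_def sum_distrib_left sum_distrib_right mult_ac)
    then show "(\<Sum>i\<in>UNIV. deriv_coeff i (vc i t) n * wave n x) = 0" by (simp add: vc_div_free[OF t(3)])
  qed
  finally show ?thesis by simp
qed

section \<open>Convection, pressure and the source of the pressure\<close>

definition conv_term :: "3 \<Rightarrow> real \<Rightarrow> real^3 \<Rightarrow> complex" where
  "conv_term j t x = (\<Sum>i\<in>UNIV. vel i t x * partial_deriv i (vel j t) x)"

text \<open>For divergence free fields \<open>div ((u \<sqdot> \<nabla>) u)\<close> contains no second derivatives.\<close>

definition press_source :: "real \<Rightarrow> real^3 \<Rightarrow> complex" where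
  "press_source t x = (\<Sum>i\<in>UNIV. \<Sum>l\<in>UNIV. partial_deriv l (vel i t) x * partial_deriv i (vel l t) x)"

text \<open>Taking the divergence of the equation gives minus the Laplacian of the pressure as the
  source, hence the division by the squared frequency. At frequency 0 the quotient is 0 by
  convention, which normalises the pressure to mean 0.\<close>

definition press_coeff :: "real \<Rightarrow> int^3 \<Rightarrow> complex" where
  "press_coeff t n = cf (press_source t) n / of_real ((norm (freq n))\<^sup>2)"

definition press :: "real \<Rightarrow> real^3 \<Rightarrow> complex" where "press t = series (press_coeff t)"

lemma press_source_continuous_periodic: "t \<in> {0..T} \<Longrightarrow> continuous_periodic L (press_source t)"
  unfolding press_source_def
  by (intro continuous_periodic_sum continuous_periodic_mult vel_deriv_continuous_periodic)

lemma conv_term_continuous_periodic: "t \<in> {0..T} \<Longrightarrow> continuous_periodic L (conv_term j t)"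
  unfolding conv_term_def
  by (intro continuous_periodic_sum continuous_periodic_mult vel_deriv_continuous_periodic vel_continuous_periodic)

lemma partial_press_source:
  assumes t: "t \<in> {0..T}"
  shows "partial_deriv k (press_source t) x = (\<Sum>i\<in>UNIV. \<Sum>l\<in>UNIV.
      partial_deriv l (vel i t) x * partial_deriv k (partial_deriv i (vel l t)) x
      + partial_deriv k (partial_deriv l (vel i t)) x * partial_deriv i (vel l t) x)"
    and "press_source t differentiable (at x)"
proof -
  have d: "\<exists>D. (partial_deriv l (vel i t) has_derivative D) (at x)" for l i
    using vel_differentiable(2)[OF t] by (simp add: differentiable_def)
  then obtain D where D: "\<And>l i. (partial_deriv l (vel i t) has_derivative D l i) (at x)" by metis
  have Dk: "D l i (axis k 1) = partial_deriv k (partial_deriv l (vel i t)) x" for l i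
    using has_derivative_partial_deriv[OF D] by simp
  have "(press_source t has_derivative (\<lambda>h. \<Sum>i\<in>UNIV. \<Sum>l\<in>UNIV.
      partial_deriv l (vel i t) x * D i l h + D l i h * partial_deriv i (vel l t) x)) (at x)"
    unfolding press_source_def[abs_def] by (intro has_derivative_sum has_derivative_mult D)
  then show "partial_deriv k (press_source t) x = (\<Sum>i\<in>UNIV. \<Sum>l\<in>UNIV.
      partial_deriv l (vel i t) x * partial_deriv k (partial_deriv i (vel l t)) x
      + partial_deriv k (partial_deriv l (vel i t)) x * partial_deriv i (vel l t) x)"
    "press_source t differentiable (at x)"
    using has_derivative_partial_deriv[of "press_source t" _ x k] by (simp_all add: Dk) (auto simp: differentiable_def)
qed

lemma partial_press_source_continuous_periodic:
  assumes t: "t \<in> {0..T}" shows "continuous_periodic L (partial_deriv k (press_source t))"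
  unfolding partial_press_source(1)[OF t, abs_def]
  by (intro continuous_periodic_sum continuous_periodic_intros continuous_periodic_mult vel_deriv_continuous_periodic[OF t])

lemma cf_partial_press_source:
  assumes t: "t \<in> {0..T}"
  shows "cf (partial_deriv k (press_source t)) n = \<i> * of_real (freq n $ k) * cf (press_source t) n"
  using press_source_continuous_periodic[OF t] partial_press_source_continuous_periodic[OF t]
  by (intro cf_partial_deriv partial_press_source(2)[OF t]) (auto simp: continuous_periodic_def)

text \<open>Bessel's inequality for the gradient of the source. That gradient is continuous even at
  \<open>t = 0\<close>, because the source involves only first derivatives of a velocity of class
  C^2.\<close>

lemma press_source_H1:
  assumes t: "t \<in> {0..T}"
  shows "(\<lambda>n. (norm (freq n))\<^sup>2 * (norm (cf (press_source t) n))\<^sup>2) summable_on UNIV"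
    and "(\<Sum>\<^sub>\<infinity>n. (norm (freq n))\<^sup>2 * (norm (cf (press_source t) n))\<^sup>2)
      \<le> (\<Sum>k\<in>UNIV. mean (\<lambda>x. (norm (partial_deriv k (press_source t) x))\<^sup>2))"
proof -
  have eq: "(norm (freq n))\<^sup>2 * (norm (cf (press_source t) n))\<^sup>2
      = (\<Sum>k\<in>UNIV. (norm (cf (partial_deriv k (press_source t)) n))\<^sup>2)" for n
  proof -
    have "(norm (freq n))\<^sup>2 = (\<Sum>k\<in>UNIV. (freq n $ k)\<^sup>2)"
      by (simp add: norm_vec_def L2_set_def sum_nonneg)
    then show ?thesis
      by (simp add: cf_partial_press_source[OF t] norm_mult power_mult_distrib sum_distrib_right)
  qed
  have s: "(\<lambda>n. (norm (cf (partial_deriv k (press_source t)) n))\<^sup>2) summable_on UNIV" for k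
    by (rule bessel(1)[OF partial_press_source_continuous_periodic[OF t]])
  show "(\<lambda>n. (norm (freq n))\<^sup>2 * (norm (cf (press_source t) n))\<^sup>2) summable_on UNIV"
    unfolding eq by (intro summable_on_sum s)
  show "(\<Sum>\<^sub>\<infinity>n. (norm (freq n))\<^sup>2 * (norm (cf (press_source t) n))\<^sup>2)
      \<le> (\<Sum>k\<in>UNIV. mean (\<lambda>x. (norm (partial_deriv k (press_source t) x))\<^sup>2))"
    unfolding eq by (subst infsum_sum) (auto intro!: sum_mono s bessel(2) partial_press_source_continuous_periodic t)
qed

end

section \<open>The equation at positive times\<close>

context periodic_box
begin

lemma norm_freq_lower: assumes "n \<noteq> 0" shows "2 * pi / L \<le> norm (freq n)"
proof -
  obtain i where i: "n $ i \<noteq> 0" using assms by (auto simp: vec_eq_iff)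
  then have "1 \<le> \<bar>real_of_int (n $ i)\<bar>" by (metis of_int_abs of_int_1_le_iff zero_less_abs_iff int_one_le_iff_zero_less)
  then have "2 * pi / L * 1 \<le> 2 * pi / L * \<bar>real_of_int (n $ i)\<bar>"
    using L_pos by (intro mult_left_mono) auto
  also have "\<dots> = \<bar>freq n $ i\<bar>" using L_pos by (simp add: freq_nth abs_mult)
  also have "\<dots> \<le> norm (freq n)" by (rule component_le_norm_cart)
  finally show ?thesis by simp
qed

text \<open>The constant that trades \<open>1 + norm (freq n)\<close> for
  \<open>norm (freq n)\<close> at nonzero frequencies, which stay at distance at least
  \<open>2 * pi / L\<close> from 0.\<close>

definition gap :: real where "gap = 1 + L / (2 * pi)"

lemma gap_pos: "0 < gap" using L_pos by (simp add: gap_def add_pos_pos)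

lemma one_plus_freq_le: assumes "n \<noteq> 0" shows "1 + norm (freq n) \<le> gap * norm (freq n)"
proof -
  have "1 \<le> L / (2 * pi) * norm (freq n)"
    using norm_freq_lower[OF assms] L_pos by (simp add: field_simps)
  then show ?thesis by (simp add: gap_def distrib_right)
qed

text \<open>At frequency 0 the left side is 0 by the convention for division, so sums over all
  indices need no exception.\<close>

lemma inverse_freq4_le: "1 / norm (freq n) ^ 4 \<le> gap ^ 4 * (1 / (1 + norm (freq n)) ^ 4)"
proof (cases "n = 0")
  case False
  have p: "0 < norm (freq n)" using False by (simp add: freq_eq_0_iff)
  have "(1 + norm (freq n)) ^ 4 \<le> (gap * norm (freq n)) ^ 4"
    by (intro power_mono one_plus_freq_le[OF False]) simp
  then have "(1 + norm (freq n)) ^ 4 \<le> gap ^ 4 * norm (freq n) ^ 4" by (simp only: power_mult_distrib)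
  moreover have "0 < (1 + norm (freq n)) ^ 4" by (rule zero_less_power) (simp add: add_pos_nonneg)
  moreover have "0 < norm (freq n) ^ 4" using p by (rule zero_less_power)
  ultimately have "1 / norm (freq n) ^ 4 \<le> gap ^ 4 / (1 + norm (freq n)) ^ 4"
    by (simp only: divide_le_eq le_divide_eq frac_le_eq) (simp add: field_simps)
  then show ?thesis by simp
qed (use gap_pos in simp)

lemma inverse_freq4_summable: "(\<lambda>n. 1 / norm (freq n) ^ 4) summable_on UNIV"
  by (rule summable_on_comparison_test[OF summable_on_cmult_right[OF lattice_summable] inverse_freq4_le]) auto

end

context navier_stokes_data
begin

lemma press_coeff_bound:
  "(1 + norm (freq n)) * norm (press_coeff t n) \<le> gap * (norm (cf (press_source t) n) / norm (freq n))"
proof (cases "n = 0")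
  case False
  have p: "0 < norm (freq n)" using False by (simp add: freq_eq_0_iff)
  have "(1 + norm (freq n)) * norm (press_coeff t n) \<le> (gap * norm (freq n)) * norm (press_coeff t n)"
    by (intro mult_right_mono one_plus_freq_le False) simp
  also have "\<dots> = gap * (norm (cf (press_source t) n) / norm (freq n))"
  proof -
    have "norm (press_coeff t n) = norm (cf (press_source t) n) / (norm (freq n))\<^sup>2"
      by (simp add: press_coeff_def norm_divide norm_power)
    then show ?thesis using p by (simp add: power2_eq_square)
  qed
  finally show ?thesis .
qed (simp add: press_coeff_def)

text \<open>Cauchy-Schwarz in the pointwise form: \<open>y / x\<close> is the product of
  \<open>x * y\<close>, square summable by \<open>press_source_H1\<close>, and
  \<open>1 / x\<^sup>2\<close>, square summable over the nonzero frequencies in dimension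
  three.\<close>

lemma press_source_div_freq_summable:
  assumes "t \<in> {0..T}"
  shows "(\<lambda>n. norm (cf (press_source t) n) / norm (freq n)) summable_on UNIV"
proof (rule summable_on_comparison_test)
  show "(\<lambda>n. 1 / 2 * ((norm (freq n))\<^sup>2 * (norm (cf (press_source t) n))\<^sup>2 + 1 / norm (freq n) ^ 4)) summable_on UNIV"
    by (intro summable_on_cmult_right summable_on_add press_source_H1[OF assms] inverse_freq4_summable)
  fix n
  define x y where "x = norm (freq n)" and "y = norm (cf (press_source t) n)"
  show "norm (cf (press_source t) n) / norm (freq n)
      \<le> 1 / 2 * ((norm (freq n))\<^sup>2 * (norm (cf (press_source t) n))\<^sup>2 + 1 / norm (freq n) ^ 4)"
  proof (cases "n = 0")
    case False
    then have x: "x > 0" by (simp add: x_def freq_eq_0_iff)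
    have "2 * (x * y) * (1 / x\<^sup>2) \<le> (x * y)\<^sup>2 + (1 / x\<^sup>2)\<^sup>2" by (rule sum_squares_bound)
    moreover have "2 * (x * y) * (1 / x\<^sup>2) = 2 * (y / x)" using x by (simp add: power2_eq_square)
    moreover have "(1 / x\<^sup>2)\<^sup>2 = 1 / x ^ 4" by (simp add: power_divide flip: power_mult)
    ultimately have "2 * (y / x) \<le> x\<^sup>2 * y\<^sup>2 + 1 / x ^ 4" by (simp only: power_mult_distrib)
    then have "1 / 2 * (2 * (y / x)) \<le> 1 / 2 * (x\<^sup>2 * y\<^sup>2 + 1 / x ^ 4)" by (rule mult_left_mono) simp
    then show ?thesis unfolding x_def[symmetric] y_def[symmetric] by simp
  qed simp
qed simp

lemma press_coeff_weighted_summable: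
  assumes "t \<in> {0..T}" shows "weighted_summable 1 (press_coeff t)"
  unfolding weighted_summable_def power_one_right
  by (rule summable_on_comparison_test[OF summable_on_cmult_right[OF press_source_div_freq_summable[OF assms], of gap] press_coeff_bound])
    simp

lemma press_C1: "t \<in> {0..T} \<Longrightarrow> C_class 1 (press t)"
  unfolding press_def by (rule C_class_series[OF press_coeff_weighted_summable])

lemma press_continuous_periodic: "t \<in> {0..T} \<Longrightarrow> continuous_periodic L (press t)"
  unfolding press_def by (rule continuous_periodic_series[OF weighted_summable_abs[OF press_coeff_weighted_summable]])

lemma partial_press: "t \<in> {0..T} \<Longrightarrow> partial_deriv j (press t) = series (deriv_coeff j (press_coeff t))"
  unfolding press_def by (rule partial_deriv_series[OF press_coeff_weighted_summable])

lemma deriv_press_coeff_summable: "t \<in> {0..T} \<Longrightarrow> deriv_coeff j (press_coeff t) abs_summable_on UNIV"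
  using weighted_summable_abs[OF weighted_summable_deriv[of 0]] press_coeff_weighted_summable by simp

text \<open>Convection plus pressure gradient, that is, the Leray projection of the convection term;
  \<open>series_quad_coeff\<close> makes the identification at positive times.\<close>

definition force :: "3 \<Rightarrow> real \<Rightarrow> real^3 \<Rightarrow> complex" where
  "force j t x = conv_term j t x + partial_deriv j (press t) x"

lemma force_continuous_periodic: "t \<in> {0..T} \<Longrightarrow> continuous_periodic L (force j t)"
  unfolding force_def
  by (intro continuous_periodic_intros conv_term_continuous_periodic)
    (simp_all add: partial_press continuous_periodic_series deriv_press_coeff_summable)

definition quad_coeff :: "3 \<Rightarrow> real \<Rightarrow> int^3 \<Rightarrow> complex" where
  "quad_coeff j t n = quad (solution t) n $ j"

lemma deriv_vc_summable:
  "0 < t \<Longrightarrow> t \<le> T \<Longrightarrow> deriv_coeff i (vc j t) abs_summable_on UNIV"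
  "0 < t \<Longrightarrow> t \<le> T \<Longrightarrow> deriv_coeff l (deriv_coeff i (vc j t)) abs_summable_on UNIV"
  by (rule weighted_summable_abs[where k=0], rule weighted_summable_deriv, rule vc_weighted_summable, assumption+)
    (rule weighted_summable_abs[where k=0], rule weighted_summable_deriv, rule weighted_summable_deriv,
      rule vc_weighted_summable, assumption+)

text \<open>Each coefficient of a divergence free field is orthogonal to its own frequency, so in a
  convolution the total frequency \<open>n\<close> may be replaced by the frequency of the other
  factor. This moves the derivative onto that factor.\<close>

lemma cdot_shift:
  assumes "t \<in> {0..T}"
  shows "cdot (freq n) (solution t (n - m)) = (\<Sum>i\<in>UNIV. of_real (freq m $ i) * vc i t (n - m))"
    and "cdot (freq n) (solution t m) = (\<Sum>i\<in>UNIV. of_real (freq (n - m) $ i) * vc i t m)"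
proof -
  have z: "cdot (freq m) (solution t m) = 0" for m
    using vc_div_free[OF assms, of m] by (simp add: cdot_def vc_def)
  have "freq n = freq (n - m) + freq m" by (simp add: freq_diff)
  then show "cdot (freq n) (solution t (n - m)) = (\<Sum>i\<in>UNIV. of_real (freq m $ i) * vc i t (n - m))"
    "cdot (freq n) (solution t m) = (\<Sum>i\<in>UNIV. of_real (freq (n - m) $ i) * vc i t m)"
    using z[of "n - m"] z[of m] by (simp_all only: cdot_add_left) (simp_all add: cdot_def vc_def)
qed

lemma cf_press_source:
  assumes t: "0 < t" "t \<le> T"
  shows "cf (press_source t) n = (\<Sum>i\<in>UNIV. \<Sum>l\<in>UNIV. conv (deriv_coeff l (vc i t)) (deriv_coeff i (vc l t)) n)"
proof -
  have "press_source t = (\<lambda>x. \<Sum>i\<in>UNIV. \<Sum>l\<in>UNIV. series (conv (deriv_coeff l (vc i t)) (deriv_coeff i (vc l t))) x)"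
    by (simp add: press_source_def[abs_def] partial_vel[OF t] series_mult deriv_vc_summable[OF t])
  then show ?thesis
    by (simp add: cf_sum continuous_periodic_sum continuous_periodic_series conv_abs_summable deriv_vc_summable[OF t] cf_series)
qed

text \<open>The two terms of the projected symbol become convection and pressure gradient after
  \<open>cdot_shift\<close> has rewritten the scalar products as derivatives of the factors.\<close>

lemma quad_coeff_eq:
  assumes t: "0 < t" "t \<le> T"
  shows "quad_coeff j t n = (\<Sum>i\<in>UNIV. conv (vc i t) (deriv_coeff i (vc j t)) n) + deriv_coeff j (press_coeff t) n"
proof -
  have t': "t \<in> {0..T}" using t by simp
  have sm: "(\<lambda>m. leray_symbol (freq n) (solution t (n - m)) (solution t m)) summable_on UNIV"
    by (rule abs_summable_summable[OF quad_abs_summable[where s=t and b=majorant_lim]])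
      (use t solution_bound majorant_lim_nonneg majorant_lim_summable in auto)
  have s1: "(\<lambda>m. vc i t (n - m) * deriv_coeff i (vc j t) m) summable_on UNIV" for i
    by (rule abs_summable_summable[OF conv_summand_abs_summable[OF vc_abs_summable[OF t'] deriv_vc_summable(1)[OF t]]])
  have s2: "(\<lambda>m. deriv_coeff l (vc i t) (n - m) * deriv_coeff i (vc l t) m) summable_on UNIV" for i l
    by (rule abs_summable_summable[OF conv_summand_abs_summable[OF deriv_vc_summable(1)[OF t] deriv_vc_summable(1)[OF t]]])
  \<comment> \<open>The symbol of the \<open>j\<close>-th derivative of the inverse of minus the
    Laplacian, equal to 0 at frequency 0 by the convention for division.\<close>
  define \<kappa> where "\<kappa> = \<i> * of_real (freq n $ j) / of_real ((norm (freq n))\<^sup>2)"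
  have summand: "leray_symbol (freq n) (solution t (n - m)) (solution t m) $ j
      = (\<Sum>i\<in>UNIV. vc i t (n - m) * deriv_coeff i (vc j t) m)
        + \<kappa> * (\<Sum>i\<in>UNIV. \<Sum>l\<in>UNIV. deriv_coeff l (vc i t) (n - m) * deriv_coeff i (vc l t) m)" for m
  proof -
    have 1: "\<i> * cdot (freq n) (solution t (n - m)) * solution t m $ j = (\<Sum>i\<in>UNIV. vc i t (n - m) * deriv_coeff i (vc j t) m)"
      unfolding cdot_shift(1)[OF t'] by (simp add: deriv_coeff_def sum_distrib_left sum_distrib_right mult_ac flip: vc_def)
    \<comment> \<open>The minus sign is \<open>\<i>\<^sup>2\<close> from the two differentiated
      factors.\<close>
    have 2: "cdot (freq n) (solution t (n - m)) * cdot (freq n) (solution t m)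
        = - (\<Sum>i\<in>UNIV. \<Sum>l\<in>UNIV. deriv_coeff l (vc i t) (n - m) * deriv_coeff i (vc l t) m)"
      unfolding cdot_shift[OF t'] sum_product sum_negf[symmetric]
      by (intro sum.cong refl) (simp add: deriv_coeff_def mult_ac)
    show ?thesis
      unfolding leray_symbol_nth mult.assoc[of \<i> "cdot _ _" "cdot _ _"] 2 1 \<kappa>_def by simp
  qed
  have "quad_coeff j t n = (\<Sum>\<^sub>\<infinity>m. leray_symbol (freq n) (solution t (n - m)) (solution t m) $ j)"
    unfolding quad_coeff_def quad_def by (rule infsum_bounded_linear[OF bounded_linear_vec_nth sm])
  also have "\<dots> = (\<Sum>\<^sub>\<infinity>m. \<Sum>i\<in>UNIV. vc i t (n - m) * deriv_coeff i (vc j t) m)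
      + (\<Sum>\<^sub>\<infinity>m. \<kappa> * (\<Sum>i\<in>UNIV. \<Sum>l\<in>UNIV. deriv_coeff l (vc i t) (n - m) * deriv_coeff i (vc l t) m))"
    unfolding summand by (intro infsum_add summable_on_sum summable_on_cmult_right s1 s2)
  also have "(\<Sum>\<^sub>\<infinity>m. \<Sum>i\<in>UNIV. vc i t (n - m) * deriv_coeff i (vc j t) m) = (\<Sum>i\<in>UNIV. conv (vc i t) (deriv_coeff i (vc j t)) n)"
    unfolding conv_def by (rule infsum_sum[OF s1])
  also have "(\<Sum>\<^sub>\<infinity>m. \<kappa> * (\<Sum>i\<in>UNIV. \<Sum>l\<in>UNIV. deriv_coeff l (vc i t) (n - m) * deriv_coeff i (vc l t) m))
      = \<kappa> * cf (press_source t) n"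
    unfolding cf_press_source[OF t] conv_def
    by (simp add: infsum_cmult_right' infsum_sum summable_on_sum s2)
  finally show ?thesis by (simp add: \<kappa>_def deriv_coeff_def[of j "press_coeff t"] press_coeff_def)
qed

lemma norm_quad_coeff_le:
  assumes "t \<in> {0..T}"
  shows "norm (quad_coeff j t n) \<le> 2 * norm (freq n) * exp (- (t * norm (freq n))) * conv majorant_lim majorant_lim n"
  unfolding quad_coeff_def
  by (rule order_trans[OF Finite_Cartesian_Product.norm_nth_le norm_quad_le])
    (use assms solution_bound majorant_lim_nonneg majorant_lim_summable in auto)

definition majorant_sq :: "int^3 \<Rightarrow> real" where "majorant_sq = conv majorant_lim majorant_lim"

lemma majorant_sq_nonneg: "0 \<le> majorant_sq n"
  by (simp add: majorant_sq_def conv_nonneg majorant_lim_nonneg)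

lemma majorant_sq_summable: "majorant_sq summable_on UNIV"
proof -
  have "majorant_lim abs_summable_on UNIV"
    using majorant_lim_summable summable_on_iff_abs_summable_on_real by blast
  then show ?thesis unfolding majorant_sq_def
    using abs_summable_summable[OF conv_abs_summable] by blast
qed

text \<open>A summable bound that is uniform for times in \<open>{r..T}\<close>, as termwise
  differentiation in time requires. It degenerates like \<open>1 / r\<close>, which is why time 0
  needs a separate argument.\<close>

lemma quad_coeff_uniform_bound:
  assumes r: "0 < r" and s: "r \<le> s" "s \<le> T"
  shows "norm (quad_coeff j s n) \<le> 2 * exp r / r * majorant_sq n"
proof -
  have "norm (freq n) * exp (- (s * norm (freq n))) \<le> (1 + norm (freq n)) ^ 1 * exp (- (r * norm (freq n)))"
    using s r by (intro mult_mono) (auto intro!: mult_right_mono)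
  also have "\<dots> \<le> fact 1 * exp r / r ^ 1" using r by (intro power_mult_exp_le) auto
  finally have 1: "norm (freq n) * exp (- (s * norm (freq n))) \<le> exp r / r" by simp
  have "norm (quad_coeff j s n) \<le> 2 * (norm (freq n) * exp (- (s * norm (freq n)))) * majorant_sq n"
    using norm_quad_coeff_le[of s j n] r s by (simp add: majorant_sq_def mult.assoc)
  also have "\<dots> \<le> 2 * (exp r / r) * majorant_sq n"
    using 1 by (intro mult_right_mono mult_left_mono majorant_sq_nonneg) auto
  finally show ?thesis by simp
qed

lemma quad_coeff_summable: "0 < t \<Longrightarrow> t \<le> T \<Longrightarrow> quad_coeff j t abs_summable_on UNIV"
  by (rule abs_summable_on_le[OF summable_on_cmult_right[OF majorant_sq_summable] quad_coeff_uniform_bound[of t]]) auto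

lemma series_quad_coeff:
  assumes t: "0 < t" "t \<le> T" shows "series (quad_coeff j t) = force j t"
proof
  fix x
  have t': "t \<in> {0..T}" using t by simp
  have c: "conv (vc i t) (deriv_coeff i (vc j t)) abs_summable_on UNIV" for i
    by (intro conv_abs_summable vc_abs_summable[OF t'] deriv_vc_summable[OF t])
  have cs: "(\<lambda>n. \<Sum>i\<in>UNIV. conv (vc i t) (deriv_coeff i (vc j t)) n) abs_summable_on UNIV"
    by (rule abs_summable_on_le[OF summable_on_sum[of UNIV "\<lambda>i n. norm (conv (vc i t) (deriv_coeff i (vc j t)) n)", OF c]])
      (rule norm_sum)
  have "series (quad_coeff j t) x = series (\<lambda>n. (\<Sum>i\<in>UNIV. conv (vc i t) (deriv_coeff i (vc j t)) n) + deriv_coeff j (press_coeff t) n) x"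
    by (simp add: quad_coeff_eq[OF t, abs_def])
  also have "\<dots> = series (\<lambda>n. \<Sum>i\<in>UNIV. conv (vc i t) (deriv_coeff i (vc j t)) n) x + series (deriv_coeff j (press_coeff t)) x"
    by (rule series_add[OF cs deriv_press_coeff_summable[OF t']])
  also have "series (\<lambda>n. \<Sum>i\<in>UNIV. conv (vc i t) (deriv_coeff i (vc j t)) n) x = (\<Sum>i\<in>UNIV. series (conv (vc i t) (deriv_coeff i (vc j t))) x)"
    unfolding series_def sum_distrib_right by (rule infsum_sum[OF series_summable[OF c]])
  also have "\<dots> = conv_term j t x"
    by (simp add: conv_term_def vel_def series_mult[OF vc_abs_summable[OF t'] deriv_vc_summable(1)[OF t], symmetric]
        partial_vel[OF t, unfolded vel_def])
  finally show "series (quad_coeff j t) x = force j t x"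
    by (simp add: force_def partial_press[OF t'])
qed

lemma vc_vector_derivative:
  assumes "t \<in> {0..T}"
  shows "((\<lambda>t. vc j t n) has_vector_derivative (- (\<nu> * (norm (freq n))\<^sup>2) *\<^sub>R vc j t n - quad_coeff j t n)) (at t within {0..T})"
  using bounded_linear.has_vector_derivative[OF bounded_linear_vec_nth solution_vector_derivative[OF assms, of n], of j]
  by (simp add: vc_def quad_coeff_def)

lemma vel_time_derivative:
  assumes t: "0 < t" "t \<le> T"
  shows "((\<lambda>s. vel j s x) has_vector_derivative
    of_real \<nu> * (\<Sum>i\<in>UNIV. partial_deriv i (partial_deriv i (vel j t)) x) - force j t x) (at t within {0..T})"
proof -
  \<comment> \<open>On this interval the weight is at most the one at time \<open>t / 2\<close>,
    which supplies a single summable majorant for all time derivatives.\<close>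
  define X where "X = {t / 2..T}"
  have X: "convex X" "t \<in> X" "X \<subseteq> {0..T}" using t by (auto simp: X_def)
  define c' where "c' s n = - (\<nu> * (norm (freq n))\<^sup>2) *\<^sub>R vc j s n - quad_coeff j s n" for s n
  define M where "M n = \<nu> * (fact 2 * exp (t / 2) / (t / 2) ^ 2) * majorant_lim n + 2 * exp (t / 2) / (t / 2) * majorant_sq n" for n
  have "((\<lambda>s. series (vc j s) x) has_vector_derivative series (c' t) x) (at t within X)"
  proof (rule series_has_vector_derivative[OF X(1,2)])
    show "((\<lambda>s. vc j s n) has_vector_derivative c' s n) (at s within X)" if "s \<in> X" for n s
      unfolding c'_def using that X by (intro has_vector_derivative_within_subset[OF vc_vector_derivative]) auto
    show "norm (c' s n) \<le> M n" if "s \<in> X" for n s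
    proof -
      have s: "t / 2 \<le> s" "s \<le> T" "s \<in> {0..T}" using that X by (auto simp: X_def)
      have "(norm (freq n))\<^sup>2 * norm (vc j s n) \<le> (1 + norm (freq n)) ^ 2 * (exp (- (t / 2 * norm (freq n))) * majorant_lim n)"
      proof (intro mult_mono)
        show "norm (vc j s n) \<le> exp (- (t / 2 * norm (freq n))) * majorant_lim n"
          using s by (intro order_trans[OF vc_bound[OF s(3)]] mult_right_mono majorant_lim_nonneg)
            (simp only: exp_le_cancel_iff neg_le_iff_le, intro mult_right_mono s norm_ge_zero)
      qed (auto intro: power_mono)
      also have "\<dots> = ((1 + norm (freq n)) ^ 2 * exp (- (t / 2 * norm (freq n)))) * majorant_lim n" by simp
      also have "\<dots> \<le> (fact 2 * exp (t / 2) / (t / 2) ^ 2) * majorant_lim n"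
        using t by (intro mult_right_mono power_mult_exp_le majorant_lim_nonneg) auto
      finally have "\<nu> * ((norm (freq n))\<^sup>2 * norm (vc j s n)) \<le> \<nu> * ((fact 2 * exp (t / 2) / (t / 2) ^ 2) * majorant_lim n)"
        using \<nu>_positive by (intro mult_left_mono) auto
      moreover have "norm (quad_coeff j s n) \<le> 2 * exp (t / 2) / (t / 2) * majorant_sq n"
        using s t by (intro quad_coeff_uniform_bound) auto
      moreover have "norm (c' s n) \<le> norm (- (\<nu> * (norm (freq n))\<^sup>2) *\<^sub>R vc j s n) + norm (quad_coeff j s n)"
        unfolding c'_def by (rule norm_triangle_ineq4)
      moreover have "norm (- (\<nu> * (norm (freq n))\<^sup>2) *\<^sub>R vc j s n) = \<nu> * ((norm (freq n))\<^sup>2 * norm (vc j s n))"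
        using \<nu>_positive by (simp add: abs_mult)
      ultimately show ?thesis unfolding M_def by (simp only: mult.assoc)
    qed
    show "M summable_on UNIV"
      unfolding M_def by (intro summable_on_add summable_on_cmult_right majorant_lim_summable majorant_sq_summable)
    show "vc j s abs_summable_on UNIV" if "s \<in> X" for s using that X vc_abs_summable by blast
  qed
  \<comment> \<open>Only the behaviour near \<open>t\<close> matters, and above \<open>t / 2\<close>
    the two intervals agree; at \<open>t = T\<close> both give the one-sided derivative.\<close>
  moreover have "at t within X = at t within {0..T}"
    by (rule at_within_nhd[of _ "{t / 2<..}"]) (use t in \<open>auto simp: X_def\<close>)
  moreover have "series (c' t) x = of_real \<nu> * (\<Sum>i\<in>UNIV. partial_deriv i (partial_deriv i (vel j t)) x) - force j t x"
  proof -
    have d2: "deriv_coeff i (deriv_coeff i (vc j t)) abs_summable_on UNIV" for i by (rule deriv_vc_summable(2)[OF t])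
    have ds: "(\<lambda>n. \<Sum>i\<in>UNIV. deriv_coeff i (deriv_coeff i (vc j t)) n) abs_summable_on UNIV"
      by (rule abs_summable_on_le[OF summable_on_sum[of UNIV "\<lambda>i n. norm (deriv_coeff i (deriv_coeff i (vc j t)) n)", OF d2]])
        (rule norm_sum)
    have c': "c' t n = of_real \<nu> * (\<Sum>i\<in>UNIV. deriv_coeff i (deriv_coeff i (vc j t)) n) - quad_coeff j t n" for n
      unfolding deriv_coeff_twice_sum by (simp add: c'_def scaleR_conv_of_real)
    have "series (c' t) x = series (\<lambda>n. of_real \<nu> * (\<Sum>i\<in>UNIV. deriv_coeff i (deriv_coeff i (vc j t)) n)) x - series (quad_coeff j t) x"
      unfolding c'[abs_def]
      by (rule series_diff[OF _ quad_coeff_summable[OF t]])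
        (use summable_on_cmult_right[OF ds, of "norm (complex_of_real \<nu>)"] in \<open>simp add: norm_mult\<close>)
    also have "series (\<lambda>n. of_real \<nu> * (\<Sum>i\<in>UNIV. deriv_coeff i (deriv_coeff i (vc j t)) n)) x
        = of_real \<nu> * (\<Sum>i\<in>UNIV. series (deriv_coeff i (deriv_coeff i (vc j t))) x)"
    proof -
      have "series (\<lambda>n. \<Sum>i\<in>UNIV. deriv_coeff i (deriv_coeff i (vc j t)) n) x = (\<Sum>i\<in>UNIV. series (deriv_coeff i (deriv_coeff i (vc j t))) x)"
        unfolding series_def sum_distrib_right by (rule infsum_sum[OF series_summable[OF d2]])
      then show ?thesis by (simp add: series_cmult)
    qed
    finally show ?thesis by (simp add: partial2_vel[OF t] series_quad_coeff[OF t])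
  qed
  ultimately show ?thesis by (simp add: vel_def)
qed

end

section \<open>Uniform convergence at the initial time\<close>

context periodic_box
begin

lemma heat_mult_antimono: "\<sigma> \<le> \<tau> \<Longrightarrow> heat_mult \<tau> n \<le> heat_mult \<sigma> n"
  by (simp add: heat_mult_def mult_right_mono)

lemma heat_uniform_limit:
  assumes g: "continuous_periodic L g" and \<nu>: "\<nu> > 0"
  shows "uniform_limit UNIV (\<lambda>t. series (\<lambda>n. of_real (heat_mult (\<nu> * t) n) * cf g n)) g (at_right 0)"
proof (rule uniform_limitI)
  fix e :: real assume "e > 0"
  then obtain d where d: "d > 0" "\<And>\<tau> x. 0 < \<tau> \<Longrightarrow> \<tau> < d \<Longrightarrow> norm (series (\<lambda>n. of_real (heat_mult \<tau> n) * cf g n) x - g x) < e"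
    using heat_approximation[OF g] by metis
  show "\<forall>\<^sub>F t in at_right 0. \<forall>x\<in>UNIV. dist (series (\<lambda>n. of_real (heat_mult (\<nu> * t) n) * cf g n) x) (g x) < e"
    unfolding eventually_at_right_field
    by (rule exI[of _ "d / \<nu>"]) (use d \<nu> in \<open>auto simp: dist_norm field_simps\<close>)
qed

lemma series_heat_time_derivative:
  assumes c: "c abs_summable_on UNIV" and \<nu>: "\<nu> > 0" and s: "s > 0"
  shows "((\<lambda>s. series (\<lambda>n. of_real (heat_mult (\<nu> * s) n) * c n) x) has_vector_derivative
     series (\<lambda>n. of_real (- (\<nu> * (norm (freq n))\<^sup>2) * heat_mult (\<nu> * s) n) * c n) x) (at s)"
proof -
  obtain C where C: "\<And>n. (1 + norm (freq n)) ^ 2 * heat_mult (\<nu> * (s / 2)) n \<le> C"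
    using heat_mult_bound[of "\<nu> * (s / 2)" 2] \<nu> s by auto
  \<comment> \<open>Staying away from 0 leaves the heat factor at time \<open>s / 2\<close> to
    absorb the two derivatives.\<close>
  define X where "X = {s / 2..2 * s}"
  have "((\<lambda>s. series (\<lambda>n. of_real (heat_mult (\<nu> * s) n) * c n) x) has_vector_derivative
     series (\<lambda>n. of_real (- (\<nu> * (norm (freq n))\<^sup>2) * heat_mult (\<nu> * s) n) * c n) x) (at s within X)"
  proof (rule series_has_vector_derivative)
    show "convex X" "s \<in> X" using s by (auto simp: X_def)
    show "((\<lambda>s. of_real (heat_mult (\<nu> * s) n) * c n) has_vector_derivative
        of_real (- (\<nu> * (norm (freq n))\<^sup>2) * heat_mult (\<nu> * s) n) * c n) (at s within X)" for n s
    proof -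
      have "((\<lambda>s. heat_mult (\<nu> * s) n) has_real_derivative - (\<nu> * (norm (freq n))\<^sup>2) * heat_mult (\<nu> * s) n) (at s within X)"
        unfolding heat_mult_def by (auto intro!: derivative_eq_intros)
      then have "((\<lambda>s. complex_of_real (heat_mult (\<nu> * s) n)) has_vector_derivative
          of_real (- (\<nu> * (norm (freq n))\<^sup>2) * heat_mult (\<nu> * s) n)) (at s within X)"
        by (intro has_vector_derivative_of_real)
          (simp add: has_real_derivative_iff_has_vector_derivative)
      then show ?thesis by (rule has_vector_derivative_mult_left)
    qed
    show "norm (of_real (- (\<nu> * (norm (freq n))\<^sup>2) * heat_mult (\<nu> * s') n) * c n) \<le> (\<nu> * C) * norm (c n)" if "s' \<in> X" for n s'
    proof -
      have "(norm (freq n))\<^sup>2 * heat_mult (\<nu> * s') n \<le> (1 + norm (freq n)) ^ 2 * heat_mult (\<nu> * (s / 2)) n"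
        using that \<nu> by (intro mult_mono power_mono heat_mult_antimono) (auto simp: X_def heat_mult_nonneg)
      also note C[of n]
      finally have "\<nu> * ((norm (freq n))\<^sup>2 * heat_mult (\<nu> * s') n) * norm (c n) \<le> \<nu> * C * norm (c n)"
        using \<nu> by (intro mult_right_mono mult_left_mono) auto
      then show ?thesis using \<nu> by (simp add: norm_mult abs_mult heat_mult_nonneg norm_power mult.assoc)
    qed
    show "(\<lambda>n. (\<nu> * C) * norm (c n)) summable_on UNIV" by (rule summable_on_cmult_right[OF c])
    show "(\<lambda>n. of_real (heat_mult (\<nu> * s') n) * c n) abs_summable_on UNIV" if "s' \<in> X" for s'
      by (rule abs_summable_on_le[OF c])
        (use that \<nu> s in \<open>auto simp: X_def norm_mult heat_mult_nonneg intro!: mult_left_le_one_le heat_mult_le_1\<close>)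
  qed
  moreover have "s \<in> interior X" using s by (simp add: X_def interior_atLeastAtMost_real)
  then have "at s within X = at s" by (rule at_within_interior)
  ultimately show ?thesis by (simp only:)
qed

lemma continuous_on_series_heat:
  assumes c: "c abs_summable_on UNIV" and \<nu>: "\<nu> > 0"
  shows "continuous_on {0..t} (\<lambda>s. series (\<lambda>n. of_real (heat_mult (\<nu> * s) n) * c n) x)"
  unfolding series_def
proof (rule continuous_on_infsum[OF _ _ c])
  show "continuous_on {0..t} (\<lambda>s. of_real (heat_mult (\<nu> * s) n) * c n * wave n x)" for n
    unfolding heat_mult_def by (intro continuous_intros)
  show "norm (of_real (heat_mult (\<nu> * s) n) * c n * wave n x) \<le> norm (c n)" if "s \<in> {0..t}" for n s
    using that \<nu> by (auto simp: norm_mult heat_mult_nonneg intro!: mult_left_le_one_le heat_mult_le_1)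
qed

end

context navier_stokes_data
begin

definition lap :: "3 \<Rightarrow> real \<Rightarrow> real^3 \<Rightarrow> complex" where
  "lap j t x = (\<Sum>i\<in>UNIV. partial_deriv i (partial_deriv i (vel j t)) x)"

lemma lap_continuous_periodic: "t \<in> {0..T} \<Longrightarrow> continuous_periodic L (lap j t)"
  unfolding lap_def by (intro continuous_periodic_sum vel_deriv_continuous_periodic)

lemma T_mem: "0 \<in> {0..T}" using T_positive by simp

lemma cf_lap_0: "cf (lap j 0) n = - of_real ((norm (freq n))\<^sup>2) * cf (U0 j) n"
  unfolding lap_def vel_0
  by (subst cf_sum) (simp_all add: U0_continuous_periodic cf_partial2_U0 deriv_coeff_twice_sum)

lemma cf_U0_summable: "cf (U0 j) abs_summable_on UNIV"
  using vc_abs_summable[OF T_mem, of j] by (simp add: vc_0)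

text \<open>The linear part of the solution. The derivative at time 0 is computed separately for it
  and for the Duhamel remainder.\<close>

definition hflow :: "3 \<Rightarrow> real \<Rightarrow> real^3 \<Rightarrow> complex" where
  "hflow j t = series (\<lambda>n. of_real (heat_mult (\<nu> * t) n) * cf (U0 j) n)"

lemma eventually_T: "eventually (\<lambda>t. t \<in> {0<..<T}) (at_right 0)"
  using eventually_at_right_real[OF T_positive] .

text \<open>For \<open>s > 0\<close> the time derivative is \<open>\<nu>\<close> times the heat flow
  of the initial Laplacian, a continuous function, so it converges uniformly to its value at 0. The
  mean value inequality transfers this to the increment, and the undamped series of second
  derivatives is never summed.\<close>

lemma hflow_derivative_0:
  assumes e: "e > 0"
  shows "eventually (\<lambda>t. norm (hflow j t x - U0 j x - t *\<^sub>R (of_real \<nu> * lap j 0 x)) \<le> t * e) (at_right 0)"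
proof -
  have "e / \<nu> > 0" using e \<nu>_positive by simp
  with heat_uniform_limit[OF lap_continuous_periodic[OF T_mem] \<nu>_positive, of j]
  have "eventually (\<lambda>t. \<forall>x\<in>UNIV. dist (series (\<lambda>n. of_real (heat_mult (\<nu> * t) n) * cf (lap j 0) n) x) (lap j 0 x) < e / \<nu>) (at_right 0)"
    by (rule uniform_limitD)
  then obtain d where d: "d > 0" "\<And>s. 0 < s \<Longrightarrow> s < d \<Longrightarrow>
      norm (series (\<lambda>n. of_real (heat_mult (\<nu> * s) n) * cf (lap j 0) n) x - lap j 0 x) < e / \<nu>"
    unfolding eventually_at_right_field dist_norm by auto
  have "norm (hflow j t x - U0 j x - t *\<^sub>R (of_real \<nu> * lap j 0 x)) \<le> t * e" if t: "0 < t" "t < d" for t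
  proof -
    have h0: "hflow j 0 x = U0 j x"
      unfolding hflow_def using vel_0[of j] by (simp add: vel_def vc_0)
    have "norm (hflow j t x - hflow j 0 x - t *\<^sub>R (of_real \<nu> * lap j 0 x)) \<le> t * e"
    proof (rule norm_increment_le)
      show "continuous_on {0..t} (\<lambda>s. hflow j s x)"
        unfolding hflow_def by (rule continuous_on_series_heat[OF cf_U0_summable \<nu>_positive])
      fix s assume s: "0 < s" "s < t"
      have eq: "series (\<lambda>n. of_real (- (\<nu> * (norm (freq n))\<^sup>2) * heat_mult (\<nu> * s) n) * cf (U0 j) n) x
          = of_real \<nu> * series (\<lambda>n. of_real (heat_mult (\<nu> * s) n) * cf (lap j 0) n) x"
        unfolding series_cmult[symmetric] cf_lap_0 by (simp add: mult_ac)
      show "((\<lambda>s. hflow j s x) has_vector_derivative of_real \<nu> * series (\<lambda>n. of_real (heat_mult (\<nu> * s) n) * cf (lap j 0) n) x) (at s)"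
        unfolding hflow_def eq[symmetric] by (rule series_heat_time_derivative[OF cf_U0_summable \<nu>_positive s(1)])
      have "norm (of_real \<nu> * series (\<lambda>n. of_real (heat_mult (\<nu> * s) n) * cf (lap j 0) n) x - of_real \<nu> * lap j 0 x)
          = \<nu> * norm (series (\<lambda>n. of_real (heat_mult (\<nu> * s) n) * cf (lap j 0) n) x - lap j 0 x)"
        using \<nu>_positive by (simp add: norm_mult flip: right_diff_distrib)
      also have "\<dots> \<le> \<nu> * (e / \<nu>)"
        using d(2)[of s] s t \<nu>_positive by (intro mult_left_mono) auto
      finally show "norm (of_real \<nu> * series (\<lambda>n. of_real (heat_mult (\<nu> * s) n) * cf (lap j 0) n) x - of_real \<nu> * lap j 0 x) \<le> e"
        using \<nu>_positive by simp
    qed (use t in simp)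
    then show ?thesis by (simp add: h0)
  qed
  then show ?thesis unfolding eventually_at_right_field using d(1) by blast
qed

definition duh :: "real \<Rightarrow> int^3 \<Rightarrow> real" where
  "duh t n = norm (solution t n - heat t n *\<^sub>R coeff u0 n)"

lemma duh_nonneg: "0 \<le> duh t n" by (simp add: duh_def)

lemma duh_le:
  assumes "t \<in> {0..T}"
  shows "duh t n \<le> 2 * t * norm (freq n) * majorant_sq n" "norm (freq n) * duh t n \<le> 2 / \<nu> * majorant_sq n"
  using norm_solution_minus_heat_le[of majorant_lim, OF _ majorant_lim_summable assms, of n]
    order_trans[OF solution_bound mult_right_mono[of _ 1]] majorant_lim_nonneg
  by (force simp: duh_def majorant_sq_def)+

lemma duh_le_freq: "t \<in> {0..T} \<Longrightarrow> duh t n \<le> gap * (norm (freq n) * duh t n)"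
proof (cases "n = 0")
  case True
  assume "t \<in> {0..T}" then show ?thesis using duh_le(1)[of t n] True by simp
next
  case False
  have "1 * duh t n \<le> (gap * norm (freq n)) * duh t n"
    using one_plus_freq_le[OF False] norm_ge_zero[of "freq n"] by (intro mult_right_mono duh_nonneg) linarith
  then show ?thesis by simp
qed

lemma freq_duh_summable: "t \<in> {0..T} \<Longrightarrow> (\<lambda>n. norm (freq n) * duh t n) summable_on UNIV"
  by (rule summable_on_comparison_test[OF summable_on_cmult_right[OF majorant_sq_summable] duh_le(2)])
    (auto simp: duh_nonneg)

text \<open>Each term is of order \<open>t\<close> by the first bound of \<open>duh_le\<close>, and
  the second bound dominates all of them by a summable sequence independent of
  \<open>t\<close>.\<close>

lemma freq_duh_tendsto: "((\<lambda>t. \<Sum>\<^sub>\<infinity>n. norm (freq n) * duh t n) \<longlongrightarrow> 0) (at_right 0)"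
proof -
  have "((\<lambda>t. \<Sum>\<^sub>\<infinity>n. norm (freq n) * duh t n) \<longlongrightarrow> (\<Sum>\<^sub>\<infinity>n::int^3. 0)) (at_right 0)"
  proof (rule tendsto_infsum_dominated)
    show "(\<lambda>n. 2 / \<nu> * majorant_sq n) summable_on UNIV" by (rule summable_on_cmult_right[OF majorant_sq_summable])
    show "\<forall>\<^sub>F t in at_right 0. \<forall>n. norm (norm (freq n) * duh t n) \<le> 2 / \<nu> * majorant_sq n"
      using eventually_T
    proof eventually_elim
      case (elim t)
      then show ?case using duh_le(2)[of t] by (simp add: abs_mult duh_nonneg)
    qed
    fix n
    have "((\<lambda>t. norm (freq n) * (2 * t * norm (freq n) * majorant_sq n)) \<longlongrightarrow> norm (freq n) * (2 * 0 * norm (freq n) * majorant_sq n)) (at_right 0)"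
      by (intro tendsto_intros)
    then have l: "((\<lambda>t. norm (freq n) * (2 * t * norm (freq n) * majorant_sq n)) \<longlongrightarrow> 0) (at_right 0)" by simp
    show "((\<lambda>t. norm (freq n) * duh t n) \<longlongrightarrow> 0) (at_right 0)"
    proof (rule Lim_null_comparison[OF _ l])
      show "\<forall>\<^sub>F t in at_right 0. norm (norm (freq n) * duh t n) \<le> norm (freq n) * (2 * t * norm (freq n) * majorant_sq n)"
        using eventually_T by eventually_elim (auto simp: abs_mult duh_nonneg intro!: mult_left_mono duh_le(1))
    qed
  qed
  then show ?thesis by simp
qed

lemma vc_minus_heat_le: "norm (vc j t n - of_real (heat_mult (\<nu> * t) n) * cf (U0 j) n) \<le> duh t n"
proof -
  have "vc j t n - of_real (heat_mult (\<nu> * t) n) * cf (U0 j) n = (solution t n - heat t n *\<^sub>R coeff u0 n) $ j"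
    by (simp add: vc_def cf_U0 heat_eq scaleR_conv_of_real[where 'a=complex])
  then show ?thesis unfolding duh_def by (simp only: Finite_Cartesian_Product.norm_nth_le)
qed

lemma vel_minus_hflow_le:
  assumes t: "t \<in> {0<..<T}"
  shows "norm (vel j t x - hflow j t x) \<le> gap * (\<Sum>\<^sub>\<infinity>n. norm (freq n) * duh t n)" (is ?A)
    and "norm (partial_deriv i (vel j t) x - series (\<lambda>n. of_real (heat_mult (\<nu> * t) n) * cf (partial_deriv i (U0 j)) n) x)
      \<le> (\<Sum>\<^sub>\<infinity>n. norm (freq n) * duh t n)" (is ?B)
proof -
  have t': "t \<in> {0..T}" "0 < t" "t \<le> T" using t by auto
  have \<tau>: "0 < \<nu> * t" using t' \<nu>_positive by simp
  have s: "(\<lambda>n. norm (freq n) * duh t n) summable_on UNIV" by (rule freq_duh_summable[OF t'(1)])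
  have "vel j t x - hflow j t x = series (\<lambda>n. vc j t n - of_real (heat_mult (\<nu> * t) n) * cf (U0 j) n) x"
    unfolding vel_def hflow_def
    by (rule series_diff[OF vc_abs_summable[OF t'(1)] heat_cf_summable[OF U0_continuous_periodic(1) \<tau>], symmetric])
  also have "norm \<dots> \<le> (\<Sum>\<^sub>\<infinity>n. gap * (norm (freq n) * duh t n))"
    unfolding series_def
    by (rule norm_infsum_le_infsum[OF summable_on_cmult_right[OF s]])
      (auto simp: norm_mult intro: order_trans[OF vc_minus_heat_le duh_le_freq[OF t'(1)]])
  finally show ?A by (simp add: infsum_cmult_right')
  have "partial_deriv i (vel j t) x - series (\<lambda>n. of_real (heat_mult (\<nu> * t) n) * cf (partial_deriv i (U0 j)) n) x
      = series (\<lambda>n. deriv_coeff i (vc j t) n - of_real (heat_mult (\<nu> * t) n) * cf (partial_deriv i (U0 j)) n) x"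
    unfolding partial_vel[OF t'(2,3)]
    by (rule series_diff[OF deriv_vc_summable(1)[OF t'(2,3)] heat_cf_summable[OF U0_continuous_periodic(2) \<tau>], symmetric])
  also have "norm \<dots> \<le> (\<Sum>\<^sub>\<infinity>n. norm (freq n) * duh t n)"
    unfolding series_def
  proof (rule norm_infsum_le_infsum[OF s])
    fix n
    have "deriv_coeff i (vc j t) n - of_real (heat_mult (\<nu> * t) n) * cf (partial_deriv i (U0 j)) n
        = deriv_coeff i (\<lambda>n. vc j t n - of_real (heat_mult (\<nu> * t) n) * cf (U0 j) n) n"
      by (simp add: cf_partial_U0 deriv_coeff_def algebra_simps)
    also have "norm \<dots> \<le> norm (freq n) * duh t n"
      by (rule order_trans[OF norm_deriv_coeff_le mult_left_mono[OF vc_minus_heat_le]]) simp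
    finally show "norm ((deriv_coeff i (vc j t) n - of_real (heat_mult (\<nu> * t) n) * cf (partial_deriv i (U0 j)) n) * wave n x)
        \<le> norm (freq n) * duh t n" by (simp add: norm_mult)
  qed
  finally show ?B .
qed

text \<open>The heat flow of the datum and of its gradient converges uniformly because both are
  continuous; the remainder is bounded by the sum of \<open>norm (freq n) * duh t n\<close>.\<close>

lemma vel_uniform_limit: "uniform_limit UNIV (\<lambda>t. vel j t) (vel j 0) (at_right 0)"
  and partial_vel_uniform_limit: "uniform_limit UNIV (\<lambda>t. partial_deriv i (vel j t)) (partial_deriv i (vel j 0)) (at_right 0)"
proof -
  have 0: "uniform_limit UNIV (\<lambda>t x. vel j t x - hflow j t x) (\<lambda>x. 0) (at_right 0)"
  proof (rule uniform_limit_bound)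
    show "\<forall>\<^sub>F t in at_right 0. \<forall>x\<in>UNIV. norm (vel j t x - hflow j t x - 0) \<le> gap * (\<Sum>\<^sub>\<infinity>n. norm (freq n) * duh t n)"
      using eventually_T by eventually_elim (auto intro: vel_minus_hflow_le(1))
    show "((\<lambda>t. gap * (\<Sum>\<^sub>\<infinity>n. norm (freq n) * duh t n)) \<longlongrightarrow> 0) (at_right 0)"
      using tendsto_mult_left[OF freq_duh_tendsto, of gap] by simp
  qed
  show "uniform_limit UNIV (\<lambda>t. vel j t) (vel j 0) (at_right 0)"
    using uniform_limit_add[OF 0 heat_uniform_limit[OF U0_continuous_periodic(1) \<nu>_positive, of j, folded hflow_def]]
    by (simp add: vel_0)
  have 1: "uniform_limit UNIV (\<lambda>t x. partial_deriv i (vel j t) x - series (\<lambda>n. of_real (heat_mult (\<nu> * t) n) * cf (partial_deriv i (U0 j)) n) x) (\<lambda>x. 0) (at_right 0)"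
  proof (rule uniform_limit_bound[OF _ freq_duh_tendsto])
    show "\<forall>\<^sub>F t in at_right 0. \<forall>x\<in>UNIV. norm (partial_deriv i (vel j t) x - series (\<lambda>n. of_real (heat_mult (\<nu> * t) n) * cf (partial_deriv i (U0 j)) n) x - 0)
      \<le> (\<Sum>\<^sub>\<infinity>n. norm (freq n) * duh t n)"
      using eventually_T by eventually_elim (auto intro: vel_minus_hflow_le(2))
  qed
  show "uniform_limit UNIV (\<lambda>t. partial_deriv i (vel j t)) (partial_deriv i (vel j 0)) (at_right 0)"
    using uniform_limit_add[OF 1 heat_uniform_limit[OF U0_continuous_periodic(2) \<nu>_positive, of i j]]
    by (simp add: vel_0)
qed

section \<open>An H^2 bound uniform in time\<close>

lemma norm_coeff_square: "(norm (coeff u0 n))\<^sup>2 = (\<Sum>j\<in>UNIV. (norm (cf (U0 j) n))\<^sup>2)"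
  by (simp add: norm_vec_def L2_set_def sum_nonneg cf_U0)

lemma coeff_H2: "(\<lambda>n. (norm (freq n) ^ 2 * norm (coeff u0 n))\<^sup>2) summable_on UNIV"
proof -
  have "(norm (freq n) ^ 2 * norm (coeff u0 n))\<^sup>2 = (\<Sum>j\<in>UNIV. (norm (cf (lap j 0) n))\<^sup>2)" for n
    unfolding power_mult_distrib norm_coeff_square cf_lap_0
    by (simp add: norm_mult power_mult_distrib sum_distrib_left norm_power)
  then show ?thesis
    by (simp only:) (intro summable_on_sum bessel(1) lap_continuous_periodic T_mem)
qed

lemma coeff_H1: "(\<lambda>n. (norm (freq n) * norm (coeff u0 n))\<^sup>2) summable_on UNIV"
proof (rule summable_on_comparison_test)
  show "(\<lambda>n. (norm (coeff u0 n))\<^sup>2 + (norm (freq n) ^ 2 * norm (coeff u0 n))\<^sup>2) summable_on UNIV"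
    using summable_square[of "\<lambda>n. norm (coeff u0 n)"] coeff_summable coeff_H2 by (intro summable_on_add) auto
  fix n
  define r y where "r = norm (freq n)" and "y = norm (coeff u0 n)"
  have "2 * y * (r\<^sup>2 * y) \<le> y\<^sup>2 + (r\<^sup>2 * y)\<^sup>2" by (rule sum_squares_bound)
  moreover have "2 * y * (r\<^sup>2 * y) = 2 * (r * y)\<^sup>2" by (simp add: power2_eq_square)
  moreover have "0 \<le> (r * y)\<^sup>2" by simp
  ultimately show "(norm (freq n) * norm (coeff u0 n))\<^sup>2 \<le> (norm (coeff u0 n))\<^sup>2 + (norm (freq n) ^ 2 * norm (coeff u0 n))\<^sup>2"
    unfolding r_def y_def by linarith
qed simp

text \<open>The \<open>H\<^sup>2\<close> bound is obtained by feeding the smoothing of the Duhamel term back into itself.\<close>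

lemma solution_H2:
  obtains h where "\<And>n. 0 \<le> h n" "(\<lambda>n. (h n)\<^sup>2) summable_on UNIV"
    "\<And>t n. t \<in> {0..T} \<Longrightarrow> (norm (freq n))\<^sup>2 * norm (solution t n) \<le> h n"
proof -
  \<comment> \<open>The first gain of the smoothing: a bound independent of time whose second part
    is one power of the frequency better than \<open>majorant_sq\<close>. At frequency 0 that part
    is 0 and so is the Duhamel term.\<close>
  define b where "b n = norm (coeff u0 n) + 2 / \<nu> * (majorant_sq n / norm (freq n))" for n
  have sol: "norm (solution t n) \<le> norm (coeff u0 n) + duh t n" if "t \<in> {0..T}" for t n
  proof -
    have "norm (solution t n) \<le> norm (heat t n *\<^sub>R coeff u0 n) + duh t n"
      unfolding duh_def by (metis add.commute diff_add_cancel norm_triangle_ineq)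
    moreover have "norm (heat t n *\<^sub>R coeff u0 n) \<le> norm (coeff u0 n)"
      using that \<nu>_positive by (simp add: heat_eq heat_mult_nonneg heat_mult_le_1 mult_left_le_one_le)
    ultimately show ?thesis by linarith
  qed
  have b: "norm (solution t n) \<le> b n" if "t \<in> {0..T}" for t n
  proof -
    have "duh t n \<le> 2 / \<nu> * (majorant_sq n / norm (freq n))"
    proof (cases "n = 0")
      case True then show ?thesis using duh_le(1)[OF that, of n] by simp
    next
      case False
      then have p: "0 < norm (freq n)" by (simp add: freq_eq_0_iff)
      have "duh t n * norm (freq n) \<le> 2 / \<nu> * majorant_sq n"
        using duh_le(2)[OF that, of n] by (simp only: mult.commute)
      then have "duh t n \<le> (2 / \<nu> * majorant_sq n) / norm (freq n)" by (simp only: pos_le_divide_eq[OF p])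
      then show ?thesis by simp
    qed
    then show ?thesis using sol[OF that, of n] by (simp add: b_def)
  qed
  have msq: "majorant_sq n / norm (freq n) \<le> gap * majorant_sq n" for n
  proof (cases "n = 0")
    case False
    then have p: "0 < norm (freq n)" by (simp add: freq_eq_0_iff)
    have "majorant_sq n * 1 \<le> majorant_sq n * (gap * norm (freq n))"
      using one_plus_freq_le[OF False] p by (intro mult_left_mono majorant_sq_nonneg) linarith
    then show ?thesis using p by (simp add: divide_le_eq mult_ac)
  qed (use gap_pos majorant_sq_nonneg in simp)
  have b_nonneg: "0 \<le> b n" for n
    using \<nu>_positive majorant_sq_nonneg[of n] by (simp add: b_def)
  have "(\<lambda>n. majorant_sq n / norm (freq n)) summable_on UNIV"
    by (rule summable_on_comparison_test[OF summable_on_cmult_right[OF majorant_sq_summable] msq])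
      (simp add: majorant_sq_nonneg)
  then have b_summable: "b summable_on UNIV"
    unfolding b_def by (intro summable_on_add coeff_summable summable_on_cmult_right)
  \<comment> \<open>The first-order part of the bound: \<open>f\<close> is square summable because
    the datum is in H^1 and \<open>majorant_sq\<close> is summable, hence square summable.\<close>
  define f where "f n = norm (freq n) * b n" for n
  have f_nonneg: "0 \<le> f n" for n by (simp add: f_def b_nonneg)
  have f_le: "f n \<le> norm (freq n) * norm (coeff u0 n) + 2 / \<nu> * majorant_sq n" for n
    using \<nu>_positive majorant_sq_nonneg[of n] by (cases "n = 0") (simp_all add: f_def b_def distrib_left freq_eq_0_iff)
  have f2: "(\<lambda>n. (f n)\<^sup>2) summable_on UNIV"
  proof (rule summable_on_comparison_test)
    have "(\<lambda>n. (2 / \<nu> * majorant_sq n)\<^sup>2) summable_on UNIV"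
      using \<nu>_positive majorant_sq_nonneg by (intro summable_square summable_on_cmult_right majorant_sq_summable) simp
    then show "(\<lambda>n. 2 * (norm (freq n) * norm (coeff u0 n))\<^sup>2 + 2 * (2 / \<nu> * majorant_sq n)\<^sup>2) summable_on UNIV"
      by (intro summable_on_add summable_on_cmult_right coeff_H1)
    fix n
    show "(f n)\<^sup>2 \<le> 2 * (norm (freq n) * norm (coeff u0 n))\<^sup>2 + 2 * (2 / \<nu> * majorant_sq n)\<^sup>2"
      by (rule order_trans[OF power_mono[OF f_le f_nonneg] power2_sum_le])
  qed simp
  have bs: "b abs_summable_on UNIV" using b_summable b_nonneg by simp
  \<comment> \<open>The triangle inequality distributes the factor over the two sequences, a
    discrete Leibniz rule. Young's inequality then applies to \<open>f\<close> and \<open>b\<close>,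
    one square summable and the other summable.\<close>
  have freq_conv: "norm (freq n) * conv b b n \<le> 2 * conv f b n" for n
  proof -
    have s1: "(\<lambda>m. f (n - m) * b m) summable_on UNIV" by (rule young_l2_l1(1)[OF f_nonneg f2 b_nonneg b_summable])
    have bij: "bij_betw (\<lambda>m. n - m) UNIV UNIV" by (rule bij_betwI[where g="\<lambda>m. n - m"]) auto
    have s2: "(\<lambda>m. b (n - m) * f m) summable_on UNIV"
      using summable_on_reindex_bij_betw[OF bij, of "\<lambda>m. f (n - m) * b m"] s1 by (simp add: mult.commute)
    have "norm (freq n) * conv b b n = (\<Sum>\<^sub>\<infinity>m. norm (freq n) * (b (n - m) * b m))"
      by (simp add: conv_def infsum_cmult_right')
    also have "\<dots> \<le> (\<Sum>\<^sub>\<infinity>m. f (n - m) * b m + b (n - m) * f m)"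
    proof (rule infsum_mono)
      show "(\<lambda>m. norm (freq n) * (b (n - m) * b m)) summable_on UNIV"
        by (intro summable_on_cmult_right abs_summable_summable[OF conv_summand_abs_summable[OF bs bs]])
      show "(\<lambda>m. f (n - m) * b m + b (n - m) * f m) summable_on UNIV" by (intro summable_on_add s1 s2)
      fix m
      have "norm (freq n) * (b (n - m) * b m) \<le> (norm (freq (n - m)) + norm (freq m)) * (b (n - m) * b m)"
        by (intro mult_right_mono norm_freq_triangle mult_nonneg_nonneg b_nonneg)
      then show "norm (freq n) * (b (n - m) * b m) \<le> f (n - m) * b m + b (n - m) * f m"
        by (simp add: f_def algebra_simps)
    qed
    also have "\<dots> = conv f b n + conv b f n" unfolding conv_def by (rule infsum_add[OF s1 s2])
    finally show ?thesis by (simp add: conv_commute[of b f])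
  qed
  define h where "h n = norm (freq n) ^ 2 * norm (coeff u0 n) + 4 / \<nu> * conv f b n" for n
  have cfb: "0 \<le> conv f b n" for n by (intro conv_nonneg f_nonneg b_nonneg)
  show ?thesis
  proof (rule that[of h])
    show "0 \<le> h n" for n using cfb[of n] \<nu>_positive by (simp add: h_def)
    show "(\<lambda>n. (h n)\<^sup>2) summable_on UNIV"
    proof (rule summable_on_comparison_test)
      show "(\<lambda>n. 2 * (norm (freq n) ^ 2 * norm (coeff u0 n))\<^sup>2 + 2 * ((4 / \<nu>)\<^sup>2 * (conv f b n)\<^sup>2)) summable_on UNIV"
        by (intro summable_on_add summable_on_cmult_right coeff_H2 young_l2_l1(2)[OF f_nonneg f2 b_nonneg b_summable])
      show "(h n)\<^sup>2 \<le> 2 * (norm (freq n) ^ 2 * norm (coeff u0 n))\<^sup>2 + 2 * ((4 / \<nu>)\<^sup>2 * (conv f b n)\<^sup>2)" for n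
        unfolding h_def power_mult_distrib[of "4 / \<nu>", symmetric] by (rule power2_sum_le)
    qed simp
    fix t n assume t: "t \<in> {0..T}"
    \<comment> \<open>The second gain: the Duhamel estimate is used again, now with \<open>b\<close>
      in place of \<open>majorant_lim\<close>.\<close>
    have "norm (freq n) * duh t n \<le> 2 / \<nu> * conv b b n"
      unfolding duh_def by (rule norm_solution_minus_heat_le(2)[OF b b_summable t])
    then have "norm (freq n) * (norm (freq n) * duh t n) \<le> norm (freq n) * (2 / \<nu> * conv b b n)"
      by (rule mult_left_mono) simp
    also have "\<dots> = 2 / \<nu> * (norm (freq n) * conv b b n)" by simp
    also have "\<dots> \<le> 2 / \<nu> * (2 * conv f b n)"
      using \<nu>_positive by (intro mult_left_mono freq_conv) auto
    finally have "(norm (freq n))\<^sup>2 * duh t n \<le> 4 / \<nu> * conv f b n" by (simp add: power2_eq_square mult.assoc)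
    moreover have "(norm (freq n))\<^sup>2 * norm (solution t n) \<le> (norm (freq n))\<^sup>2 * (norm (coeff u0 n) + duh t n)"
      by (intro mult_left_mono sol t) simp
    ultimately show "(norm (freq n))\<^sup>2 * norm (solution t n) \<le> h n"
      by (simp add: h_def distrib_left)
  qed
qed

end

section \<open>The time derivative at the initial time\<close>

context navier_stokes_data
begin

text \<open>Parseval turns the pointwise H^2 bound on the coefficients into a mean square bound on
  second derivatives. The point is that \<open>H\<close> does not depend on \<open>t\<close>, down
  to time 0.\<close>

lemma hess_mean_bound:
  obtains H where "H \<ge> 0"
    "\<And>t l i j. 0 < t \<Longrightarrow> t \<le> T \<Longrightarrow> mean (\<lambda>x. (norm (partial_deriv l (partial_deriv i (vel j t)) x))\<^sup>2) \<le> H"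
proof -
  obtain h where h: "\<And>n. 0 \<le> h n" "(\<lambda>n. (h n)\<^sup>2) summable_on UNIV"
    "\<And>t n. t \<in> {0..T} \<Longrightarrow> (norm (freq n))\<^sup>2 * norm (solution t n) \<le> h n" using solution_H2 by blast
  show ?thesis
  proof (rule that[of "\<Sum>\<^sub>\<infinity>n. (h n)\<^sup>2"])
    show "0 \<le> (\<Sum>\<^sub>\<infinity>n. (h n)\<^sup>2)" by (intro infsum_nonneg) simp
    fix t l i j assume t: "0 < t" "t \<le> T"
    have le: "norm (deriv_coeff l (deriv_coeff i (vc j t)) n) \<le> h n" for n
    proof -
      have "norm (deriv_coeff l (deriv_coeff i (vc j t)) n) \<le> norm (freq n) * (norm (freq n) * norm (solution t n))"
        by (intro order_trans[OF norm_deriv_coeff_le mult_left_mono] order_trans[OF norm_deriv_coeff_le mult_left_mono] norm_vc_le) auto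
      also have "\<dots> \<le> h n" using h(3)[of t n] t by (simp add: power2_eq_square mult.assoc)
      finally show ?thesis .
    qed
    have "(\<Sum>\<^sub>\<infinity>n. (norm (deriv_coeff l (deriv_coeff i (vc j t)) n))\<^sup>2) \<le> (\<Sum>\<^sub>\<infinity>n. (h n)\<^sup>2)"
    proof (rule infsum_mono[OF _ h(2)])
      show le2: "(norm (deriv_coeff l (deriv_coeff i (vc j t)) n))\<^sup>2 \<le> (h n)\<^sup>2" for n
        by (rule power_mono[OF le]) simp
      show "(\<lambda>n. (norm (deriv_coeff l (deriv_coeff i (vc j t)) n))\<^sup>2) summable_on UNIV"
        by (rule summable_on_comparison_test[OF h(2) le2]) simp
    qed
    then show "mean (\<lambda>x. (norm (partial_deriv l (partial_deriv i (vel j t)) x))\<^sup>2) \<le> (\<Sum>\<^sub>\<infinity>n. (h n)\<^sup>2)"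
      unfolding partial2_vel[OF t] mean_norm_square_series[OF deriv_vc_summable(2)[OF t]] .
  qed
qed

lemma partial_vel_eventually_bounded:
  obtains M where "M > 0" "\<forall>\<^sub>F t in at_right 0. \<forall>i j x. norm (partial_deriv i (vel j t) x) \<le> M"
proof -
  have "\<exists>M. \<forall>x. norm (partial_deriv i (vel j 0) x) \<le> M" for i j
    using continuous_periodic_bounded[OF vel_deriv_continuous_periodic(1)[OF T_mem]] by metis
  then obtain m where m: "\<And>i j x. norm (partial_deriv i (vel j 0) x) \<le> m i j" by metis
  define M where "M = (\<Sum>i\<in>UNIV. \<Sum>j\<in>UNIV. \<bar>m i j\<bar>) + 1"
  have mM: "m i j + 1 \<le> M" for i j
  proof -
    have "m i j \<le> \<bar>m i j\<bar>" by simp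
    also have "\<dots> \<le> (\<Sum>j\<in>UNIV. \<bar>m i j\<bar>)" by (rule member_le_sum) auto
    also have "\<dots> \<le> (\<Sum>i\<in>UNIV. \<Sum>j\<in>UNIV. \<bar>m i j\<bar>)"
      by (rule member_le_sum[of i UNIV "\<lambda>i. \<Sum>j\<in>UNIV. \<bar>m i j\<bar>"]) (auto intro: sum_nonneg)
    finally show ?thesis by (simp add: M_def)
  qed
  have "\<forall>\<^sub>F t in at_right 0. \<forall>x\<in>UNIV. dist (partial_deriv i (vel j t) x) (partial_deriv i (vel j 0) x) < 1" for i j
    by (rule uniform_limitD[OF partial_vel_uniform_limit]) simp
  then have "\<forall>\<^sub>F t in at_right 0. \<forall>i j. \<forall>x\<in>UNIV. dist (partial_deriv i (vel j t) x) (partial_deriv i (vel j 0) x) < 1"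
    by (intro eventually_all_finite)
  then have "\<forall>\<^sub>F t in at_right 0. \<forall>i j x. norm (partial_deriv i (vel j t) x) \<le> M"
  proof eventually_elim
    case (elim t)
    show ?case
    proof (intro allI)
      fix i j x
      have "norm (partial_deriv i (vel j t) x) \<le> norm (partial_deriv i (vel j 0) x) + dist (partial_deriv i (vel j t) x) (partial_deriv i (vel j 0) x)"
        unfolding dist_norm by (rule norm_triangle_sub)
      then show "norm (partial_deriv i (vel j t) x) \<le> M"
        using elim[rule_format, OF UNIV_I, of i j x] m[of i j x] mM[of i j] by linarith
    qed
  qed
  moreover have "M > 0" by (simp add: M_def add_nonneg_pos sum_nonneg)
  ultimately show ?thesis using that by blast
qed

text \<open>A derivative of the source is a sum of products of a first and a second derivative of
  the velocity. The first derivatives are bounded uniformly near time 0, the second ones in mean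
  square.\<close>

lemma press_source_H1_bound:
  obtains C where "C \<ge> 0" "\<forall>\<^sub>F t in at_right 0. (\<Sum>\<^sub>\<infinity>n. (norm (freq n))\<^sup>2 * (norm (cf (press_source t) n))\<^sup>2) \<le> C"
proof -
  obtain H where H: "H \<ge> 0"
    "\<And>t l i j. 0 < t \<Longrightarrow> t \<le> T \<Longrightarrow> mean (\<lambda>x. (norm (partial_deriv l (partial_deriv i (vel j t)) x))\<^sup>2) \<le> H"
    using hess_mean_bound by blast
  obtain M where M: "M > 0" "\<forall>\<^sub>F t in at_right 0. \<forall>i j x. norm (partial_deriv i (vel j t) x) \<le> M"
    using partial_vel_eventually_bounded by blast
  \<comment> \<open>The 3 counts the directions of differentiation. In \<open>36 * M\<^sup>2\<close>
    the 4 is the square of the 2 from the product rule and the 9 comes from the square of a sum of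
    nine terms; \<open>9 * H\<close> bounds the mean of the nine squares.\<close>
  define C where "C = 3 * (36 * M\<^sup>2 * (9 * H))"
  have "\<forall>\<^sub>F t in at_right 0. (\<Sum>\<^sub>\<infinity>n. (norm (freq n))\<^sup>2 * (norm (cf (press_source t) n))\<^sup>2) \<le> C"
    using M(2) eventually_T
  proof eventually_elim
    case (elim t)
    then have t: "t \<in> {0..T}" "0 < t" "t \<le> T" by auto
    have bM: "norm (partial_deriv i (vel j t) x) \<le> M" for i j x using elim by blast
    have k: "mean (\<lambda>x. (norm (partial_deriv k (press_source t) x))\<^sup>2) \<le> 36 * M\<^sup>2 * (9 * H)" for k
    proof -
      define a where "a i l x = norm (partial_deriv k (partial_deriv i (vel l t)) x)" for i l x
      define Q where "Q x = (\<Sum>p\<in>UNIV. (a (fst p) (snd p) x)\<^sup>2)" for x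
      have pw: "(norm (partial_deriv k (press_source t) x))\<^sup>2 \<le> 36 * M\<^sup>2 * Q x" for x
      proof -
        have "norm (partial_deriv k (press_source t) x) \<le> (\<Sum>i\<in>UNIV. \<Sum>l\<in>UNIV. M * a i l x + M * a l i x)"
          unfolding partial_press_source(1)[OF t(1)]
        proof (intro sum_norm_le)
          fix i l
          show "norm (partial_deriv l (vel i t) x * partial_deriv k (partial_deriv i (vel l t)) x
              + partial_deriv k (partial_deriv l (vel i t)) x * partial_deriv i (vel l t) x) \<le> M * a i l x + M * a l i x"
          proof (rule norm_triangle_le[OF add_mono])
            show "norm (partial_deriv l (vel i t) x * partial_deriv k (partial_deriv i (vel l t)) x) \<le> M * a i l x"
              by (simp add: a_def norm_mult bM mult_right_mono)
            show "norm (partial_deriv k (partial_deriv l (vel i t)) x * partial_deriv i (vel l t) x) \<le> M * a l i x"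
              using mult_right_mono[OF bM[of i l x], of "a l i x"] by (simp add: a_def norm_mult mult.commute)
          qed
        qed
        also have "\<dots> = 2 * M * (\<Sum>i\<in>UNIV. \<Sum>l\<in>UNIV. a i l x)"
        proof -
          have "(\<Sum>i\<in>UNIV. \<Sum>l\<in>UNIV. a l i x) = (\<Sum>i\<in>UNIV. \<Sum>l\<in>UNIV. a i l x)" by (rule sum.swap)
          then show ?thesis by (simp add: sum.distrib flip: sum_distrib_left)
        qed
        also have "(\<Sum>i\<in>UNIV. \<Sum>l\<in>UNIV. a i l x) = (\<Sum>p\<in>UNIV. a (fst p) (snd p) x)"
          by (simp add: sum.cartesian_product case_prod_unfold)
        finally have "(norm (partial_deriv k (press_source t) x))\<^sup>2 \<le> (2 * M * (\<Sum>p\<in>UNIV. a (fst p) (snd p) x))\<^sup>2"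
          by (rule power_mono) simp
        also have "\<dots> = 4 * M\<^sup>2 * (\<Sum>p\<in>UNIV. a (fst p) (snd p) x)\<^sup>2" by (simp add: power_mult_distrib)
        also have "\<dots> \<le> 4 * M\<^sup>2 * (Q x * 9)"
        proof (intro mult_left_mono)
          have "(\<Sum>p\<in>(UNIV :: (3 \<times> 3) set). a (fst p) (snd p) x)\<^sup>2 \<le> (\<Sum>p\<in>UNIV. (a (fst p) (snd p) x)\<^sup>2) * card (UNIV :: (3 \<times> 3) set)"
            by (rule sum_squared_le_sum_of_squares)
          moreover have "card (UNIV :: (3 \<times> 3) set) = 9"
            by (simp add: card_cartesian_product flip: UNIV_Times_UNIV)
          ultimately show "(\<Sum>p\<in>UNIV. a (fst p) (snd p) x)\<^sup>2 \<le> Q x * 9" by (simp add: Q_def)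
        qed simp
        finally show ?thesis by simp
      qed
      have ca: "continuous_periodic L (\<lambda>x. (a (fst p) (snd p) x)\<^sup>2)" for p
        unfolding a_def by (intro continuous_periodic_norm_square vel_deriv_continuous_periodic t)
      have cQ: "continuous_periodic L Q" unfolding Q_def by (intro continuous_periodic_sum ca)
      have "mean (\<lambda>x. (norm (partial_deriv k (press_source t) x))\<^sup>2) \<le> mean (\<lambda>x. 36 * M\<^sup>2 * Q x)"
        by (rule mean_mono[OF continuous_periodic_norm_square[OF partial_press_source_continuous_periodic[OF t(1)]]
            continuous_periodic_mult[OF continuous_periodic_const cQ] pw])
      also have "\<dots> = 36 * M\<^sup>2 * mean Q" by (rule mean_bounded_linear[OF bounded_linear_mult_right cQ])
      also have "mean Q = (\<Sum>p\<in>UNIV. mean (\<lambda>x. (a (fst p) (snd p) x)\<^sup>2))" unfolding Q_def by (rule mean_sum[OF ca])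
      also have "\<dots> \<le> (\<Sum>p\<in>(UNIV :: (3 \<times> 3) set). H)"
        unfolding a_def by (intro sum_mono H t)
      also have "\<dots> = 9 * H" by (simp add: card_cartesian_product flip: UNIV_Times_UNIV)
      finally show ?thesis by (simp add: mult_left_mono)
    qed
    have "(\<Sum>k\<in>UNIV. mean (\<lambda>x. (norm (partial_deriv k (press_source t) x))\<^sup>2)) \<le> (\<Sum>k\<in>(UNIV::3 set). 36 * M\<^sup>2 * (9 * H))"
      by (intro sum_mono k)
    also have "\<dots> = C" by (simp add: C_def)
    finally show ?case using press_source_H1(2)[OF t(1)] by linarith
  qed
  moreover have "C \<ge> 0" using H(1) by (simp add: C_def)
  ultimately show ?thesis using that by blast
qed

lemma bounded_range_continuous_periodic:
  "continuous_periodic L f \<Longrightarrow> bounded (range f)"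
  using continuous_periodic_bounded[of f] by (metis bounded_iff rangeE)

lemma press_source_uniform_limit: "uniform_limit UNIV press_source (press_source 0) (at_right 0)"
  unfolding press_source_def[abs_def]
  by (intro uniform_limit_sum uniform_lim_mult partial_vel_uniform_limit bounded_range_continuous_periodic
      vel_deriv_continuous_periodic T_mem)

lemma conv_term_uniform_limit: "uniform_limit UNIV (conv_term j) (conv_term j 0) (at_right 0)"
  unfolding conv_term_def[abs_def]
  by (intro uniform_limit_sum uniform_lim_mult vel_uniform_limit partial_vel_uniform_limit bounded_range_continuous_periodic
      vel_deriv_continuous_periodic vel_continuous_periodic T_mem)

lemma cf_press_source_tendsto: "((\<lambda>t. norm (cf (press_source t) n - cf (press_source 0) n)) \<longlongrightarrow> 0) (at_right 0)"
proof (rule tendstoI)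
  fix e :: real assume e: "e > 0"
  then have "e / 2 > 0" by simp
  from uniform_limitD[OF press_source_uniform_limit this] eventually_T
  show "\<forall>\<^sub>F t in at_right 0. dist (norm (cf (press_source t) n - cf (press_source 0) n)) 0 < e"
  proof eventually_elim
    case (elim t)
    then have t: "t \<in> {0..T}" by auto
    have "norm (cf (\<lambda>x. press_source t x - press_source 0 x) n) \<le> e / 2"
      by (rule norm_cf_le[OF continuous_periodic_intros(2)[OF press_source_continuous_periodic[OF t] press_source_continuous_periodic[OF T_mem]]])
        (use elim in \<open>auto simp: dist_norm less_imp_le\<close>)
    then have "norm (cf (press_source t) n - cf (press_source 0) n) \<le> e / 2"
      by (simp only: cf_diff[OF press_source_continuous_periodic[OF t] press_source_continuous_periodic[OF T_mem]])
    then show ?case using e by simp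
  qed
qed

text \<open>Convergence of each coefficient together with the uniform \<open>H\<^sup>1\<close> bound is enough, because
  \<open>1 / \<bar>\<xi>\<bar>\<^sup>4\<close> is summable over the three dimensional lattice.\<close>

lemma press_source_l1_tendsto:
  "((\<lambda>t. \<Sum>\<^sub>\<infinity>n. norm (cf (press_source t) n - cf (press_source 0) n) / norm (freq n)) \<longlongrightarrow> 0) (at_right 0)"
proof (rule tendstoI)
  fix e :: real assume e: "e > 0"
  obtain C where C: "C \<ge> 0" "\<forall>\<^sub>F t in at_right 0. (\<Sum>\<^sub>\<infinity>n. (norm (freq n))\<^sup>2 * (norm (cf (press_source t) n))\<^sup>2) \<le> C"
    using press_source_H1_bound by blast
  define C0 where "C0 = (\<Sum>\<^sub>\<infinity>n. (norm (freq n))\<^sup>2 * (norm (cf (press_source 0) n))\<^sup>2)"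
  have C0: "C0 \<ge> 0" unfolding C0_def by (intro infsum_nonneg) simp
  define C2 where "C2 = 2 * C + 2 * C0 + 1"
  have C2: "C2 > 0" using C(1) C0 by (simp add: C2_def)
  \<comment> \<open>\<open>C2\<close> bounds the H^1 sum of the differences, so the part weighted by
    \<open>\<epsilon>\<close> contributes at most \<open>e / 2\<close>. The 1 in \<open>C2\<close>
    only ensures that it is positive.\<close>
  define \<epsilon> where "\<epsilon> = e / (2 * C2)"
  have \<epsilon>: "\<epsilon> > 0" using e C2 by (simp add: \<epsilon>_def)
  define y where "y t n = norm (cf (press_source t) n - cf (press_source 0) n)" for t n
  \<comment> \<open>The term truncated at a summable level, so that dominated convergence applies to
    \<open>z\<close>; what is cut off is controlled by the H^1 bound.\<close>
  define z where "z t n = min (y t n / norm (freq n)) (1 / \<epsilon> * (1 / norm (freq n) ^ 4))" for t n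
  have z0: "0 \<le> z t n" for t n using \<epsilon> by (simp add: z_def y_def)
  have zb: "(\<lambda>n. 1 / \<epsilon> * (1 / norm (freq n) ^ 4)) summable_on UNIV"
    by (rule summable_on_cmult_right[OF inverse_freq4_summable])
  have zs: "z t summable_on UNIV" for t
    by (rule summable_on_comparison_test[OF zb]) (simp_all add: z0, simp add: z_def)
  have "((\<lambda>t. \<Sum>\<^sub>\<infinity>n. z t n) \<longlongrightarrow> (\<Sum>\<^sub>\<infinity>n::int^3. 0)) (at_right 0)"
  proof (rule tendsto_infsum_dominated[OF _ _ zb])
    show "\<forall>\<^sub>F t in at_right 0. \<forall>n. norm (z t n) \<le> 1 / \<epsilon> * (1 / norm (freq n) ^ 4)"
      by (intro always_eventually allI) (simp only: real_norm_def abs_of_nonneg[OF z0], simp add: z_def)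
    fix n
    have l: "((\<lambda>t. y t n / norm (freq n)) \<longlongrightarrow> 0) (at_right 0)"
      using tendsto_divide_zero[OF cf_press_source_tendsto[of n], of "norm (freq n)"] by (simp add: y_def)
    show "((\<lambda>t. z t n) \<longlongrightarrow> 0) (at_right 0)"
      by (rule Lim_null_comparison[OF _ l]) (auto simp: z0 intro!: always_eventually, simp add: z_def)
  qed
  then have "\<forall>\<^sub>F t in at_right 0. dist (\<Sum>\<^sub>\<infinity>n. z t n) 0 < e / 2"
    using e by (intro tendstoD) auto
  then show "\<forall>\<^sub>F t in at_right 0. dist (\<Sum>\<^sub>\<infinity>n. norm (cf (press_source t) n - cf (press_source 0) n) / norm (freq n)) 0 < e"
    using C(2) eventually_T
  proof eventually_elim
    case (elim t)
    then have t: "t \<in> {0..T}" by auto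
    define q where "q n = (norm (freq n))\<^sup>2 * (y t n)\<^sup>2" for n
    have qle: "q n \<le> 2 * ((norm (freq n))\<^sup>2 * (norm (cf (press_source t) n))\<^sup>2) + 2 * ((norm (freq n))\<^sup>2 * (norm (cf (press_source 0) n))\<^sup>2)" for n
    proof -
      have "(y t n)\<^sup>2 \<le> (norm (cf (press_source t) n) + norm (cf (press_source 0) n))\<^sup>2"
        unfolding y_def by (intro power_mono norm_triangle_ineq4) simp
      also have "\<dots> \<le> 2 * (norm (cf (press_source t) n))\<^sup>2 + 2 * (norm (cf (press_source 0) n))\<^sup>2" by (rule power2_sum_le)
      finally have "q n \<le> (norm (freq n))\<^sup>2 * (2 * (norm (cf (press_source t) n))\<^sup>2 + 2 * (norm (cf (press_source 0) n))\<^sup>2)"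
        unfolding q_def by (rule mult_left_mono) simp
      then show ?thesis by (simp add: algebra_simps)
    qed
    have qb: "(\<lambda>n. 2 * ((norm (freq n))\<^sup>2 * (norm (cf (press_source t) n))\<^sup>2) + 2 * ((norm (freq n))\<^sup>2 * (norm (cf (press_source 0) n))\<^sup>2)) summable_on UNIV"
      by (intro summable_on_add summable_on_cmult_right press_source_H1(1) t T_mem)
    have qs: "q summable_on UNIV" by (rule summable_on_comparison_test[OF qb qle]) (simp add: q_def)
    have "(\<Sum>\<^sub>\<infinity>n. q n) \<le> (\<Sum>\<^sub>\<infinity>n. 2 * ((norm (freq n))\<^sup>2 * (norm (cf (press_source t) n))\<^sup>2) + 2 * ((norm (freq n))\<^sup>2 * (norm (cf (press_source 0) n))\<^sup>2))"
      by (rule infsum_mono[OF qs qb qle])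
    also have "\<dots> = 2 * (\<Sum>\<^sub>\<infinity>n. (norm (freq n))\<^sup>2 * (norm (cf (press_source t) n))\<^sup>2) + 2 * C0"
      using infsum_add[OF summable_on_cmult_right[OF press_source_H1(1)[OF t], of 2] summable_on_cmult_right[OF press_source_H1(1)[OF T_mem], of 2]]
      unfolding C0_def by (simp only: infsum_cmult_right')
    also have "\<dots> \<le> C2" using elim(2) by (simp add: C2_def)
    finally have qC: "(\<Sum>\<^sub>\<infinity>n. q n) \<le> C2" .
    \<comment> \<open>If the truncation is active, then with \<open>r = norm (freq n)\<close> the
      inequality says \<open>1 \<le> \<epsilon> * r ^ 3 * y t n\<close>, and multiplying by
      \<open>y t n / r\<close> bounds the term by \<open>\<epsilon> * q n\<close>.\<close>
    have main: "y t n / norm (freq n) \<le> \<epsilon> * q n + z t n" for n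
    proof (cases "y t n / norm (freq n) \<le> 1 / \<epsilon> * (1 / norm (freq n) ^ 4)")
      case True
      then show ?thesis using \<epsilon> by (simp add: z_def q_def min_def)
    next
      case False
      then have n0: "norm (freq n) \<noteq> 0" by (auto simp: zero_le_divide_iff)
      define r where "r = norm (freq n)"
      have r: "r > 0" using n0 by (simp add: r_def)
      have y0: "0 \<le> y t n" by (simp add: y_def)
      have "1 / \<epsilon> * (1 / r ^ 4) < y t n / r" using False by (simp add: r_def)
      then have "1 / \<epsilon> * (1 / r ^ 4) * (\<epsilon> * r ^ 4) \<le> y t n / r * (\<epsilon> * r ^ 4)"
        using \<epsilon> r by (intro mult_right_mono) auto
      then have "1 \<le> \<epsilon> * (r ^ 3 * y t n)" using \<epsilon> r by (simp add: power3_eq_cube power4_eq_xxxx mult_ac)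
      then have "1 * (y t n / r) \<le> \<epsilon> * (r ^ 3 * y t n) * (y t n / r)" using y0 r by (intro mult_right_mono) auto
      also have "\<dots> = \<epsilon> * q n" using r by (simp add: q_def r_def[symmetric] power2_eq_square power3_eq_cube)
      finally show ?thesis using z0[of t n] by (simp add: r_def)
    qed
    have ms: "(\<lambda>n. \<epsilon> * q n + z t n) summable_on UNIV" by (intro summable_on_add summable_on_cmult_right qs zs)
    have "(\<Sum>\<^sub>\<infinity>n. y t n / norm (freq n)) \<le> (\<Sum>\<^sub>\<infinity>n. \<epsilon> * q n + z t n)"
      by (rule infsum_mono[OF summable_on_comparison_test[OF ms main] ms main]) (simp add: y_def)
    also have "\<dots> = \<epsilon> * (\<Sum>\<^sub>\<infinity>n. q n) + (\<Sum>\<^sub>\<infinity>n. z t n)"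
      by (simp add: infsum_add summable_on_cmult_right qs zs infsum_cmult_right')
    also have "\<dots> < \<epsilon> * C2 + e / 2"
      using elim(1) qC \<epsilon> by (intro add_le_less_mono mult_left_mono) (auto simp: dist_real_def)
    also have "\<dots> = e" using C2 by (simp add: \<epsilon>_def)
    finally have "(\<Sum>\<^sub>\<infinity>n. y t n / norm (freq n)) < e" .
    moreover have "0 \<le> (\<Sum>\<^sub>\<infinity>n. y t n / norm (freq n))" by (intro infsum_nonneg) (simp add: y_def)
    ultimately show ?case by (simp add: y_def dist_real_def)
  qed
qed

lemma partial_press_uniform_limit:
  "uniform_limit UNIV (\<lambda>t. partial_deriv j (press t)) (partial_deriv j (press 0)) (at_right 0)"
proof (rule uniform_limit_bound[OF _ press_source_l1_tendsto])
  show "\<forall>\<^sub>F t in at_right 0. \<forall>x\<in>UNIV. norm (partial_deriv j (press t) x - partial_deriv j (press 0) x)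
      \<le> (\<Sum>\<^sub>\<infinity>n. norm (cf (press_source t) n - cf (press_source 0) n) / norm (freq n))"
    using eventually_T
  proof eventually_elim
    case (elim t)
    then have t: "t \<in> {0..T}" by auto
    show ?case
    proof
      fix x
      have "partial_deriv j (press t) x - partial_deriv j (press 0) x
          = series (\<lambda>n. deriv_coeff j (press_coeff t) n - deriv_coeff j (press_coeff 0) n) x"
        unfolding partial_press[OF t] partial_press[OF T_mem]
        by (rule series_diff[OF deriv_press_coeff_summable[OF t] deriv_press_coeff_summable[OF T_mem], symmetric])
      also have "norm \<dots> \<le> (\<Sum>\<^sub>\<infinity>n. norm (cf (press_source t) n - cf (press_source 0) n) / norm (freq n))"
        unfolding series_def
      proof (rule norm_infsum_le_infsum)
        have le: "norm (cf (press_source t) n - cf (press_source 0) n) / norm (freq n)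
            \<le> norm (cf (press_source t) n) / norm (freq n) + norm (cf (press_source 0) n) / norm (freq n)" for n
          unfolding add_divide_distrib[symmetric] by (intro divide_right_mono norm_triangle_ineq4) simp
        show "(\<lambda>n. norm (cf (press_source t) n - cf (press_source 0) n) / norm (freq n)) summable_on UNIV"
          by (rule summable_on_comparison_test[OF summable_on_add[OF press_source_div_freq_summable[OF t] press_source_div_freq_summable[OF T_mem]] le])
            simp
        fix n
        have "deriv_coeff j (press_coeff t) n - deriv_coeff j (press_coeff 0) n
            = deriv_coeff j (\<lambda>n. (cf (press_source t) n - cf (press_source 0) n) / of_real ((norm (freq n))\<^sup>2)) n"
          by (simp add: deriv_coeff_def press_coeff_def diff_divide_distrib algebra_simps)
        also have "norm \<dots> \<le> norm (freq n) * norm ((cf (press_source t) n - cf (press_source 0) n) / of_real ((norm (freq n))\<^sup>2))"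
          by (rule norm_deriv_coeff_le)
        also have "\<dots> = norm (cf (press_source t) n - cf (press_source 0) n) / norm (freq n)"
        proof -
          have "norm ((cf (press_source t) n - cf (press_source 0) n) / of_real ((norm (freq n))\<^sup>2))
              = norm (cf (press_source t) n - cf (press_source 0) n) / (norm (freq n))\<^sup>2"
            by (simp add: norm_divide norm_power)
          then show ?thesis by (simp add: power2_eq_square)
        qed
        finally show "norm ((deriv_coeff j (press_coeff t) n - deriv_coeff j (press_coeff 0) n) * wave n x)
            \<le> norm (cf (press_source t) n - cf (press_source 0) n) / norm (freq n)" by (simp add: norm_mult)
      qed
      finally show "norm (partial_deriv j (press t) x - partial_deriv j (press 0) x)
          \<le> (\<Sum>\<^sub>\<infinity>n. norm (cf (press_source t) n - cf (press_source 0) n) / norm (freq n))" .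
    qed
  qed
qed

lemma force_uniform_limit: "uniform_limit UNIV (force j) (force j 0) (at_right 0)"
  unfolding force_def[abs_def]
  by (rule uniform_limit_add[OF conv_term_uniform_limit partial_press_uniform_limit])

text \<open>Along \<open>s \<mapsto> exp (\<nu> (t - s) \<Delta>) u(s)\<close> the diffusion cancels.\<close>

lemma duhamel_flow_derivative:
  assumes t: "0 < s" "s < t" "t \<le> T"
  shows "((\<lambda>s. series (\<lambda>n. of_real (heat_mult (\<nu> * (t - s)) n) * vc j s n) x) has_vector_derivative
     - series (\<lambda>n. of_real (heat_mult (\<nu> * (t - s)) n) * quad_coeff j s n) x) (at s)"
proof -
  \<comment> \<open>The lower end keeps the bound on \<open>quad_coeff\<close> uniform. The upper
    end keeps the heat time \<open>\<nu> * (t - r)\<close> nonnegative.\<close>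
  define X where "X = {s / 2..t}"
  define c' where "c' r n = - (of_real (heat_mult (\<nu> * (t - r)) n) * quad_coeff j r n)" for r n
  have X: "convex X" "s \<in> X" "X \<subseteq> {0..T}" using t by (auto simp: X_def)
  have hX: "0 \<le> heat_mult (\<nu> * (t - r)) n" "heat_mult (\<nu> * (t - r)) n \<le> 1" if "r \<in> X" for r n
    using that \<nu>_positive by (auto simp: X_def heat_mult_nonneg intro!: heat_mult_le_1)
  have "((\<lambda>s. series (\<lambda>n. of_real (heat_mult (\<nu> * (t - s)) n) * vc j s n) x) has_vector_derivative series (c' s) x) (at s within X)"
  proof (rule series_has_vector_derivative[OF X(1,2)])
    fix n r assume r: "r \<in> X"
    have dh: "((\<lambda>r. complex_of_real (heat_mult (\<nu> * (t - r)) n)) has_vector_derivative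
        of_real (\<nu> * (norm (freq n))\<^sup>2 * heat_mult (\<nu> * (t - r)) n)) (at r within X)"
    proof -
      have "((\<lambda>r. heat_mult (\<nu> * (t - r)) n) has_real_derivative \<nu> * (norm (freq n))\<^sup>2 * heat_mult (\<nu> * (t - r)) n) (at r within X)"
        unfolding heat_mult_def by (auto intro!: derivative_eq_intros)
      then show ?thesis
        by (intro has_vector_derivative_of_real) (simp add: has_real_derivative_iff_has_vector_derivative)
    qed
    have dv: "((\<lambda>r. vc j r n) has_vector_derivative (- (\<nu> * (norm (freq n))\<^sup>2) *\<^sub>R vc j r n - quad_coeff j r n)) (at r within X)"
      using r X by (intro has_vector_derivative_within_subset[OF vc_vector_derivative]) auto
    show "((\<lambda>r. of_real (heat_mult (\<nu> * (t - r)) n) * vc j r n) has_vector_derivative c' r n) (at r within X)"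
      using has_vector_derivative_mult[OF dh dv] by (simp add: c'_def scaleR_conv_of_real algebra_simps)
    show "norm (c' r n) \<le> 2 * exp (s / 2) / (s / 2) * majorant_sq n"
    proof -
      have "norm (c' r n) \<le> norm (quad_coeff j r n)"
        using hX[OF r, of n] by (simp add: c'_def norm_mult mult_left_le_one_le)
      also have "\<dots> \<le> 2 * exp (s / 2) / (s / 2) * majorant_sq n"
        using r t by (intro quad_coeff_uniform_bound) (auto simp: X_def)
      finally show ?thesis .
    qed
  next
    show "(\<lambda>n. 2 * exp (s / 2) / (s / 2) * majorant_sq n) summable_on UNIV"
      by (rule summable_on_cmult_right[OF majorant_sq_summable])
    show "(\<lambda>n. of_real (heat_mult (\<nu> * (t - r)) n) * vc j r n) abs_summable_on UNIV" if "r \<in> X" for r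
      using that X hX[OF that] by (intro abs_summable_on_le[OF vc_abs_summable[of r j]]) (auto simp: norm_mult intro!: mult_left_le_one_le)
  qed
  moreover have "at s within X = at s"
    by (rule at_within_interior) (use t in \<open>simp add: X_def interior_atLeastAtMost_real\<close>)
  moreover have "series (c' s) x = - series (\<lambda>n. of_real (heat_mult (\<nu> * (t - s)) n) * quad_coeff j s n) x"
    by (simp add: series_def c'_def infsum_uminus)
  ultimately show ?thesis by simp
qed

text \<open>The derivative along the flow is minus a heat-damped \<open>force j s\<close>, with both
  the damping and \<open>s\<close> varying. It is compared with the same damping of
  \<open>force j r\<close> at a fixed time \<open>r\<close>: the contraction property bounds the
  difference, and \<open>heat_approximation\<close> removes the damping from the fixed
  function.\<close>

lemma duhamel_derivative_0:
  assumes e: "e > 0"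
  shows "eventually (\<lambda>t. norm (vel j t x - hflow j t x + t *\<^sub>R force j 0 x) \<le> t * e) (at_right 0)"
proof -
  have "\<forall>\<^sub>F t in at_right 0. \<forall>x\<in>UNIV. dist (force j t x) (force j 0 x) < e / 4"
    by (rule uniform_limitD[OF force_uniform_limit]) (use e in simp)
  then have "\<forall>\<^sub>F t in at_right 0. t \<in> {0<..<T} \<and> (\<forall>x\<in>UNIV. dist (force j t x) (force j 0 x) < e / 4)"
    using eventually_T by eventually_elim auto
  then obtain \<delta> where \<delta>: "\<delta> > 0" "\<And>s x. 0 < s \<Longrightarrow> s < \<delta> \<Longrightarrow> s < T \<and> norm (force j s x - force j 0 x) < e / 4"
    unfolding eventually_at_right_field dist_norm by auto
  \<comment> \<open>A positive reference time is taken instead of 0 because there the coefficients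
    of the force are absolutely summable and known to be \<open>quad_coeff j r\<close>.\<close>
  define r where "r = \<delta> / 2"
  have r: "0 < r" "r < \<delta>" "r \<le> T" using \<delta>(1) \<delta>(2)[of r] by (auto simp: r_def less_imp_le)
  have rT: "r \<in> {0..T}" using r by simp
  have cfF: "cf (force j r) = quad_coeff j r"
    using cf_series[OF quad_coeff_summable[OF r(1,3)]] by (simp add: series_quad_coeff[OF r(1,3)] fun_eq_iff)
  have e4: "e / 4 > 0" using e by simp
  obtain d where
    d: "d > 0" "\<And>\<tau> x. 0 < \<tau> \<Longrightarrow> \<tau> < d \<Longrightarrow> norm (series (\<lambda>n. of_real (heat_mult \<tau> n) * quad_coeff j r n) x - force j r x) < e / 4"
    by (rule heat_approximation[OF force_continuous_periodic[OF rT, of j] e4, unfolded cfF]) (rule that, assumption, blast)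
  have "norm (vel j t x - hflow j t x + t *\<^sub>R force j 0 x) \<le> t * e" if t: "0 < t" "t < min \<delta> (d / \<nu>)" for t
  proof -
    have tT: "t \<le> T" "t \<in> {0..T}" using \<delta>(2)[of t x] t by auto
    define \<Psi> where "\<Psi> s = series (\<lambda>n. of_real (heat_mult (\<nu> * (t - s)) n) * vc j s n) x" for s
    have "norm (\<Psi> t - \<Psi> 0 - t *\<^sub>R (- force j 0 x)) \<le> t * e"
    proof (rule norm_increment_le)
      show "continuous_on {0..t} \<Psi>"
        unfolding \<Psi>_def series_def
      proof (rule continuous_on_infsum[OF _ _ majorant_lim_summable])
        fix n
        have "continuous_on {0..T} (\<lambda>s. vc j s n)"
          using solution_continuous[of n] unfolding vc_def by (intro continuous_intros)
        then have "continuous_on {0..t} (\<lambda>s. vc j s n)" using tT by (auto elim: continuous_on_subset)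
        then show "continuous_on {0..t} (\<lambda>s. of_real (heat_mult (\<nu> * (t - s)) n) * vc j s n * wave n x)"
          unfolding heat_mult_def by (intro continuous_intros)
        fix s assume s: "s \<in> {0..t}"
        have "norm (of_real (heat_mult (\<nu> * (t - s)) n) * vc j s n * wave n x) \<le> norm (vc j s n)"
          using s \<nu>_positive by (auto simp: norm_mult heat_mult_nonneg intro!: mult_left_le_one_le heat_mult_le_1)
        also have "\<dots> \<le> majorant_lim n" using s tT by (intro vc_bound0) auto
        finally show "norm (of_real (heat_mult (\<nu> * (t - s)) n) * vc j s n * wave n x) \<le> majorant_lim n" .
      qed
      fix s assume s: "0 < s" "s < t"
      have sT: "s \<le> T" using s tT by simp
      define \<tau> where "\<tau> = \<nu> * (t - s)"
      have \<tau>: "0 < \<tau>" "\<tau> < d"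
      proof -
        have "\<tau> \<le> \<nu> * t" using s \<nu>_positive by (simp add: \<tau>_def)
        also have "\<dots> < d" using t \<nu>_positive by (simp add: less_divide_eq mult.commute)
        finally show "\<tau> < d" .
      qed (use s \<nu>_positive in \<open>simp add: \<tau>_def\<close>)
      show "(\<Psi> has_vector_derivative - series (\<lambda>n. of_real (heat_mult \<tau> n) * quad_coeff j s n) x) (at s)"
        unfolding \<Psi>_def \<tau>_def by (rule duhamel_flow_derivative[OF s tT(1)])
      have qs: "quad_coeff j s abs_summable_on UNIV" and qr: "quad_coeff j r abs_summable_on UNIV"
        using quad_coeff_summable s sT r by auto
      have hs: "(\<lambda>n. of_real (heat_mult \<tau> n) * c n) abs_summable_on UNIV" if "c abs_summable_on UNIV" for c :: "int^3 \<Rightarrow> complex"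
        by (rule abs_summable_on_le[OF that]) (use \<tau> in \<open>simp add: norm_mult heat_mult_nonneg heat_mult_le_1 mult_left_le_one_le\<close>)
      have ds: "(\<lambda>n. quad_coeff j s n - quad_coeff j r n) abs_summable_on UNIV"
        by (rule abs_summable_on_le[OF summable_on_add[OF qs qr]]) (rule norm_triangle_ineq4)
      have F: "norm (force j s x - force j 0 x) < e / 4" "norm (force j r x - force j 0 x) < e / 4" for x
        using \<delta>(2)[of s] \<delta>(2)[of r] s t r by auto
      have 1: "norm (series (\<lambda>n. of_real (heat_mult \<tau> n) * (quad_coeff j s n - quad_coeff j r n)) x) \<le> e / 4 + e / 4"
      proof (rule norm_series_heat_le[OF ds])
        fix x
        have "series (\<lambda>n. quad_coeff j s n - quad_coeff j r n) x = (force j s x - force j 0 x) - (force j r x - force j 0 x)"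
          using series_diff[OF qs qr] by (simp add: series_quad_coeff s(1) sT r)
        also have "norm \<dots> \<le> e / 4 + e / 4"
          by (rule order_trans[OF norm_triangle_ineq4 add_mono]) (use F in \<open>auto simp: less_imp_le\<close>)
        finally show "norm (series (\<lambda>n. quad_coeff j s n - quad_coeff j r n) x) \<le> e / 4 + e / 4" .
      qed (use \<tau> in simp)
      have 2: "series (\<lambda>n. of_real (heat_mult \<tau> n) * quad_coeff j s n) x
          = series (\<lambda>n. of_real (heat_mult \<tau> n) * (quad_coeff j s n - quad_coeff j r n)) x
            + series (\<lambda>n. of_real (heat_mult \<tau> n) * quad_coeff j r n) x"
        using series_add[OF hs[OF ds] hs[OF qr]] by (simp add: algebra_simps)
      have "norm (series (\<lambda>n. of_real (heat_mult \<tau> n) * quad_coeff j s n) x - force j 0 x)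
        \<le> norm (series (\<lambda>n. of_real (heat_mult \<tau> n) * (quad_coeff j s n - quad_coeff j r n)) x)
          + norm (series (\<lambda>n. of_real (heat_mult \<tau> n) * quad_coeff j r n) x - force j r x)
          + norm (force j r x - force j 0 x)"
        unfolding 2 by norm
      also have "\<dots> \<le> e" using 1 d(2)[OF \<tau>, of x] F(2)[of x] by linarith
      finally show "norm (- series (\<lambda>n. of_real (heat_mult \<tau> n) * quad_coeff j s n) x - - force j 0 x) \<le> e"
        by (simp add: norm_minus_commute)
    qed (use t in simp)
    moreover have "\<Psi> t = vel j t x" "\<Psi> 0 = hflow j t x"
      by (simp_all add: \<Psi>_def vel_def hflow_def vc_0)
    ultimately show ?thesis by simp
  qed
  moreover have "0 < min \<delta> (d / \<nu>)" using \<delta>(1) d(1) \<nu>_positive by simp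
  ultimately show ?thesis unfolding eventually_at_right_field by blast
qed

lemma vel_time_derivative_0:
  "((\<lambda>s. vel j s x) has_vector_derivative of_real \<nu> * lap j 0 x - force j 0 x) (at 0 within {0..T})"
proof -
  define D where "D = of_real \<nu> * lap j 0 x - force j 0 x"
  have "((\<lambda>t. (1 / t) *\<^sub>R (vel j t x - vel j 0 x - t *\<^sub>R D)) \<longlongrightarrow> 0) (at_right 0)"
  proof (rule tendstoI)
    fix e :: real assume e: "e > 0"
    then have e4: "e / 4 > 0" by simp
    from hflow_derivative_0[OF e4, of j x] duhamel_derivative_0[OF e4, of j x] eventually_T
    show "\<forall>\<^sub>F t in at_right 0. dist ((1 / t) *\<^sub>R (vel j t x - vel j 0 x - t *\<^sub>R D)) 0 < e"
    proof eventually_elim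
      case (elim t)
      then have t: "t > 0" by simp
      have "vel j t x - vel j 0 x - t *\<^sub>R D
          = (hflow j t x - U0 j x - t *\<^sub>R (of_real \<nu> * lap j 0 x)) + (vel j t x - hflow j t x + t *\<^sub>R force j 0 x)"
        by (simp add: D_def vel_0 algebra_simps)
      also have "norm \<dots> \<le> t * (e / 4) + t * (e / 4)" by (rule norm_triangle_le[OF add_mono[OF elim(1,2)]])
      also have "\<dots> < t * e" using t e by simp
      finally show ?case using t by (simp add: divide_less_eq mult.commute)
    qed
  qed
  moreover have "at 0 within {0..T} = at_right 0" by (rule at_within_Icc_at_right[OF T_positive])
  moreover have "eventually (\<lambda>t. (1 / t) *\<^sub>R (vel j t x - vel j 0 x - t *\<^sub>R D)
      = (1 / norm (t - 0)) *\<^sub>R (vel j t x - (vel j 0 x + (t - 0) *\<^sub>R D))) (at_right 0)"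
    using eventually_T by eventually_elim (simp add: algebra_simps)
  ultimately have "((\<lambda>t. (1 / norm (t - 0)) *\<^sub>R (vel j t x - (vel j 0 x + (t - 0) *\<^sub>R D))) \<longlongrightarrow> 0) (at 0 within {0..T})"
    using tendsto_cong by force
  then show ?thesis
    unfolding has_vector_derivative_def has_derivative_within D_def[symmetric]
    by (simp add: bounded_linear_scaleR_left)
qed

theorem vel_equation:
  assumes "t \<in> {0..T}"
  shows "((\<lambda>s. vel j s x) has_vector_derivative of_real \<nu> * lap j t x - force j t x) (at t within {0..T})"
  using assms vel_time_derivative[of t j x] vel_time_derivative_0[of j x] unfolding lap_def
  by (cases "t = 0") auto

end

section \<open>Hoelder norms and the existence time\<close>

lemma spatially_periodic_multi_deriv:
  fixes f :: "real^3 \<Rightarrow> 'b::real_normed_vector"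
  assumes "spatially_periodic L f" shows "spatially_periodic L (multi_deriv m f)"
proof -
  have "spatially_periodic L ((partial_deriv i ^^ j) f)" if "spatially_periodic L f" for i j and f :: "real^3 \<Rightarrow> 'b"
    by (induction j) (use that in \<open>auto intro: spatially_periodic_partial_deriv\<close>)
  then show ?thesis using assms by (simp add: multi_deriv_def)
qed

lemma multi_deriv_0: "multi_deriv 0 f = f"
  by (simp add: multi_deriv_def)

lemma multi_deriv_axis2: "multi_deriv (axis i 2) f = partial_deriv i (partial_deriv i f)"
  using exhaust_3[of i] by (auto simp: multi_deriv_def axis_def numeral_2_eq_2)

lemma mi_order_axis: "mi_order (axis i j) = j"
  by (simp add: mi_order_def axis_def if_distrib cong: if_cong)

context periodic_box
begin

text \<open>Each weighted supremum is one nonnegative summand of the norm, hence bounded by it;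
  periodicity extends the bound from the closed cube to the whole space.\<close>

lemma multi_deriv_le_holder_norm:
  assumes f: "f \<in> holder_space L k \<alpha>" and m: "mi_order m \<le> k"
  shows "norm (multi_deriv m f x) \<le> enn2real (holder_norm L k \<alpha> f) / L ^ mi_order m"
proof -
  define R where "R = enn2real (holder_norm L k \<alpha> f)"
  have R: "holder_norm L k \<alpha> f = ennreal R" "0 \<le> R"
    using f by (simp_all add: R_def holder_space_def)
  obtain c where c: "x + (\<chi> i. L * of_int (c $ i)) \<in> period_cube L" using wrap_in_cube by blast
  define y where "y = x + (\<chi> i. L * of_int (c $ i))"
  have eq: "multi_deriv m f y = multi_deriv m f x"
    unfolding y_def using f by (intro spatially_periodic_shift spatially_periodic_multi_deriv) (simp add: holder_space_def)
  have "ennreal (L ^ mi_order m) * ennreal (norm (multi_deriv m f y))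
      \<le> ennreal (L ^ mi_order m) * (SUP x\<in>period_cube L. ennreal (norm (multi_deriv m f x)))"
    using c by (intro mult_left_mono SUP_upper) (auto simp: y_def)
  also have "\<dots> \<le> Ck_norm L k f"
    unfolding Ck_norm_def
    by (rule member_le_sum[of m "{m. mi_order m \<le> k}" "\<lambda>m. ennreal (L ^ mi_order m) * (SUP x\<in>period_cube L. ennreal (norm (multi_deriv m f x)))"])
      (use m finite_mi_order_le in auto)
  also have "\<dots> \<le> ennreal R" unfolding R(1)[symmetric] holder_norm_def by simp
  finally have "ennreal (L ^ mi_order m * norm (multi_deriv m f x)) \<le> ennreal R"
    using L_pos by (simp add: ennreal_mult' eq)
  then have "L ^ mi_order m * norm (multi_deriv m f x) \<le> R" using R(2) by (simp add: ennreal_le_iff)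
  then show ?thesis using L_pos by (simp add: R_def le_divide_eq mult.commute)
qed

definition lattice_const :: real where "lattice_const = (\<Sum>\<^sub>\<infinity>n. 1 / (1 + norm (freq n)) ^ 4)"

text \<open>The coefficient is the product of \<open>(1 + r)\<^sup>2 * y\<close> and
  \<open>1 / (1 + r)\<^sup>2\<close>, where \<open>r\<close> is the frequency and \<open>y\<close>
  the modulus. The square of the first is at most
  \<open>8 * (y\<^sup>2 + (r\<^sup>2 * y)\<^sup>2)\<close>, summed by Bessel's inequality for
  \<open>f\<close> and its Laplacian; the square of the second is summable on the lattice.\<close>

lemma cf_l1_bound:
  assumes f: "spatially_periodic L f" "C_class 2 f"
    and S0: "\<And>x. norm (f x) \<le> S0" and S2: "\<And>x. norm (\<Sum>i\<in>UNIV. partial_deriv i (partial_deriv i f) x) \<le> S2"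
  shows "cf f abs_summable_on UNIV" and "(\<Sum>\<^sub>\<infinity>n. norm (cf f n)) \<le> 4 * (S0\<^sup>2 + S2\<^sup>2) + lattice_const / 2"
proof -
  have d: "f differentiable (at x)" "partial_deriv i f differentiable (at x)" for x i
    using f(2) by (simp_all add: numeral_2_eq_2)
  have c: "continuous_periodic L f" "continuous_periodic L (partial_deriv i f)" "continuous_periodic L (partial_deriv l (partial_deriv i f))" for i l
    using C_class_continuous[OF f(2)] f(2) f(1)
      spatially_periodic_partial_deriv[OF spatially_periodic_partial_deriv[OF f(1)]]
      spatially_periodic_partial_deriv[OF f(1)] C_class_continuous[of "Suc 0" "partial_deriv i f"]
    by (auto simp: continuous_periodic_def numeral_2_eq_2)
  define g where "g x = (\<Sum>i\<in>UNIV. partial_deriv i (partial_deriv i f) x)" for x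
  have cg: "continuous_periodic L g" unfolding g_def by (intro continuous_periodic_sum c)
  have cf1: "cf (partial_deriv i f) = deriv_coeff i (cf f)" for i
    using cf_partial_deriv[OF f(1) d(1), of i] c(2)[of i] by (simp add: fun_eq_iff deriv_coeff_def continuous_periodic_def)
  have cf2: "cf (partial_deriv i (partial_deriv i f)) = deriv_coeff i (deriv_coeff i (cf f))" for i
    using cf_partial_deriv[OF spatially_periodic_partial_deriv[OF f(1)] d(2), of i i] c(3)[of i i]
    by (simp add: fun_eq_iff deriv_coeff_def continuous_periodic_def cf1)
  have cfg: "cf g n = - of_real ((norm (freq n))\<^sup>2) * cf f n" for n
    unfolding g_def by (subst cf_sum) (simp_all add: c cf2 deriv_coeff_twice_sum)
  have ms: "mean (\<lambda>x. (norm (h x))\<^sup>2) \<le> S\<^sup>2" if "continuous_periodic L h" "\<And>x. norm (h x) \<le> S" for h :: "real^3 \<Rightarrow> complex" and S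
    using mean_mono[OF continuous_periodic_norm_square[OF that(1)] continuous_periodic_const power_mono[OF that(2)]]
    by (simp add: mean_const)
  have s0: "(\<lambda>n. (norm (cf f n))\<^sup>2) summable_on UNIV" "(\<Sum>\<^sub>\<infinity>n. (norm (cf f n))\<^sup>2) \<le> S0\<^sup>2"
    using bessel[OF c(1)] ms[OF c(1) S0] by auto
  have s2: "(\<lambda>n. (norm (cf g n))\<^sup>2) summable_on UNIV" "(\<Sum>\<^sub>\<infinity>n. (norm (cf g n))\<^sup>2) \<le> S2\<^sup>2"
    using bessel[OF cg] ms[OF cg, of S2] S2 by (auto simp: g_def)
  define M where "M n = 4 * ((norm (cf f n))\<^sup>2 + (norm (cf g n))\<^sup>2) + 1 / 2 * (1 / (1 + norm (freq n)) ^ 4)" for n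
  have le: "norm (cf f n) \<le> M n" for n
  proof -
    define r y where "r = norm (freq n)" and "y = norm (cf f n)"
    have p: "0 < (1 + r)\<^sup>2" by (rule zero_less_power) (simp add: r_def add_pos_nonneg)
    have "2 * ((1 + r)\<^sup>2 * y) * (1 / (1 + r)\<^sup>2) \<le> ((1 + r)\<^sup>2 * y)\<^sup>2 + (1 / (1 + r)\<^sup>2)\<^sup>2" by (rule sum_squares_bound)
    moreover have "2 * ((1 + r)\<^sup>2 * y) * (1 / (1 + r)\<^sup>2) = 2 * y" using p by simp
    moreover have "(1 / (1 + r)\<^sup>2)\<^sup>2 = 1 / (1 + r) ^ 4" by (simp add: power_divide flip: power_mult)
    moreover have "((1 + r)\<^sup>2 * y)\<^sup>2 \<le> 8 * (y\<^sup>2 + (r\<^sup>2 * y)\<^sup>2)"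
    proof -
      have "(1 + r)\<^sup>2 \<le> 2 + 2 * r\<^sup>2" using power2_sum_le[of 1 r] by simp
      then have "((1 + r)\<^sup>2)\<^sup>2 \<le> (2 + 2 * r\<^sup>2)\<^sup>2" by (rule power_mono) simp
      also have "\<dots> \<le> 2 * 2\<^sup>2 + 2 * (2 * r\<^sup>2)\<^sup>2" by (rule power2_sum_le)
      finally have "((1 + r)\<^sup>2)\<^sup>2 \<le> 8 * (1 + (r\<^sup>2)\<^sup>2)" by (simp add: power_mult_distrib)
      then have "((1 + r)\<^sup>2)\<^sup>2 * y\<^sup>2 \<le> 8 * (1 + (r\<^sup>2)\<^sup>2) * y\<^sup>2" by (rule mult_right_mono) simp
      then show ?thesis by (simp add: power_mult_distrib algebra_simps)
    qed
    moreover have "norm (cf g n) = r\<^sup>2 * y" by (simp add: cfg r_def y_def norm_mult norm_power)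
    ultimately show ?thesis unfolding M_def r_def[symmetric] y_def[symmetric] by simp
  qed
  have Ms: "M summable_on UNIV"
    unfolding M_def by (intro summable_on_add summable_on_cmult_right s0 s2 lattice_summable)
  show cs: "cf f abs_summable_on UNIV" by (rule abs_summable_on_le[OF Ms le])
  have "(\<Sum>\<^sub>\<infinity>n. norm (cf f n)) \<le> (\<Sum>\<^sub>\<infinity>n. M n)" by (rule infsum_mono[OF cs Ms le])
  also have "\<dots> = 4 * ((\<Sum>\<^sub>\<infinity>n. (norm (cf f n))\<^sup>2) + (\<Sum>\<^sub>\<infinity>n. (norm (cf g n))\<^sup>2)) + 1 / 2 * lattice_const"
    unfolding M_def lattice_const_def
    by (subst infsum_add) (simp_all add: infsum_cmult_right' infsum_add s0 s2 lattice_summable summable_on_add summable_on_cmult_right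
        del: times_divide_eq_left times_divide_eq_right)
  also have "\<dots> \<le> 4 * (S0\<^sup>2 + S2\<^sup>2) + lattice_const / 2" using s0(2) s2(2) by simp
  finally show "(\<Sum>\<^sub>\<infinity>n. norm (cf f n)) \<le> 4 * (S0\<^sup>2 + S2\<^sup>2) + lattice_const / 2" .
qed

text \<open>The outer 3 counts the components. The Laplacian of a component is a sum of three second
  derivatives, each at most \<open>R / L\<^sup>2\<close> because of the powers of \<open>L\<close>
  in the norm.\<close>

definition coeff_bound :: "real \<Rightarrow> real" where
  "coeff_bound R = 3 * (4 * (R\<^sup>2 + (3 * (R / L\<^sup>2))\<^sup>2) + lattice_const / 2)"

lemma coeff_bound_nonneg: "0 \<le> coeff_bound R"
  by (simp add: coeff_bound_def lattice_const_def infsum_nonneg)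

lemma coeff_l1_bound:
  assumes u0: "u0 \<in> holder_space L k \<alpha>" and k: "2 \<le> k"
  shows "coeff u0 abs_summable_on UNIV"
    and "(\<Sum>\<^sub>\<infinity>n. norm (coeff u0 n)) \<le> coeff_bound (enn2real (holder_norm L k \<alpha> u0))"
proof -
  define R where "R = enn2real (holder_norm L k \<alpha> u0)"
  have per: "spatially_periodic L u0" and C2: "C_class 2 u0"
    using u0 C_class_le[OF _ k] by (auto simp: holder_space_def)
  define U where "U j x = complex_of_real (u0 x $ j)" for j x
  have bl: "bounded_linear (\<lambda>v :: real^3. complex_of_real (v $ j))" for j
    by (rule bounded_linear_compose[OF bounded_linear_of_real bounded_linear_vec_nth])
  have d: "u0 differentiable (at x)" "partial_deriv i u0 differentiable (at x)" for x i
    using C2 by (simp_all add: numeral_2_eq_2)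
  have p1: "partial_deriv i (U j) = (\<lambda>x. of_real (partial_deriv i u0 x $ j))" for i j
    using partial_deriv_bounded_linear[OF bl d(1)] by (simp add: U_def[abs_def] fun_eq_iff)
  have p2: "partial_deriv i (partial_deriv i (U j)) = (\<lambda>x. of_real (partial_deriv i (partial_deriv i u0) x $ j))" for i j
    unfolding p1 using partial_deriv_bounded_linear[OF bl d(2)] by (simp add: fun_eq_iff)
  have UC: "C_class 2 (U j)" for j
    using C_class_bounded_linear[OF bl C2] by (simp add: U_def[abs_def])
  have Up: "spatially_periodic L (U j)" for j using per by (simp add: U_def spatially_periodic_def)
  have S0: "norm (U j x) \<le> R" for j x
  proof -
    have "norm (U j x) \<le> norm (u0 x)" by (simp add: U_def component_le_norm_cart)
    also have "\<dots> \<le> R" using multi_deriv_le_holder_norm[OF u0, of 0 x] by (simp add: multi_deriv_0 mi_order_def R_def)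
    finally show ?thesis .
  qed
  have S2: "norm (\<Sum>i\<in>UNIV. partial_deriv i (partial_deriv i (U j)) x) \<le> 3 * (R / L\<^sup>2)" for j x
  proof -
    have "norm (\<Sum>i\<in>UNIV. partial_deriv i (partial_deriv i (U j)) x) \<le> (\<Sum>i\<in>(UNIV::3 set). R / L\<^sup>2)"
    proof (rule sum_norm_le)
      fix i
      have "norm (partial_deriv i (partial_deriv i (U j)) x) \<le> norm (partial_deriv i (partial_deriv i u0) x)"
        unfolding p2 by (simp add: component_le_norm_cart)
      also have "\<dots> \<le> R / L\<^sup>2"
        using multi_deriv_le_holder_norm[OF u0, of "axis i 2" x] k by (simp add: multi_deriv_axis2 mi_order_axis R_def)
      finally show "norm (partial_deriv i (partial_deriv i (U j)) x) \<le> R / L\<^sup>2" .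
    qed
    then show ?thesis by simp
  qed
  note b = cf_l1_bound[OF Up UC S0 S2]
  have le: "norm (coeff u0 n) \<le> (\<Sum>j\<in>UNIV. norm (cf (U j) n))" for n
    unfolding coeff_def norm_vec_def U_def[abs_def] using L2_set_le_sum[of UNIV "\<lambda>j. norm (cf (\<lambda>x. complex_of_real (u0 x $ j)) n)"]
    by simp
  have s: "(\<lambda>n. \<Sum>j\<in>UNIV. norm (cf (U j) n)) summable_on UNIV" by (rule summable_on_sum[OF b(1)])
  show cs: "coeff u0 abs_summable_on UNIV" by (rule abs_summable_on_le[OF s le])
  have "(\<Sum>\<^sub>\<infinity>n. norm (coeff u0 n)) \<le> (\<Sum>\<^sub>\<infinity>n. \<Sum>j\<in>UNIV. norm (cf (U j) n))" by (rule infsum_mono[OF cs s le])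
  also have "\<dots> = (\<Sum>j\<in>UNIV. \<Sum>\<^sub>\<infinity>n. norm (cf (U j) n))" by (rule infsum_sum[OF b(1)])
  also have "\<dots> \<le> (\<Sum>j\<in>(UNIV::3 set). 4 * (R\<^sup>2 + (3 * (R / L\<^sup>2))\<^sup>2) + lattice_const / 2)" by (intro sum_mono b(2))
  finally show "(\<Sum>\<^sub>\<infinity>n. norm (coeff u0 n)) \<le> coeff_bound (enn2real (holder_norm L k \<alpha> u0))"
    by (simp add: coeff_bound_def R_def)
qed

text \<open>A class of fields closed under partial derivatives, and hence under every
  \<open>multi_deriv\<close>; it contains the velocity at positive times, and each member is bounded
  and Lipschitz.\<close>

definition smooth_field :: "(real^3 \<Rightarrow> real^3) \<Rightarrow> bool" where
  "smooth_field f \<longleftrightarrow> (\<exists>c. (\<forall>j k. weighted_summable k (c j)) \<and> f = (\<lambda>x. \<chi> j. Re (series (c j) x)))"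

lemma smooth_fieldE:
  assumes "smooth_field f"
  obtains c where "\<And>j k. weighted_summable k (c j)" "f = (\<lambda>x. \<chi> j. Re (series (c j) x))"
  using assms unfolding smooth_field_def by blast

lemma smooth_field_partial_deriv:
  assumes "smooth_field f" shows "smooth_field (partial_deriv i f)"
proof -
  obtain c where c: "\<And>j k. weighted_summable k (c j)" "f = (\<lambda>x. \<chi> j. Re (series (c j) x))"
    using smooth_fieldE[OF assms] by metis
  have d: "series (c j) differentiable (at x)" for j x
    using has_derivative_series[OF c(1)] differentiable_def by blast
  have dR: "(\<lambda>x. Re (series (c j) x)) differentiable (at x)" for j x
    using d[of j x] bounded_linear.has_derivative[OF bounded_linear_Re] unfolding differentiable_def by blast
  have "partial_deriv i f x = (\<chi> j. Re (series (deriv_coeff i (c j)) x))" for x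
    unfolding c(2) by (simp add: partial_deriv_vec_lambda(1)[OF dR] partial_deriv_bounded_linear[OF bounded_linear_Re d] partial_deriv_series[OF c(1)])
  then show ?thesis
    unfolding smooth_field_def using weighted_summable_deriv[OF c(1)]
    by (intro exI[of _ "\<lambda>j. deriv_coeff i (c j)"]) (simp add: fun_eq_iff)
qed

lemma smooth_field_multi_deriv: assumes "smooth_field f" shows "smooth_field (multi_deriv m f)"
proof -
  have "smooth_field ((partial_deriv i ^^ j) f)" if "smooth_field f" for i j f
    by (induction j) (use that in \<open>auto intro: smooth_field_partial_deriv\<close>)
  then show ?thesis using assms by (simp add: multi_deriv_def)
qed

lemma smooth_field_periodic: "smooth_field f \<Longrightarrow> continuous_periodic L f"
proof -
  assume "smooth_field f"
  then obtain c where c: "\<And>j k. weighted_summable k (c j)" "f = (\<lambda>x. \<chi> j. Re (series (c j) x))"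
    using smooth_fieldE by metis
  have "continuous_periodic L (series (c j))" for j
    by (rule continuous_periodic_series[OF weighted_summable_abs[OF c(1)]])
  then show ?thesis
    unfolding c(2) continuous_periodic_def by (auto simp: spatially_periodic_def intro!: continuous_intros continuous_on_vec_lambda)
qed

lemma smooth_field_Lipschitz:
  assumes "smooth_field f" obtains K where "K \<ge> 0" "\<And>x y. norm (f x - f y) \<le> K * norm (x - y)"
proof -
  obtain c where c: "\<And>j k. weighted_summable k (c j)" "f = (\<lambda>x. \<chi> j. Re (series (c j) x))"
    using smooth_fieldE[OF assms] by metis
  define K where "K j = (\<Sum>\<^sub>\<infinity>n. (1 + norm (freq n)) * norm (c j n))" for j
  have s: "(\<lambda>n. (1 + norm (freq n)) * norm (c j n)) summable_on UNIV" for j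
    using c(1)[of 1 j] by (simp add: weighted_summable_def)
  have K0: "0 \<le> K j" for j unfolding K_def by (intro infsum_nonneg) simp
  have lip: "norm (series (c j) x - series (c j) y) \<le> K j * norm (x - y)" for j x y
  proof (rule differentiable_bound[OF convex_UNIV has_derivative_series[OF c(1)]])
    fix z
    show "onorm (\<lambda>h. \<Sum>\<^sub>\<infinity>n. c j n * (\<i> * of_real (freq n \<bullet> h) * wave n z)) \<le> K j"
    proof (rule onorm_bound[OF K0])
      fix h
      have "norm (\<Sum>\<^sub>\<infinity>n. c j n * (\<i> * of_real (freq n \<bullet> h) * wave n z)) \<le> (\<Sum>\<^sub>\<infinity>n. (1 + norm (freq n)) * norm (c j n) * norm h)"
      proof (rule norm_infsum_le_infsum[OF summable_on_cmult_left[OF s]])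
        fix n
        have "\<bar>freq n \<bullet> h\<bar> \<le> (1 + norm (freq n)) * norm h"
          using Cauchy_Schwarz_ineq2[of "freq n" h] by (smt (verit) mult_right_mono norm_ge_zero)
        then have "norm (c j n) * \<bar>freq n \<bullet> h\<bar> \<le> norm (c j n) * ((1 + norm (freq n)) * norm h)"
          by (rule mult_left_mono) simp
        then show "norm (c j n * (\<i> * of_real (freq n \<bullet> h) * wave n z)) \<le> (1 + norm (freq n)) * norm (c j n) * norm h"
          by (simp add: norm_mult mult_ac)
      qed
      then show "norm (\<Sum>\<^sub>\<infinity>n. c j n * (\<i> * of_real (freq n \<bullet> h) * wave n z)) \<le> K j * norm h"
        by (simp add: K_def infsum_cmult_left')
    qed
  qed auto
  have "norm (f x - f y) \<le> (\<Sum>j\<in>UNIV. K j) * norm (x - y)" for x y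
  proof -
    have "norm (f x - f y) \<le> (\<Sum>j\<in>UNIV. \<bar>(f x - f y) $ j\<bar>)" by (rule norm_le_l1_cart)
    also have "\<dots> \<le> (\<Sum>j\<in>UNIV. K j * norm (x - y))"
    proof (rule sum_mono)
      fix j
      have "\<bar>(f x - f y) $ j\<bar> = \<bar>Re (series (c j) x - series (c j) y)\<bar>" by (simp add: c(2))
      also have "\<dots> \<le> norm (series (c j) x - series (c j) y)" by (rule abs_Re_le_cmod)
      also note lip
      finally show "\<bar>(f x - f y) $ j\<bar> \<le> K j * norm (x - y)" .
    qed
    finally show ?thesis by (simp add: sum_distrib_right)
  qed
  then show ?thesis using that[of "\<Sum>j\<in>UNIV. K j"] by (simp add: sum_nonneg K0)
qed

text \<open>The Lipschitz bound leaves the factor \<open>norm (x - y) powr (1 - \<alpha>)\<close>,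
  which is bounded on the cube since the exponent is positive; \<open>3 * L\<close> is a crude bound
  for the diameter.\<close>

lemma smooth_field_holder_seminorm:
  assumes f: "smooth_field f" and \<alpha>: "0 < \<alpha>" "\<alpha> < 1" shows "holder_seminorm L \<alpha> f < top"
proof -
  obtain K where K: "K \<ge> 0" "\<And>x y. norm (f x - f y) \<le> K * norm (x - y)" using smooth_field_Lipschitz[OF f] by blast
  have "L powr \<alpha> * (norm (f x - f y) / norm (x - y) powr \<alpha>) \<le> L powr \<alpha> * (K * (3 * L) powr (1 - \<alpha>))"
    if "x \<in> period_cube L" "y \<in> period_cube L" for x y
  proof (cases "x = y")
    case False
    then have p: "norm (x - y) > 0" by simp
    have "norm (x - y) \<le> (\<Sum>i\<in>UNIV. \<bar>(x - y) $ i\<bar>)" by (rule norm_le_l1_cart)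
    also have "\<dots> \<le> (\<Sum>i\<in>(UNIV::3 set). L)"
    proof (rule sum_mono)
      fix i
      have "0 \<le> x $ i" "x $ i \<le> L" "0 \<le> y $ i" "y $ i \<le> L"
        using that by (auto simp: period_cube_def mem_box_cart)
      then show "\<bar>(x - y) $ i\<bar> \<le> L" by (simp add: abs_le_iff)
    qed
    finally have n3: "norm (x - y) \<le> 3 * L" by simp
    have "norm (f x - f y) / norm (x - y) powr \<alpha> \<le> K * norm (x - y) / norm (x - y) powr \<alpha>"
      by (intro divide_right_mono K) simp
    also have "\<dots> = K * norm (x - y) powr (1 - \<alpha>)" using p by (simp add: powr_diff)
    also have "\<dots> \<le> K * (3 * L) powr (1 - \<alpha>)" using K(1) n3 p \<alpha> by (intro mult_left_mono powr_mono2) auto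
    finally show ?thesis by (intro mult_left_mono) auto
  qed (use K in simp)
  then have "holder_seminorm L \<alpha> f \<le> ennreal (L powr \<alpha> * (K * (3 * L) powr (1 - \<alpha>)))"
    unfolding holder_seminorm_def by (intro SUP_least ennreal_leI)
  then show ?thesis by (rule le_less_trans) simp
qed

lemma smooth_field_holder_norm:
  assumes f: "smooth_field f" and \<alpha>: "0 < \<alpha>" "\<alpha> < 1" shows "holder_norm L k \<alpha> f < top"
proof -
  have "(SUP x\<in>period_cube L. ennreal (norm (multi_deriv m f x))) < top" for m
  proof -
    obtain M where M: "\<And>x. norm (multi_deriv m f x) \<le> M"
      using continuous_periodic_bounded[OF smooth_field_periodic[OF smooth_field_multi_deriv[OF f]]] by metis
    then have "(SUP x\<in>period_cube L. ennreal (norm (multi_deriv m f x))) \<le> ennreal M"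
      by (intro SUP_least ennreal_leI)
    then show ?thesis by (rule le_less_trans) simp
  qed
  then have "Ck_norm L k f < top"
    unfolding Ck_norm_def by (simp add: finite_mi_order_le ennreal_mult_less_top)
  moreover have "(\<Sum>m | mi_order m = k. ennreal (L ^ k) * holder_seminorm L \<alpha> (multi_deriv m f)) < top"
    using smooth_field_holder_seminorm[OF smooth_field_multi_deriv[OF f] \<alpha>]
    by (simp add: finite_mi_order_eq ennreal_mult_less_top)
  ultimately show ?thesis by (simp add: holder_norm_def)
qed

end

context navier_stokes_data
begin

definition velocity :: "real \<Rightarrow> real^3 \<Rightarrow> real^3" where "velocity t x = (\<chi> j. Re (vel j t x))"

definition pressure :: "real \<Rightarrow> real^3 \<Rightarrow> real" where "pressure t x = Re (press t x)"

lemma velocity_0: "velocity 0 = u0"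
  by (simp add: velocity_def fun_eq_iff vec_eq_iff vel_0 U0_def)

lemma Re_vel_differentiable:
  assumes "t \<in> {0..T}"
  shows "(\<lambda>x. Re (vel j t x)) differentiable (at x)" "(\<lambda>x. Re (partial_deriv i (vel j t) x)) differentiable (at x)"
  using vel_differentiable(1)[OF assms, of j x] vel_differentiable(2)[OF assms, of i j x]
    bounded_linear.has_derivative[OF bounded_linear_Re] unfolding differentiable_def by blast+

lemma partial_velocity:
  assumes t: "t \<in> {0..T}"
  shows "partial_deriv i (velocity t) = (\<lambda>x. \<chi> j. Re (partial_deriv i (vel j t) x))"
    and "partial_deriv l (partial_deriv i (velocity t)) = (\<lambda>x. \<chi> j. Re (partial_deriv l (partial_deriv i (vel j t)) x))"
proof -
  show 1: "partial_deriv i (velocity t) = (\<lambda>x. \<chi> j. Re (partial_deriv i (vel j t) x))" for i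
    unfolding velocity_def[abs_def]
    by (simp add: fun_eq_iff partial_deriv_vec_lambda(1)[OF Re_vel_differentiable(1)[OF t]]
        partial_deriv_bounded_linear[OF bounded_linear_Re vel_differentiable(1)[OF t]])
  show "partial_deriv l (partial_deriv i (velocity t)) = (\<lambda>x. \<chi> j. Re (partial_deriv l (partial_deriv i (vel j t)) x))"
    unfolding 1
    by (simp add: fun_eq_iff partial_deriv_vec_lambda(1)[OF Re_vel_differentiable(2)[OF t]]
        partial_deriv_bounded_linear[OF bounded_linear_Re vel_differentiable(2)[OF t]])
qed

lemma grad_pressure: "t \<in> {0..T} \<Longrightarrow> grad (pressure t) x $ j = Re (partial_deriv j (press t) x)"
  using partial_deriv_bounded_linear[OF bounded_linear_Re, of "press t" x j] press_C1[of t]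
  by (simp add: grad_def pressure_def[abs_def])

theorem velocity_solution: "navier_stokes_solution L \<nu> T u0 velocity pressure"
  unfolding navier_stokes_solution_def
proof (intro conjI ballI allI)
  show "velocity 0 = u0" by (rule velocity_0)
  fix t assume t: "t \<in> {0..T}"
  show "spatially_periodic L (velocity t)"
    using vel_periodic[OF t] by (simp add: velocity_def spatially_periodic_def)
  show "C_class 2 (velocity t)"
    unfolding velocity_def[abs_def] by (intro C_class_vec_lambda C_class_bounded_linear[OF bounded_linear_Re] vel_C2 t)
  show "spatially_periodic L (pressure t)"
    using press_continuous_periodic[OF t] by (simp add: pressure_def spatially_periodic_def continuous_periodic_def)
  show "C_class 1 (pressure t)"
    unfolding pressure_def[abs_def] by (intro C_class_bounded_linear[OF bounded_linear_Re] press_C1 t)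
  fix x
  have "divergence (velocity t) x = Re (\<Sum>i\<in>UNIV. partial_deriv i (vel i t) x)"
    by (simp add: divergence_def partial_velocity(1)[OF t])
  then show "divergence (velocity t) x = 0" by (simp add: div_vel[OF t])
  define D where "D j = Re (of_real \<nu> * lap j t x - force j t x)" for j
  have "((\<lambda>s. Re (vel j s x)) has_derivative (\<lambda>h. h * D j)) (at t within {0..T})" for j
    using bounded_linear.has_vector_derivative[OF bounded_linear_Re vel_equation[OF t, of j x]]
    by (simp add: has_vector_derivative_def D_def)
  from has_derivative_vec_lambda[OF this]
  have deriv: "((\<lambda>s. velocity s x) has_vector_derivative (\<chi> j. D j)) (at t within {0..T})"
    unfolding has_vector_derivative_def velocity_def
    by (rule has_derivative_eq_rhs) (simp add: fun_eq_iff vec_eq_iff)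
  \<comment> \<open>The real part of a product is the product of the real parts only because the
    velocity factor in the convection term is real.\<close>
  have "Im (vel i t x) = 0" for i
    using vel_real[OF t, of i x] by (simp add: complex_eq_iff)
  then have "Re (conv_term j t x) = convection (velocity t) (velocity t) x $ j" for j
    by (simp add: conv_term_def convection_def partial_velocity(1)[OF t]) (simp add: velocity_def)
  moreover have "Re (lap j t x) = laplacian (velocity t) x $ j" for j
    by (simp add: lap_def laplacian_def partial_velocity(2)[OF t])
  ultimately have "(\<chi> j. D j) + convection (velocity t) (velocity t) x - \<nu> *\<^sub>R laplacian (velocity t) x + grad (pressure t) x = 0"
    by (simp add: vec_eq_iff D_def force_def grad_pressure[OF t])
  with deriv show "\<exists>u'. ((\<lambda>s. velocity s x) has_vector_derivative u') (at t within {0..T}) \<and>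
      u' + convection (velocity t) (velocity t) x - \<nu> *\<^sub>R laplacian (velocity t) x + grad (pressure t) x = 0"
    by blast
qed

text \<open>At \<open>t = 0\<close> the field is the datum, which has the regularity by assumption;
  at later times it is smooth.\<close>

lemma velocity_holder_space:
  assumes t: "t \<in> {0..T}" and u0: "u0 \<in> holder_space L k \<alpha>" and \<alpha>: "0 < \<alpha>" "\<alpha> < 1"
  shows "velocity t \<in> holder_space L k \<alpha>"
proof (cases "t = 0")
  case True then show ?thesis using u0 by (simp add: velocity_0)
next
  case False
  then have t': "0 < t" "t \<le> T" using t by auto
  have "smooth_field (velocity t)"
    unfolding smooth_field_def velocity_def[abs_def] vel_def
    by (intro exI[of _ "\<lambda>j. vc j t"]) (simp add: vc_weighted_summable[OF t'])
  then have "holder_norm L k \<alpha> (velocity t) < top" by (rule smooth_field_holder_norm[OF _ \<alpha>])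
  moreover have "C_class k (velocity t)"
    unfolding velocity_def[abs_def] by (intro C_class_vec_lambda C_class_bounded_linear[OF bounded_linear_Re] vel_C_class t')
  moreover have "spatially_periodic L (velocity t)"
    using vel_periodic[OF t] by (simp add: velocity_def spatially_periodic_def)
  ultimately show ?thesis by (simp add: holder_space_def)
qed

end

text \<open>The dependence of the existence time is expressed by the order of quantifiers:
  \<open>T\<close> is chosen before the datum, after \<open>k\<close>, \<open>\<alpha>\<close>,
  \<open>L\<close> and \<open>\<nu>\<close>, and sees the datum only through the value of its
  norm.\<close>

theorem theorem5p4:
  fixes k :: nat and \<alpha> L \<nu> :: real
  assumes "k \<ge> 2" and "0 < \<alpha>" and "\<alpha> < 1" and "L > 0" and "\<nu> > 0"
  shows "\<exists>T :: real \<Rightarrow> real.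
    \<forall>u0 :: real^3 \<Rightarrow> real^3.
      u0 \<in> holder_space L k \<alpha> \<and> (\<forall>x. divergence u0 x = 0) \<longrightarrow>
      (let \<tau> = T (enn2real (holder_norm L k \<alpha> u0)) in
        \<tau> > 0 \<and>
        (\<exists>(u :: real \<Rightarrow> real^3 \<Rightarrow> real^3) (p :: real \<Rightarrow> real^3 \<Rightarrow> real).
          (\<forall>t\<in>{0..\<tau>}. u t \<in> holder_space L k \<alpha>) \<and>
          navier_stokes_solution L \<nu> \<tau> u0 u p))"
proof -
  interpret periodic_box L by unfold_locales (rule assms(4))
  \<comment> \<open>The second entry solves
    \<open>72 * sqrt (2 * T / \<nu>) * (1 + coeff_bound R) = 1\<close> for \<open>T\<close>. Adding
    1 to the bound keeps the denominator positive, and the first entry is the limit needed for the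
    cost of the exponential weight.\<close>
  define T where "T R = min (2 * \<nu>) (\<nu> / (2 * (72 * (1 + coeff_bound R))\<^sup>2))" for R
  show ?thesis
  proof (intro exI[of _ T] allI impI)
    fix u0 :: "real^3 \<Rightarrow> real^3"
    assume u0: "u0 \<in> holder_space L k \<alpha> \<and> (\<forall>x. divergence u0 x = 0)"
    define R where "R = enn2real (holder_norm L k \<alpha> u0)"
    define A where "A = coeff_bound R"
    have A: "0 \<le> A" by (simp add: A_def coeff_bound_nonneg)
    have T_pos: "0 < T R" using assms(5) A by (simp add: T_def A_def[symmetric])
    interpret navier_stokes_data L u0 \<nu> "T R"
    proof
      show "0 < \<nu>" "0 < T R" "T R \<le> 2 * \<nu>" using assms(5) T_pos by (simp_all add: T_def)
      show "spatially_periodic L u0" "C_class 2 u0" "divergence u0 x = 0" for x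
        using u0 C_class_le[OF _ assms(1)] by (auto simp: holder_space_def)
      show "coeff u0 abs_summable_on UNIV" using u0 assms(1) by (intro coeff_l1_bound) auto
      have le: "(\<Sum>\<^sub>\<infinity>n. norm (coeff u0 n)) \<le> A"
        unfolding A_def R_def using u0 assms(1) by (intro coeff_l1_bound) auto
      have "2 * T R / \<nu> \<le> (1 / (72 * (1 + A)))\<^sup>2"
      proof -
        have "T R \<le> \<nu> / (2 * (72 * (1 + A))\<^sup>2)" by (simp add: T_def A_def)
        then have "2 * T R / \<nu> \<le> 2 * (\<nu> / (2 * (72 * (1 + A))\<^sup>2)) / \<nu>"
          using assms(5) by (intro divide_right_mono mult_left_mono) auto
        also have "\<dots> = (1 / (72 * (1 + A)))\<^sup>2" using assms(5) by (simp add: power_divide)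
        finally show ?thesis .
      qed
      then have "sqrt (2 * T R / \<nu>) \<le> 1 / (72 * (1 + A))" using A by (intro real_le_lsqrt) auto
      then have "72 * sqrt (2 * T R / \<nu>) * (\<Sum>\<^sub>\<infinity>n. norm (coeff u0 n)) \<le> 72 * (1 / (72 * (1 + A))) * A"
        using le A T_pos assms(5) by (intro mult_mono) (auto simp: infsum_nonneg)
      also have "\<dots> \<le> 1" using A by (simp add: divide_le_eq)
      finally show "72 * sqrt (2 * T R / \<nu>) * (\<Sum>\<^sub>\<infinity>n. norm (coeff u0 n)) \<le> 1" .
    qed
    show "let \<tau> = T (enn2real (holder_norm L k \<alpha> u0)) in
        \<tau> > 0 \<and>
        (\<exists>(u :: real \<Rightarrow> real^3 \<Rightarrow> real^3) (p :: real \<Rightarrow> real^3 \<Rightarrow> real).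
          (\<forall>t\<in>{0..\<tau>}. u t \<in> holder_space L k \<alpha>) \<and>
          navier_stokes_solution L \<nu> \<tau> u0 u p)"
      unfolding Let_def R_def[symmetric]
    proof (intro conjI exI ballI)
      show "velocity t \<in> holder_space L k \<alpha>" if "t \<in> {0..T R}" for t
        using u0 assms that by (intro velocity_holder_space) auto
    qed (rule T_pos velocity_solution)+
  qed
qed

end
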